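(* Let $\tau:I\to I$ be piecewise monotonic and transitive and not essentially injective, and let $\sigma:X\to X$ be the associated local homeomorphism. Let $X_1,\ldots,X_N$ be the unique partition of $X$ into clopen sets with $\sigma(X_i)=X_{i+1\bmod N}$ and $\sigma^N|_{X_i}$ topologically exact for each $i$, and let $DG(\tau)=\bigoplus_iG_i$ be the corresponding decomposition, where $G_i=\{[f]\in DG(\tau)\mid\operatorname{supp}f\subset X_i\}$. Let $\mu$ be the unique probability measure on $X$ scaled by $\sigma$, with scaling factor $s$. Then we have an isomorphism of dimension groups given by $$DG(\tau)/DG(\tau)_{\rm inf}\;\cong\;\bigoplus_iG_i/(G_i)_{\rm inf}\;\cong\;\bigoplus_i\mu(G_i),$$ where each $G_i/(G_i)_{\rm inf}$ has the quotient ordering, and $\bigoplus_i\mu(G_i)$ has the ordering inherited from $\mathbb R^N$ (coordinatewise order). An isomorphism from $DG(\tau)/DG(\tau)_{\rm inf}$ onto $\bigoplus_i\mu(G_i)$ is given by $\Psi([f])=\bigoplus_i\mu(f\chi_{X_i})$, and $\Psi$ carries the order automorphism induced by $\mathcal L_*$ on $DG(\tau)/DG(\tau)_{\rm inf}$ to the order automorphism of $\bigoplus_i\mu(G_i)$ given by $$(\lambda_1,\lambda_2,\ldots,\lambda_N)\mapsto(s\lambda_N,s\lambda_1,\ldots,s\lambda_{N-1}).$$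
   Context: Let $I=[0,1]$. A (not necessarily continuous) map $\tau:I\to I$ is piecewise monotonic if there are points $0=a_0<a_1<\dots<a_n=1$ such that each $\tau|_{(a_{i-1},a_i)}$ is continuous and strictly monotonic; the points are chosen so that no $(a_{i-1},a_i)$ is contained in a larger open interval on which $\tau$ is continuous and strictly monotonic. Then $\{a_0,\dots,a_n\}$ is the partition associated with $\tau$, and $\tau_i:[a_{i-1},a_i]\to I$ denotes the continuous extension of $\tau|_{(a_{i-1},a_i)}$. Actual values of $\tau$ at partition points of discontinuity are ignored: $\widehat\tau(x)$ is the set of left and right limits of $\tau$ at $x$, $\widehat\tau(A)=\bigcup_i\tau_i(A\cap[a_{i-1},a_i])$, and $\widehat\tau^{-1}(A)=\bigcup_i\{x\in[a_{i-1},a_i]:\tau_i(x)\in A\}$. $\tau$ (viewed as undefined at the partition points) is transitive if for all non-empty open $U,V\subset I$ there is $n\ge 0$ with $\tau^n(U)\cap V\ne\emptyset$. $\tau$ is essentially injective if there are no disjoint (nondegenerate) intervals $J,J'$ with $\tau(J)=\tau(J')$; equivalently, $\tau$ is injective on the complement of the set of partition points. The generalized orbit of $x\in I$ is the smallest subset of $I$ containing $x$ that is forward and backward invariant under $\widehat\tau$. $I_1$ is the union of the generalized orbits of $a_0,\dots,a_n$, and $I_0=I\setminus I_1$. $X$ is the totally ordered set obtained from $I$ by replacing each $x\in I_1\setminus\{0,1\}$ by two points $x^-<x^+$, with the order topology (homeomorphic to a compact subset of $\mathbb R$); $\pi:X\to I$ is the collapse map ($\pi(x^\pm)=x$), and $X_0=\pi^{-1}(I_0)$.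 The local homeomorphism associated with $\tau$ is the unique continuous map $\sigma:X\to X$ with $\pi\circ\sigma=\tau\circ\pi$ on $X_0$. Let $(\mathcal L f)(x)=\sum_{\sigma y=x}f(y)$ for $f\in C(X,\mathbb Z)$. $DG(\tau)$ is $C(X,\mathbb Z)$ modulo $f\sim g$ iff $\mathcal L^nf=\mathcal L^ng$ for some $n\ge0$, ordered by $[f]\ge0$ iff $\mathcal L^nf\ge0$ for some $n$; it is a dimension group with distinguished order unit $[1]$, and $\mathcal L_*[f]=[\mathcal Lf]$. The map $[f]\mapsto\bigoplus_i[f\chi_{X_i}]$ is a dimension group isomorphism $DG(\tau)\cong\bigoplus_iG_i$, each $G_i$ having the inherited order and order unit $[\chi_{X_i}]$. A probability measure $\mu$ on $X$ is scaled by $\sigma$ by a factor $s>0$ if $\mu(\sigma(E))=s\mu(E)$ for all Borel sets $E$ on which $\sigma$ is one-to-one. It induces the well-defined homomorphism $[f]\mapsto\mu(f)=\int f\,d\mu$ on $DG(\tau)$, and $\mu(G_i)$ is the image of $G_i$. Under the hypotheses of the claim the partition and the scaled measure exist and are unique. A continuous map $g:Y\to Y$ is topologically exact if for each non-empty open $V\subset Y$ there is $n\ge0$ with $g^n(V)=Y$. For a dimension group $G$ with order unit $e$, $x\in G$ is infinitesimal if $-e\le nx\le e$ for all integers $n\ge0$ (independent of the choice of $e$), and $G_{\rm inf}$ is the subgroup of infinitesimals. In a quotient $G/H$, the positive cone is the image of the positive cone of $G$. Indices mod $N$ are taken in $\{1,\dots,N\}$. An isomorphism of dimension groups is a group isomorphism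 that is also an order isomorphism. *)

theory Defs
  imports "HOL-Probability.Probability_Measure" "HOL-Algebra.Product_Groups"
begin

section \<open>Piecewise monotonic maps of the unit interval\<close>

text \<open>A map of \<open>I = [0,1]\<close> is a function \<open>\<tau> :: real \<Rightarrow> real\<close> whose values outside \<open>I\<close> are
  irrelevant.\<close>

definition cont_strict_monotonic :: "(real \<Rightarrow> real) \<Rightarrow> real \<Rightarrow> real \<Rightarrow> bool" where
  "cont_strict_monotonic \<tau> c d \<longleftrightarrow>
     continuous_on {c<..<d} \<tau> \<and>
     (strict_mono_on {c<..<d} \<tau> \<or> strict_antimono_on {c<..<d} \<tau>)"

definition monotonicity_points :: "(real \<Rightarrow> real) \<Rightarrow> nat \<Rightarrow> (nat \<Rightarrow> real) \<Rightarrow> bool" where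
  "monotonicity_points \<tau> n a \<longleftrightarrow>
     0 < n \<and> a 0 = 0 \<and> a n = 1 \<and>
     (\<forall>i<n. a i < a (Suc i) \<and> cont_strict_monotonic \<tau> (a i) (a (Suc i)))"

definition piecewise_monotonic :: "(real \<Rightarrow> real) \<Rightarrow> bool" where
  "piecewise_monotonic \<tau> \<longleftrightarrow>
     \<tau> \<in> {0..1} \<rightarrow> {0..1} \<and> (\<exists>n a. monotonicity_points \<tau> n a)"

definition associated_partition :: "(real \<Rightarrow> real) \<Rightarrow> nat \<Rightarrow> (nat \<Rightarrow> real) \<Rightarrow> bool" where
  "associated_partition \<tau> n a \<longleftrightarrow>
     monotonicity_points \<tau> n a \<and>
     (\<forall>i<n. \<not> (\<exists>c d. {c<..<d} \<subseteq> {0..1} \<and> {a i<..<a (Suc i)} \<subset> {c<..<d} \<and>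
                      cont_strict_monotonic \<tau> c d))"

definition partition_set :: "nat \<Rightarrow> (nat \<Rightarrow> real) \<Rightarrow> real set" where
  "partition_set n a = a ` {..n}"

text \<open>\<open>branch \<tau> a i\<close> is the continuous extension of \<open>\<tau>\<close> to the closed interval
  \<open>[a\<^sub>i, a\<^sub>i\<^sub>+\<^sub>1]\<close>, for \<open>i < n\<close>.\<close>

definition branch :: "(real \<Rightarrow> real) \<Rightarrow> (nat \<Rightarrow> real) \<Rightarrow> nat \<Rightarrow> real \<Rightarrow> real" where
  "branch \<tau> a i x =
     (if x = a i then Lim (at_right x) \<tau>
      else if x = a (Suc i) then Lim (at_left x) \<tau>
      else \<tau> x)"

definition hat_image ::
  "(real \<Rightarrow> real) \<Rightarrow> nat \<Rightarrow> (nat \<Rightarrow> real) \<Rightarrow> real set \<Rightarrow> real set" where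
  "hat_image \<tau> n a A = (\<Union>i<n. branch \<tau> a i ` (A \<inter> {a i..a (Suc i)}))"

definition hat_preimage ::
  "(real \<Rightarrow> real) \<Rightarrow> nat \<Rightarrow> (nat \<Rightarrow> real) \<Rightarrow> real set \<Rightarrow> real set" where
  "hat_preimage \<tau> n a A = (\<Union>i<n. {x \<in> {a i..a (Suc i)}. branch \<tau> a i x \<in> A})"

text \<open>Transitivity and essential injectivity regard \<open>\<tau>\<close> as undefined at the partition
  points, so the image of a set \<open>A\<close> is \<open>\<tau> ` (A - P)\<close> with \<open>P\<close> the partition set.\<close>

definition transitive_map :: "(real \<Rightarrow> real) \<Rightarrow> nat \<Rightarrow> (nat \<Rightarrow> real) \<Rightarrow> bool" where
  "transitive_map \<tau> n a \<longleftrightarrow>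
     (\<forall>U V. openin (top_of_set {0..1}) U \<and> U \<noteq> {} \<and> openin (top_of_set {0..1}) V \<and> V \<noteq> {} \<longrightarrow>
        (\<exists>k. ((\<lambda>A. \<tau> ` (A - partition_set n a)) ^^ k) U \<inter> V \<noteq> {}))"

definition nondegenerate_interval :: "real set \<Rightarrow> bool" where
  "nondegenerate_interval J \<longleftrightarrow> is_interval J \<and> (\<exists>x\<in>J. \<exists>y\<in>J. x < y)"

definition essentially_injective :: "(real \<Rightarrow> real) \<Rightarrow> nat \<Rightarrow> (nat \<Rightarrow> real) \<Rightarrow> bool" where
  "essentially_injective \<tau> n a \<longleftrightarrow>
     \<not> (\<exists>J J'. J \<subseteq> {0..1} \<and> J' \<subseteq> {0..1} \<and>
              nondegenerate_interval J \<and> nondegenerate_interval J' \<and> J \<inter> J' = {} \<and>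
              \<tau> ` (J - partition_set n a) = \<tau> ` (J' - partition_set n a))"

definition generalized_orbit ::
  "(real \<Rightarrow> real) \<Rightarrow> nat \<Rightarrow> (nat \<Rightarrow> real) \<Rightarrow> real \<Rightarrow> real set" where
  "generalized_orbit \<tau> n a x =
     \<Inter> {A. A \<subseteq> {0..1} \<and> x \<in> A \<and> hat_image \<tau> n a A \<subseteq> A \<and> hat_preimage \<tau> n a A \<subseteq> A}"

definition I\<^sub>1 :: "(real \<Rightarrow> real) \<Rightarrow> nat \<Rightarrow> (nat \<Rightarrow> real) \<Rightarrow> real set" where
  "I\<^sub>1 \<tau> n a = (\<Union>i\<le>n. generalized_orbit \<tau> n a (a i))"

definition I\<^sub>0 :: "(real \<Rightarrow> real) \<Rightarrow> nat \<Rightarrow> (nat \<Rightarrow> real) \<Rightarrow> real set" where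
  "I\<^sub>0 \<tau> n a = {0..1} - I\<^sub>1 \<tau> n a"


section \<open>The disconnected interval and the associated local homeomorphism\<close>

text \<open>A point of \<open>X\<close> is a pair: \<open>(x, 0)\<close> for a point \<open>x\<close> that is not split, and
  \<open>(x, -1)\<close>, \<open>(x, 1)\<close> for the two points \<open>x\<^sup>-\<close>, \<open>x\<^sup>+\<close> replacing a split point. The order is
  lexicographic, and the collapse map \<open>\<pi>\<close> is \<open>fst\<close>. The topology is the order topology of the
  set \<open>X\<close> itself, which is not the subspace topology of a lexicographic order on all pairs.\<close>

definition split_less :: "real \<times> int \<Rightarrow> real \<times> int \<Rightarrow> bool" where
  "split_less p q \<longleftrightarrow> fst p < fst q \<or> (fst p = fst q \<and> snd p < snd q)"

definition split_points :: "real set \<Rightarrow> (real \<times> int) set" where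
  "split_points S =
     ({0..1} - (S - {0, 1})) \<times> {0} \<union> ({0..1} \<inter> (S - {0, 1})) \<times> {-1, 1}"

definition split_topology :: "real set \<Rightarrow> (real \<times> int) topology" where
  "split_topology S = topology_generated_by
     ({split_points S} \<union>
      {{p \<in> split_points S. split_less p q} | q. q \<in> split_points S} \<union>
      {{p \<in> split_points S. split_less q p} | q. q \<in> split_points S})"

definition X_top :: "(real \<Rightarrow> real) \<Rightarrow> nat \<Rightarrow> (nat \<Rightarrow> real) \<Rightarrow> (real \<times> int) topology" where
  "X_top \<tau> n a = split_topology (I\<^sub>1 \<tau> n a)"

lemma topspace_X_top [simp]: "topspace (X_top \<tau> n a) = split_points (I\<^sub>1 \<tau> n a)"
  unfolding X_top_def split_topology_def by (auto simp: topology_generated_by_topspace)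

definition associated_local_homeo ::
  "(real \<Rightarrow> real) \<Rightarrow> nat \<Rightarrow> (nat \<Rightarrow> real) \<Rightarrow> (real \<times> int \<Rightarrow> real \<times> int) \<Rightarrow> bool" where
  "associated_local_homeo \<tau> n a \<sigma> \<longleftrightarrow>
     continuous_map (X_top \<tau> n a) (X_top \<tau> n a) \<sigma> \<and>
     (\<forall>p \<in> topspace (X_top \<tau> n a). fst p \<in> I\<^sub>0 \<tau> n a \<longrightarrow> fst (\<sigma> p) = \<tau> (fst p))"


section \<open>Ordered groups\<close>

text \<open>Ordered abelian groups are written in the multiplicative notation of HOL-Algebra; the
  order is given by the positive cone.\<close>

record 'a ordered_group = "'a monoid" +
  poscone :: "'a set"

definition og_le :: "('a, 'b) ordered_group_scheme \<Rightarrow> 'a \<Rightarrow> 'a \<Rightarrow> bool" where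
  "og_le G x y \<longleftrightarrow> inv\<^bsub>G\<^esub> x \<otimes>\<^bsub>G\<^esub> y \<in> poscone G"

definition og_iso ::
  "('a, 'c) ordered_group_scheme \<Rightarrow> ('b, 'd) ordered_group_scheme \<Rightarrow> ('a \<Rightarrow> 'b) set" where
  "og_iso G H = {h \<in> iso G H. \<forall>x\<in>carrier G. \<forall>y\<in>carrier G. og_le G x y \<longleftrightarrow> og_le H (h x) (h y)}"

definition infinitesimals :: "('a, 'b) ordered_group_scheme \<Rightarrow> 'a \<Rightarrow> 'a set" where
  "infinitesimals G e =
     {x \<in> carrier G. \<forall>k::nat. og_le G (inv\<^bsub>G\<^esub> e) (x [^]\<^bsub>G\<^esub> k) \<and> og_le G (x [^]\<^bsub>G\<^esub> k) e}"

definition og_quotient ::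
  "('a, 'b) ordered_group_scheme \<Rightarrow> 'a set \<Rightarrow> 'a set ordered_group" where
  "og_quotient G H =
     \<lparr>carrier = carrier (G Mod H), mult = mult (G Mod H), one = one (G Mod H),
      poscone = (\<lambda>x. H #>\<^bsub>G\<^esub> x) ` poscone G\<rparr>"

text \<open>The direct sum of finitely many ordered groups, with the coordinatewise order.\<close>

definition og_sum ::
  "'i set \<Rightarrow> ('i \<Rightarrow> ('a, 'b) ordered_group_scheme) \<Rightarrow> ('i \<Rightarrow> 'a) ordered_group" where
  "og_sum K G =
     \<lparr>carrier = carrier (product_group K G), mult = mult (product_group K G),
      one = one (product_group K G), poscone = (\<Pi>\<^sub>E i\<in>K. poscone (G i))\<rparr>"

definition real_og :: "real set \<Rightarrow> real ordered_group" where
  "real_og S = \<lparr>carrier = S, mult = (+), one = 0, poscone = {x \<in> S. 0 \<le> x}\<rparr>"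


section \<open>The dimension group of a local homeomorphism\<close>

text \<open>Functions on \<open>X\<close> are represented by functions on the whole type that vanish off \<open>X\<close>; so
  the constant function \<open>1\<close> is \<open>indicator (topspace X)\<close>, and the characteristic function of
  \<open>E\<close> is \<open>indicator E\<close>.\<close>

definition C_int :: "'a topology \<Rightarrow> ('a \<Rightarrow> int) set" where
  "C_int X = {f. continuous_map X (discrete_topology UNIV) f \<and> (\<forall>x. x \<notin> topspace X \<longrightarrow> f x = 0)}"

definition transfer :: "'a topology \<Rightarrow> ('a \<Rightarrow> 'a) \<Rightarrow> ('a \<Rightarrow> int) \<Rightarrow> 'a \<Rightarrow> int" where
  "transfer X \<sigma> f x =
     (if x \<in> topspace X then \<Sum>y | y \<in> topspace X \<and> \<sigma> y = x. f y else 0)"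

definition DG_rel :: "'a topology \<Rightarrow> ('a \<Rightarrow> 'a) \<Rightarrow> (('a \<Rightarrow> int) \<times> ('a \<Rightarrow> int)) set" where
  "DG_rel X \<sigma> = {(f, g). f \<in> C_int X \<and> g \<in> C_int X \<and>
                         (\<exists>k. (transfer X \<sigma> ^^ k) f = (transfer X \<sigma> ^^ k) g)}"

definition DG_class :: "'a topology \<Rightarrow> ('a \<Rightarrow> 'a) \<Rightarrow> ('a \<Rightarrow> int) \<Rightarrow> ('a \<Rightarrow> int) set" where
  "DG_class X \<sigma> f = DG_rel X \<sigma> `` {f}"

definition DG :: "'a topology \<Rightarrow> ('a \<Rightarrow> 'a) \<Rightarrow> ('a \<Rightarrow> int) set ordered_group" where
  "DG X \<sigma> =
     \<lparr>carrier = C_int X // DG_rel X \<sigma>,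
      mult = (\<lambda>A B. \<Union>f\<in>A. \<Union>g\<in>B. DG_class X \<sigma> (\<lambda>x. f x + g x)),
      one = DG_class X \<sigma> (\<lambda>x. 0),
      poscone = {DG_class X \<sigma> f | f. f \<in> C_int X \<and> (\<exists>k. \<forall>x. 0 \<le> (transfer X \<sigma> ^^ k) f x)}\<rparr>"

text \<open>The subgroup of classes of functions supported in a clopen set \<open>Y\<close>, with the inherited
  order. As \<open>f\<close> is continuous and integer valued, the set where it does not vanish is closed.\<close>

definition DG_part ::
  "'a topology \<Rightarrow> ('a \<Rightarrow> 'a) \<Rightarrow> 'a set \<Rightarrow> ('a \<Rightarrow> int) set ordered_group" where
  "DG_part X \<sigma> Y =
     (let D = {DG_class X \<sigma> f | f. f \<in> C_int X \<and> {x. f x \<noteq> 0} \<subseteq> Y}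
      in (DG X \<sigma>)\<lparr>carrier := D, poscone := poscone (DG X \<sigma>) \<inter> D\<rparr>)"

definition DG_inf :: "'a topology \<Rightarrow> ('a \<Rightarrow> 'a) \<Rightarrow> ('a \<Rightarrow> int) set set" where
  "DG_inf X \<sigma> = infinitesimals (DG X \<sigma>) (DG_class X \<sigma> (indicator (topspace X)))"

definition DG_part_inf :: "'a topology \<Rightarrow> ('a \<Rightarrow> 'a) \<Rightarrow> 'a set \<Rightarrow> ('a \<Rightarrow> int) set set" where
  "DG_part_inf X \<sigma> Y = infinitesimals (DG_part X \<sigma> Y) (DG_class X \<sigma> (indicator Y))"

definition DG_mod_inf ::
  "'a topology \<Rightarrow> ('a \<Rightarrow> 'a) \<Rightarrow> ('a \<Rightarrow> int) set set ordered_group" where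
  "DG_mod_inf X \<sigma> = og_quotient (DG X \<sigma>) (DG_inf X \<sigma>)"

definition DG_part_mod_inf ::
  "'a topology \<Rightarrow> ('a \<Rightarrow> 'a) \<Rightarrow> 'a set \<Rightarrow> ('a \<Rightarrow> int) set set ordered_group" where
  "DG_part_mod_inf X \<sigma> Y = og_quotient (DG_part X \<sigma> Y) (DG_part_inf X \<sigma> Y)"

definition mod_inf_class ::
  "'a topology \<Rightarrow> ('a \<Rightarrow> 'a) \<Rightarrow> ('a \<Rightarrow> int) \<Rightarrow> ('a \<Rightarrow> int) set set" where
  "mod_inf_class X \<sigma> f = DG_inf X \<sigma> #>\<^bsub>DG X \<sigma>\<^esub> DG_class X \<sigma> f"

definition part_mod_inf_class ::
  "'a topology \<Rightarrow> ('a \<Rightarrow> 'a) \<Rightarrow> 'a set \<Rightarrow> ('a \<Rightarrow> int) \<Rightarrow> ('a \<Rightarrow> int) set set" where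
  "part_mod_inf_class X \<sigma> Y f = DG_part_inf X \<sigma> Y #>\<^bsub>DG_part X \<sigma> Y\<^esub> DG_class X \<sigma> f"


section \<open>Scaled measures and topologically exact cycles\<close>

definition scaled_measure ::
  "'a topology \<Rightarrow> ('a \<Rightarrow> 'a) \<Rightarrow> real \<Rightarrow> 'a measure \<Rightarrow> bool" where
  "scaled_measure X \<sigma> s \<mu> \<longleftrightarrow>
     prob_space \<mu> \<and> space \<mu> = topspace X \<and>
     sets \<mu> = sigma_sets (topspace X) {U. openin X U} \<and>
     0 < s \<and> (\<forall>E\<in>sets \<mu>. inj_on \<sigma> E \<longrightarrow> measure \<mu> (\<sigma> ` E) = s * measure \<mu> E)"

text \<open>The homomorphism induced by \<open>\<mu>\<close> on classes: the common value of the integrals of the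
  representatives.\<close>

definition class_integral :: "'a measure \<Rightarrow> ('a \<Rightarrow> int) set \<Rightarrow> real" where
  "class_integral \<mu> A = (THE r. \<exists>f\<in>A. r = (\<integral>x. of_int (f x) \<partial>\<mu>))"

definition mu_part :: "'a topology \<Rightarrow> ('a \<Rightarrow> 'a) \<Rightarrow> 'a measure \<Rightarrow> 'a set \<Rightarrow> real ordered_group" where
  "mu_part X \<sigma> \<mu> Y = real_og (class_integral \<mu> ` carrier (DG_part X \<sigma> Y))"

definition topologically_exact :: "'a topology \<Rightarrow> ('a \<Rightarrow> 'a) \<Rightarrow> bool" where
  "topologically_exact Y g \<longleftrightarrow>
     continuous_map Y Y g \<and>
     (\<forall>V. openin Y V \<and> V \<noteq> {} \<longrightarrow> (\<exists>k. (g ^^ k) ` V = topspace Y))"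

text \<open>Indices run over \<open>{1..N}\<close>; the successor of \<open>i\<close> modulo \<open>N\<close> in this range is
  \<open>i mod N + 1\<close>.\<close>

definition exact_cycle ::
  "'a topology \<Rightarrow> ('a \<Rightarrow> 'a) \<Rightarrow> nat \<Rightarrow> (nat \<Rightarrow> 'a set) \<Rightarrow> bool" where
  "exact_cycle X \<sigma> N Y \<longleftrightarrow>
     0 < N \<and> disjoint_family_on Y {1..N} \<and> (\<Union>i\<in>{1..N}. Y i) = topspace X \<and>
     (\<forall>i\<in>{1..N}. Y i \<noteq> {} \<and> openin X (Y i) \<and> closedin X (Y i) \<and>
        \<sigma> ` Y i = Y (i mod N + 1) \<and>
        topologically_exact (subtopology X (Y i)) (\<sigma> ^^ N))"

definition scaled_shift :: "nat \<Rightarrow> real \<Rightarrow> (nat \<Rightarrow> real) \<Rightarrow> nat \<Rightarrow> real" where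
  "scaled_shift N s l = (\<lambda>i\<in>{1..N}. s * l (if i = 1 then N else i - 1))"

end

theory Submission
  imports Defs
begin

text \<open>
  Everything rests on one positivity statement: if \<open>f\<close> is integer valued, supported in \<open>X\<^sub>i\<close>
  and \<open>\<integral>f d\<mu> > 0\<close>, then \<open>L\<^sup>k f \<ge> 0\<close> for some \<open>k\<close>. It says that \<open>\<mu>\<close> determines the order
  on \<open>G\<^sub>i\<close>, so that the infinitesimals of \<open>G\<^sub>i\<close> are the kernel of \<open>\<mu>\<close>; the isomorphisms are then
  instances of the first isomorphism theorem.

  For positivity, \<open>s > 1\<close> because \<open>\<sigma>\<close> is not injective, so a suitable power of \<open>L/s\<close> contracts the
  variation up to a multiple of the \<open>L\<^sup>1\<close> norm (Lasota--Yorke). A nonnegative function whose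
  variation is at most \<open>B\<close> times its integral is at least half its integral (as \<open>\<mu>\<close> has mass 1) on
  one of finitely many cylinders depending only on \<open>B\<close>, and exactness spreads this bound over
  \<open>X\<^sub>i\<close> in a bounded number of steps. Hence the positive and negative parts of \<open>L\<^sup>k f\<close> keep
  cancelling until the negative part has negligible mass, and then the Lasota--Yorke inequality makes
  it negligible in the sup norm.
\<close>

section \<open>The order topology of the split interval\<close>

text \<open>A function on X becomes discontinuous when read on the interval, and
  \<open>\<sigma>\<close> is given explicitly only over the unsplit points. Variation is therefore
  measured on the line and tested at unsplit points alone: \<open>ctrl f B\<close> asks for a
  finitely additive \<nu> of total mass at most B such that f changes between x < y by at most
  \<nu>[x,y]. Additivity then handles the sum over disjoint cylinders, and preimages under an
  iterate of \<tau> push \<nu> forward, so no supremum over partitions is ever taken. One branch of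
  an iterate of \<open>L\<close> costs the variation on its cylinder plus two jumps at the ends of
  its image, each bounded by oscillation plus mean. This is the origin of the factor 3 = 1 + 2 in
  the Lasota-Yorke inequality. The inequality is applied to iterates whose growth factor is at least
  6, so that after division by the growth the variation is halved in each step. On the topological
  side, X is handled through one-sided germs, because the two halves of a split point differ only in
  the side from which they are approached.\<close>

text \<open>A germ of a point is a side, right (\<open>e = 1\<close>) or left (\<open>e = -1\<close>), from which the point is a limit
  of other points; \<open>near S p e Q\<close> says that \<open>Q\<close> holds close to \<open>p\<close> on that side.\<close>

definition has_germ :: "real \<times> int \<Rightarrow> int \<Rightarrow> bool" where
  "has_germ p e \<longleftrightarrow> (e = 1 \<and> fst p < 1 \<or> e = -1 \<and> 0 < fst p) \<and> (snd p = 0 \<or> snd p = e)"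

definition near :: "real set \<Rightarrow> real \<times> int \<Rightarrow> int \<Rightarrow> (real \<times> int \<Rightarrow> bool) \<Rightarrow> bool" where
  "near S p e Q \<longleftrightarrow> (\<exists>\<epsilon>>0. \<forall>q\<in>split_points S.
     0 < of_int e * (fst q - fst p) \<and> of_int e * (fst q - fst p) < \<epsilon> \<longrightarrow> Q q)"

lemma nearI:
  assumes "\<epsilon> > 0"
    and "\<And>q. q \<in> split_points S \<Longrightarrow> 0 < of_int e * (fst q - fst p) \<Longrightarrow>
           of_int e * (fst q - fst p) < \<epsilon> \<Longrightarrow> Q q"
  shows "near S p e Q"
  using assms unfolding near_def by blast

lemma nearE:
  assumes "near S p e Q"
  obtains \<epsilon> where "\<epsilon> > 0"
    and "\<And>q. q \<in> split_points S \<Longrightarrow> 0 < of_int e * (fst q - fst p) \<Longrightarrow>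
           of_int e * (fst q - fst p) < \<epsilon> \<Longrightarrow> Q q"
  using assms unfolding near_def by blast

lemma near_mono:
  assumes "near S p e Q" and "\<And>q. q \<in> split_points S \<Longrightarrow> Q q \<Longrightarrow> R q"
  shows "near S p e R"
  using assms unfolding near_def by blast

lemma near_conj:
  assumes "near S p e Q" and "near S p e R"
  shows "near S p e (\<lambda>q. Q q \<and> R q)"
proof -
  obtain \<epsilon> \<delta> where "\<epsilon> > 0" "\<delta> > 0" and
    *: "\<forall>q\<in>split_points S. 0 < of_int e * (fst q - fst p) \<and> of_int e * (fst q - fst p) < \<epsilon> \<longrightarrow> Q q"
       "\<forall>q\<in>split_points S. 0 < of_int e * (fst q - fst p) \<and> of_int e * (fst q - fst p) < \<delta> \<longrightarrow> R q"
    using assms unfolding near_def by blast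
  then show ?thesis by (intro nearI[of "min \<epsilon> \<delta>"]) auto
qed

lemma split_points_fst: "p \<in> split_points S \<Longrightarrow> 0 \<le> fst p \<and> fst p \<le> 1"
  by (auto simp: split_points_def)

lemma split_points_snd:
  "p \<in> split_points S \<Longrightarrow> (fst p \<notin> S - {0,1} \<longrightarrow> snd p = 0) \<and>
     (fst p \<in> S - {0,1} \<longrightarrow> snd p = 1 \<or> snd p = -1)"
  by (auto simp: split_points_def)

lemma germ_exists: "p \<in> split_points S \<Longrightarrow> \<exists>e. has_germ p e"
  using split_points_fst[of p S] split_points_snd[of p S]
  by (cases "fst p = 0"; cases "fst p = 1"; cases "snd p = -1") (auto simp: has_germ_def)

text \<open>The two halves of a split point carry opposite germs, and over an unsplit position there
  is only one point. Images and preimages under \<open>\<sigma>\<close> are identified this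
  way.\<close>

lemma germ_unique:
  assumes "p \<in> split_points S" "q \<in> split_points S" "fst p = fst q" "has_germ p e" "has_germ q e"
  shows "p = q"
proof -
  have "snd p = snd q"
  proof (cases "fst p \<in> S - {0,1}")
    case True
    then have "snd p \<noteq> 0" using split_points_snd[OF assms(1)] by auto
    moreover have "snd q \<noteq> 0" using True assms(3) split_points_snd[OF assms(2)] by auto
    ultimately show ?thesis using assms(4,5) by (simp add: has_germ_def)
  next
    case False
    then show ?thesis using assms(3) split_points_snd[OF assms(1)] split_points_snd[OF assms(2)]
      by simp
  qed
  then show ?thesis using assms(3) by (simp add: prod_eq_iff)
qed

lemma germ_point:
  assumes "0 \<le> x" "x \<le> 1" "e = 1 \<and> x < 1 \<or> e = -1 \<and> 0 < x"
  obtains p where "p \<in> split_points S" "fst p = x" "has_germ p e"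
proof (cases "x \<in> S - {0,1}")
  case True
  then have "(x, e) \<in> split_points S" using assms by (auto simp: split_points_def)
  then show ?thesis using that[of "(x,e)"] assms by (auto simp: has_germ_def)
next
  case False
  then have "(x, 0) \<in> split_points S" using assms by (auto simp: split_points_def)
  then show ?thesis using that[of "(x,0)"] assms by (auto simp: has_germ_def)
qed

text \<open>Two germs force the second coordinate 0 and exclude 0 and 1, which are unsplit but
  one-sided. What remains is a position off \<open>S\<close>.\<close>

lemma germ_both:
  assumes "p \<in> split_points S" "has_germ p 1" "has_germ p (-1)"
  shows "fst p \<notin> S"
  using assms split_points_snd[of p S] by (auto simp: has_germ_def)

lemma topspace_split_topology [simp]: "topspace (split_topology S) = split_points S"
  unfolding split_topology_def by (auto simp: topology_generated_by_topspace)

lemma openin_split_rays: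
  assumes "q \<in> split_points S"
  shows "openin (split_topology S) {p \<in> split_points S. split_less p q}"
    and "openin (split_topology S) {p \<in> split_points S. split_less q p}"
  unfolding split_topology_def openin_topology_generated_by_iff
  by (rule generate_topology_on.Basis, use assms in blast)+

lemma near_ray:
  assumes "p \<in> split_points S" "q \<in> split_points S" "has_germ p e"
  shows "split_less p q \<Longrightarrow> near S p e (\<lambda>r. split_less r q)"
    and "split_less q p \<Longrightarrow> near S p e (\<lambda>r. split_less q r)"
proof -
  assume *: "split_less p q"
  show "near S p e (\<lambda>r. split_less r q)"
  proof (cases "fst p < fst q")
    case True
    then show ?thesis using assms
      by (intro nearI[of "fst q - fst p"]) (auto simp: split_less_def has_germ_def)
  next
    case False
    then have "fst p = fst q" "snd p < snd q" using * by (auto simp: split_less_def)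
    moreover from this have "e = -1" using assms split_points_snd[of p S] split_points_snd[of q S]
      by (auto simp: has_germ_def split: if_splits)
    ultimately show ?thesis
      by (intro nearI[of 1]) (auto simp: split_less_def)
  qed
next
  assume *: "split_less q p"
  show "near S p e (\<lambda>r. split_less q r)"
  proof (cases "fst q < fst p")
    case True
    then show ?thesis using assms
      by (intro nearI[of "fst p - fst q"]) (auto simp: split_less_def has_germ_def)
  next
    case False
    then have "fst p = fst q" "snd q < snd p" using * by (auto simp: split_less_def)
    moreover from this have "e = 1" using assms split_points_snd[of p S] split_points_snd[of q S]
      by (auto simp: has_germ_def split: if_splits)
    ultimately show ?thesis
      by (intro nearI[of 1]) (auto simp: split_less_def)
  qed
qed

lemma openin_split_near:
  assumes "openin (split_topology S) U" "p \<in> U" "has_germ p e"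
  shows "near S p e (\<lambda>q. q \<in> U)"
proof -
  have "generate_topology_on
     ({split_points S} \<union>
      {{p \<in> split_points S. split_less p q} | q. q \<in> split_points S} \<union>
      {{p \<in> split_points S. split_less q p} | q. q \<in> split_points S}) U"
    using assms(1) unfolding split_topology_def openin_topology_generated_by_iff .
  then show ?thesis using assms(2,3)
  proof (induction arbitrary: p)
    case Empty
    then show ?case by simp
  next
    case (Int A B)
    have "near S p e (\<lambda>q. q \<in> A)" "near S p e (\<lambda>q. q \<in> B)" using Int by simp_all
    then show ?case using near_conj[of S p e "\<lambda>q. q \<in> A" "\<lambda>q. q \<in> B"] by simp
  next
    case (UN K)
    then obtain V where "V \<in> K" "p \<in> V" by blast
    with UN have "near S p e (\<lambda>q. q \<in> V)" by blast
    then show ?case by (rule near_mono) (use \<open>V \<in> K\<close> in blast)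
  next
    case (Basis V)
    have p: "p \<in> split_points S" using Basis by auto
    consider "V = split_points S" 
      | q where "q \<in> split_points S" "V = {p \<in> split_points S. split_less p q}"
      | q where "q \<in> split_points S" "V = {p \<in> split_points S. split_less q p}"
      using Basis(1) by blast
    then show ?case
    proof cases
      case 1
      then show ?thesis unfolding near_def by (intro exI[of _ 1]) auto
    next
      case (2 q)
      then have "near S p e (\<lambda>r. split_less r q)" using near_ray(1)[OF p _ Basis(3)] Basis(2) by blast
      then show ?thesis by (rule near_mono) (use 2 in blast)
    next
      case (3 q)
      then have "near S p e (\<lambda>r. split_less q r)" using near_ray(2)[OF p _ Basis(3)] Basis(2) by blast
      then show ?thesis by (rule near_mono) (use 3 in blast)
    qed
  qed
qed

text \<open>Only sides with a germ need testing: on a side without one, p is an end of X or next to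
  its twin, so a single ray cuts that side off. Later openness arguments in X use this form.\<close>

lemma openin_split_iff:
  "openin (split_topology S) U \<longleftrightarrow>
     U \<subseteq> split_points S \<and> (\<forall>p\<in>U. \<forall>e. has_germ p e \<longrightarrow> near S p e (\<lambda>q. q \<in> U))"
  (is "?L \<longleftrightarrow> ?R")
proof
  assume ?L then show ?R
    using openin_split_near openin_subset[of "split_topology S" U] by auto
next
  assume R: ?R
  have "\<exists>V. openin (split_topology S) V \<and> p \<in> V \<and> V \<subseteq> U" if "p \<in> U" for p
  proof -
    have p: "p \<in> split_points S" using R that by auto
    \<comment> \<open>The neighbourhood is an intersection of two sets, one per side. On the right
      it is a ray ending at a point close to p, or at the twin \<open>x\<^sup>+\<close> if p is
      \<open>x\<^sup>-\<close>, or all of X if p is the last point.\<close>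
    have right: "\<exists>V. openin (split_topology S) V \<and> p \<in> V \<and> (\<forall>q\<in>V. split_less p q \<longrightarrow> q \<in> U)"
    proof (cases "has_germ p 1")
      case True
      then have "near S p 1 (\<lambda>q. q \<in> U)" using R that by blast
      then obtain \<epsilon> where \<epsilon>: "\<epsilon> > 0" "\<And>q. q \<in> split_points S \<Longrightarrow> 0 < fst q - fst p \<Longrightarrow>
          fst q - fst p < \<epsilon> \<Longrightarrow> q \<in> U"
        by (elim nearE) simp
      \<comment> \<open>Clipping at 1 keeps z in the unit interval, so that a point of X lies over
        it.\<close>
      define z where "z = min 1 (fst p + \<epsilon> / 2)"
      have z: "fst p < z" "z < fst p + \<epsilon>" "0 \<le> z" "z \<le> 1" 
        using True \<epsilon>(1) split_points_fst[OF p] by (auto simp: z_def has_germ_def)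
      obtain r where r: "r \<in> split_points S" "fst r = z"
        using germ_point[of z "-1" S] z split_points_fst[OF p] by fastforce
      have "q \<in> U" if "q \<in> split_points S" "split_less q r" "split_less p q" for q
      proof (cases "fst p < fst q")
        case True
        then show ?thesis using that \<epsilon>(2)[of q] z r by (auto simp: split_less_def)
      next
        case False
        then have "fst p = fst q" "snd p < snd q" using that by (auto simp: split_less_def)
        then show ?thesis using \<open>has_germ p 1\<close> that p split_points_snd[of p S] split_points_snd[of q S]
          by (auto simp: has_germ_def split: if_splits)
      qed
      moreover have "split_less p r" using r z by (simp add: split_less_def)
      ultimately show ?thesis using openin_split_rays(1)[OF r(1)] p
        by (intro exI[of _ "{q \<in> split_points S. split_less q r}"]) auto
    next
      case False
      show ?thesis
      proof (cases "fst p = 1")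
        case True
        then have "\<not> split_less p q" if "q \<in> split_points S" for q
          using p that split_points_fst[of q S] split_points_snd[of p S] split_points_snd[of q S]
          by (auto simp: split_less_def split: if_splits)
        then show ?thesis using p openin_topspace[of "split_topology S"]
          by (intro exI[of _ "split_points S"]) simp
      next
        case F: False
        then have s: "snd p = -1" "fst p \<in> S - {0,1}"
          using False split_points_fst[OF p] split_points_snd[OF p]
          by (auto simp: has_germ_def split: if_splits)
        then have r: "(fst p, 1) \<in> split_points S"
          using p split_points_fst[OF p] by (auto simp: split_points_def)
        have "\<not> split_less p q" if "q \<in> split_points S" "split_less q (fst p, 1)" for q
        proof
          assume "split_less p q"
          then have "fst q = fst p" "-1 < snd q" "snd q < 1" using that(2) s(1) by (auto simp: split_less_def)
          then show False using s(2) split_points_snd[OF that(1)] by simp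
        qed
        moreover have "split_less p (fst p, 1)" using s by (auto simp: split_less_def)
        ultimately show ?thesis using openin_split_rays(1)[OF r] p
          by (intro exI[of _ "{q \<in> split_points S. split_less q (fst p, 1)}"]) auto
      qed
    qed
    have left: "\<exists>V. openin (split_topology S) V \<and> p \<in> V \<and> (\<forall>q\<in>V. split_less q p \<longrightarrow> q \<in> U)"
    proof (cases "has_germ p (-1)")
      case True
      then have "near S p (-1) (\<lambda>q. q \<in> U)" using R that by blast
      then obtain \<epsilon> where \<epsilon>: "\<epsilon> > 0" "\<And>q. q \<in> split_points S \<Longrightarrow> 0 < fst p - fst q \<Longrightarrow>
          fst p - fst q < \<epsilon> \<Longrightarrow> q \<in> U"
        by (elim nearE) simp
      define z where "z = max 0 (fst p - \<epsilon> / 2)"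
      have z: "z < fst p" "fst p - \<epsilon> < z" "0 \<le> z" "z \<le> 1" 
        using True \<epsilon>(1) split_points_fst[OF p] by (auto simp: z_def has_germ_def)
      obtain r where r: "r \<in> split_points S" "fst r = z"
        using germ_point[of z "1" S] z split_points_fst[OF p] by fastforce
      have "q \<in> U" if "q \<in> split_points S" "split_less r q" "split_less q p" for q
      proof (cases "fst q < fst p")
        case True
        then show ?thesis using that \<epsilon>(2)[of q] z r by (auto simp: split_less_def)
      next
        case False
        then have "fst p = fst q" "snd q < snd p" using that by (auto simp: split_less_def)
        then show ?thesis using \<open>has_germ p (-1)\<close> that p split_points_snd[of p S] split_points_snd[of q S]
          by (auto simp: has_germ_def split: if_splits)
      qed
      moreover have "split_less r p" using r z by (simp add: split_less_def)
      ultimately show ?thesis using openin_split_rays(2)[OF r(1)] p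
        by (intro exI[of _ "{q \<in> split_points S. split_less r q}"]) auto
    next
      case False
      show ?thesis
      proof (cases "fst p = 0")
        case True
        then have "\<not> split_less q p" if "q \<in> split_points S" for q
          using p that split_points_fst[of q S] split_points_snd[of p S] split_points_snd[of q S]
          by (auto simp: split_less_def split: if_splits)
        then show ?thesis using p openin_topspace[of "split_topology S"]
          by (intro exI[of _ "split_points S"]) simp
      next
        case F: False
        then have s: "snd p = 1" "fst p \<in> S - {0,1}"
          using False split_points_fst[OF p] split_points_snd[OF p]
          by (auto simp: has_germ_def split: if_splits)
        then have r: "(fst p, -1) \<in> split_points S"
          using p split_points_fst[OF p] by (auto simp: split_points_def)
        have "\<not> split_less q p" if "q \<in> split_points S" "split_less (fst p, -1) q" for q
        proof
          assume "split_less q p"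
          then have "fst q = fst p" "-1 < snd q" "snd q < 1" using that(2) s(1) by (auto simp: split_less_def)
          then show False using s(2) split_points_snd[OF that(1)] by simp
        qed
        moreover have "split_less (fst p, -1) p" using s by (auto simp: split_less_def)
        ultimately show ?thesis using openin_split_rays(2)[OF r] p
          by (intro exI[of _ "{q \<in> split_points S. split_less (fst p, -1) q}"]) auto
      qed
    qed
    obtain V W where "openin (split_topology S) V" "p \<in> V" "\<forall>q\<in>V. split_less p q \<longrightarrow> q \<in> U"
      "openin (split_topology S) W" "p \<in> W" "\<forall>q\<in>W. split_less q p \<longrightarrow> q \<in> U"
      using left right by blast
    moreover have "q = p \<or> split_less p q \<or> split_less q p" for q
      by (auto simp: split_less_def prod_eq_iff)
    ultimately have "openin (split_topology S) (V \<inter> W) \<and> p \<in> V \<inter> W \<and> V \<inter> W \<subseteq> U"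
      using that openin_Int[of "split_topology S" V W] by fast
    then show ?thesis by blast
  qed
  then show ?L by (subst openin_subopen) blast
qed

text \<open>With a discrete target, continuity is local constancy, here along each germ.\<close>

lemma C_int_split_iff:
  "f \<in> C_int (split_topology S) \<longleftrightarrow>
     (\<forall>p. p \<notin> split_points S \<longrightarrow> f p = 0) \<and>
     (\<forall>p\<in>split_points S. \<forall>e. has_germ p e \<longrightarrow> near S p e (\<lambda>q. f q = f p))"
  (is "?L \<longleftrightarrow> ?R")
proof
  assume L: ?L
  have "near S p e (\<lambda>q. f q = f p)" if "p \<in> split_points S" "has_germ p e" for p e
  proof -
    have "openin (split_topology S) {q \<in> split_points S. f q \<in> {f p}}"
      using openin_continuous_map_preimage[of "split_topology S" "discrete_topology UNIV" f "{f p}"] L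
      by (simp add: C_int_def)
    from openin_split_near[OF this _ that(2)] have "near S p e (\<lambda>q. q \<in> {q \<in> split_points S. f q \<in> {f p}})"
      using that(1) by blast
    then show ?thesis by (rule near_mono) simp
  qed
  then show ?R using L by (auto simp: C_int_def)
next
  assume R: ?R
  have "openin (split_topology S) {q \<in> split_points S. f q \<in> U}" for U
    unfolding openin_split_iff
  proof (intro conjI ballI allI impI)
    fix p e assume p: "p \<in> {q \<in> split_points S. f q \<in> U}" "has_germ p e"
    then have "near S p e (\<lambda>q. f q = f p)" using R by blast
    then show "near S p e (\<lambda>q. q \<in> {q \<in> split_points S. f q \<in> U})"
      by (rule near_mono) (use p in auto)
  qed auto
  then show ?L using R by (auto simp: C_int_def continuous_map_def)
qed

section \<open>Laps of a piecewise monotonic map\<close>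

text \<open>The limit is the infimum of the values; it lies strictly below each of them because the
  value at a midpoint towards c lies in between.\<close>

lemma increasing_limit_right:
  fixes h :: "real \<Rightarrow> real"
  assumes cd: "c < d" and mono: "\<And>x y. c < x \<Longrightarrow> x < y \<Longrightarrow> y < d \<Longrightarrow> h x < h y"
    and lb: "\<And>x. c < x \<Longrightarrow> x < d \<Longrightarrow> l \<le> h x"
  obtains L where "(h \<longlongrightarrow> L) (at_right c)" "\<And>x. c < x \<Longrightarrow> x < d \<Longrightarrow> L < h x" "l \<le> L"
proof -
  define L where "L = Inf (h ` {c<..<d})"
  have ne: "h ` {c<..<d} \<noteq> {}" using cd by auto
  have bdd: "bdd_below (h ` {c<..<d})" using lb by (auto intro!: bdd_belowI[of _ l])
  have le: "L \<le> h x" if "c < x" "x < d" for x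
    unfolding L_def using that bdd by (auto intro: cInf_lower)
  have less: "L < h x" if "c < x" "x < d" for x
    using le[of "(c + x) / 2"] mono[of "(c + x) / 2" x] that by auto
  have "l \<le> L" unfolding L_def using ne lb by (auto intro: cInf_greatest)
  moreover have "(h \<longlongrightarrow> L) (at_right c)"
  proof (rule order_tendstoI)
    fix y assume "y < L"
    then show "\<forall>\<^sub>F x in at_right c. y < h x"
      unfolding eventually_at_right[OF cd] using le cd by (intro exI[of _ d]) force
  next
    fix y assume "L < y"
    then obtain x where x: "c < x" "x < d" "h x < y"
      using cInf_lessD[OF ne, of y] by (auto simp: L_def)
    then show "\<forall>\<^sub>F x in at_right c. h x < y"
      unfolding eventually_at_right[OF cd] using mono by (intro exI[of _ x]) force
  qed
  ultimately show ?thesis using that less by blast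
qed

text \<open>Reflecting both axes turns a left limit of an increasing function into a right limit of
  an increasing one.\<close>

lemma increasing_limit_left:
  fixes h :: "real \<Rightarrow> real"
  assumes cd: "c < d" and mono: "\<And>x y. c < x \<Longrightarrow> x < y \<Longrightarrow> y < d \<Longrightarrow> h x < h y"
    and ub: "\<And>x. c < x \<Longrightarrow> x < d \<Longrightarrow> h x \<le> u"
  obtains L where "(h \<longlongrightarrow> L) (at_left d)" "\<And>x. c < x \<Longrightarrow> x < d \<Longrightarrow> h x < L" "L \<le> u"
proof -
  obtain L where L: "((\<lambda>x. - h (- x)) \<longlongrightarrow> L) (at_right (- d))"
    "\<And>x. - d < x \<Longrightarrow> x < - c \<Longrightarrow> L < - h (- x)" "- u \<le> L"
    using increasing_limit_right[of "-d" "-c" "\<lambda>x. - h (- x)" "-u"] cd mono ub by auto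
  have "((\<lambda>x. - (- h (- (- x)))) \<longlongrightarrow> - L) (at_left d)"
    unfolding filterlim_at_left_to_right using L(1) by (intro tendsto_minus) simp
  moreover have "h x < - L" if "c < x" "x < d" for x using L(2)[of "-x"] that by simp
  ultimately show ?thesis using that[of "-L"] L(3) by auto
qed

locale interval_map =
  fixes \<tau> :: "real \<Rightarrow> real" and n :: nat and a :: "nat \<Rightarrow> real"
    and \<sigma> :: "real \<times> int \<Rightarrow> real \<times> int"
  assumes maps: "\<tau> \<in> {0..1} \<rightarrow> {0..1}"
    and pts: "monotonicity_points \<tau> n a"
    and homeo: "associated_local_homeo \<tau> n a \<sigma>"
begin

abbreviation "S \<equiv> I\<^sub>1 \<tau> n a"
abbreviation "X \<equiv> X_top \<tau> n a"
abbreviation "XX \<equiv> split_points S"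
abbreviation "b \<equiv> branch \<tau> a"

text \<open>The sign that makes \<open>orient i * \<tau>\<close> increasing on the i-th lap, so that
  both kinds of monotonicity share one argument.\<close>

definition orient :: "nat \<Rightarrow> int" where
  "orient i = (if strict_mono_on {a i<..<a (Suc i)} \<tau> then 1 else -1)"

lemma orient_cases: "orient i = 1 \<or> orient i = -1"
  by (simp add: orient_def)

lemma a_0: "a 0 = 0" and a_n: "a n = 1" and n_pos: "0 < n"
  using pts by (auto simp: monotonicity_points_def)

lemma a_Suc: "i < n \<Longrightarrow> a i < a (Suc i)"
  using pts by (auto simp: monotonicity_points_def)

lemma a_less: "i < j \<Longrightarrow> j \<le> n \<Longrightarrow> a i < a j"
proof (induction j)
  case (Suc j)
  then show ?case using a_Suc[of j] by (cases "i = j") auto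
qed simp

lemma a_mono: "i \<le> j \<Longrightarrow> j \<le> n \<Longrightarrow> a i \<le> a j"
  using a_less[of i j] by (cases "i = j") auto

lemma a_range: "i \<le> n \<Longrightarrow> 0 \<le> a i \<and> a i \<le> 1"
  using a_mono[of 0 i] a_mono[of i n] a_0 a_n by auto

lemma orient_mono:
  assumes "i < n" "a i < x" "x < y" "y < a (Suc i)"
  shows "of_int (orient i) * \<tau> x < of_int (orient i) * \<tau> y"
proof -
  have "cont_strict_monotonic \<tau> (a i) (a (Suc i))"
    using pts assms(1) by (auto simp: monotonicity_points_def)
  then show ?thesis using assms
    by (auto simp: cont_strict_monotonic_def orient_def monotone_on_def)
qed

lemma \<tau>_range: "0 \<le> x \<Longrightarrow> x \<le> 1 \<Longrightarrow> 0 \<le> \<tau> x \<and> \<tau> x \<le> 1"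
  using maps by auto

lemma orient_sq: "of_int (orient i) * (of_int (orient i) * (x::real)) = x"
  using orient_cases[of i] by auto

lemma orient_range:
  assumes "i < n" "a i < x" "x < a (Suc i)"
  shows "-1 \<le> of_int (orient i) * \<tau> x \<and> of_int (orient i) * \<tau> x \<le> 1"
  using \<tau>_range[of x] a_range[of i] a_range[of "Suc i"] assms orient_cases[of i] by auto

lemma branch_eq: "a i < x \<Longrightarrow> x < a (Suc i) \<Longrightarrow> b i x = \<tau> x"
  by (simp add: branch_def)

lemma limit_range:
  assumes "(\<tau> \<longlongrightarrow> l) (at c within A)" "at c within A \<noteq> bot"
    "eventually (\<lambda>x. 0 \<le> \<tau> x \<and> \<tau> x \<le> 1) (at c within A)"
  shows "0 \<le> l \<and> l \<le> 1"
  using tendsto_lowerbound[OF assms(1) _ assms(2), of 0] tendsto_upperbound[OF assms(1) _ assms(2), of 1]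
    assms(3) by (auto simp: eventually_conj_iff)

text \<open>Monotonicity and boundedness provide the one-sided limit, so the \<open>Lim\<close> in
  \<open>branch\<close> is a genuine limit and not an unspecified value.\<close>

lemma branch_left:
  assumes i: "i < n"
  shows "(\<tau> \<longlongrightarrow> b i (a i)) (at_right (a i))"
    and "\<And>x. a i < x \<Longrightarrow> x < a (Suc i) \<Longrightarrow> of_int (orient i) * b i (a i) < of_int (orient i) * \<tau> x"
    and "0 \<le> b i (a i)" "b i (a i) \<le> 1"
proof -
  obtain L where L: "((\<lambda>x. of_int (orient i) * \<tau> x) \<longlongrightarrow> L) (at_right (a i))"
    "\<And>x. a i < x \<Longrightarrow> x < a (Suc i) \<Longrightarrow> L < of_int (orient i) * \<tau> x"
    using increasing_limit_right[of "a i" "a (Suc i)" "\<lambda>x. of_int (orient i) * \<tau> x" "-1"]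
      a_Suc[OF i] orient_mono[OF i] orient_range[OF i] by metis
  have *: "(\<tau> \<longlongrightarrow> of_int (orient i) * L) (at_right (a i))"
    using tendsto_mult_left[OF L(1), of "of_int (orient i)"] by (simp add: orient_sq)
  then have eq: "b i (a i) = of_int (orient i) * L"
    by (simp add: branch_def tendsto_Lim)
  show "(\<tau> \<longlongrightarrow> b i (a i)) (at_right (a i))" using * eq by simp
  show "of_int (orient i) * b i (a i) < of_int (orient i) * \<tau> x" if "a i < x" "x < a (Suc i)" for x
    using L(2) that by (simp add: eq orient_sq)
  have "\<forall>\<^sub>F x in at_right (a i). 0 \<le> \<tau> x \<and> \<tau> x \<le> 1"
    unfolding eventually_at_right[OF a_Suc[OF i]]
    using a_Suc[OF i] \<tau>_range a_range[of i] a_range[of "Suc i"] i 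
    by (intro exI[of _ "a (Suc i)"]) auto
  from limit_range[OF * _ this] show "0 \<le> b i (a i)" "b i (a i) \<le> 1" by (auto simp: eq)
qed

lemma branch_right:
  assumes i: "i < n"
  shows "(\<tau> \<longlongrightarrow> b i (a (Suc i))) (at_left (a (Suc i)))"
    and "\<And>x. a i < x \<Longrightarrow> x < a (Suc i) \<Longrightarrow>
           of_int (orient i) * \<tau> x < of_int (orient i) * b i (a (Suc i))"
    and "0 \<le> b i (a (Suc i))" "b i (a (Suc i)) \<le> 1"
proof -
  obtain L where L: "((\<lambda>x. of_int (orient i) * \<tau> x) \<longlongrightarrow> L) (at_left (a (Suc i)))"
    "\<And>x. a i < x \<Longrightarrow> x < a (Suc i) \<Longrightarrow> of_int (orient i) * \<tau> x < L"
    using increasing_limit_left[of "a i" "a (Suc i)" "\<lambda>x. of_int (orient i) * \<tau> x" "1"]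
      a_Suc[OF i] orient_mono[OF i] orient_range[OF i] by metis
  have *: "(\<tau> \<longlongrightarrow> of_int (orient i) * L) (at_left (a (Suc i)))"
    using tendsto_mult_left[OF L(1), of "of_int (orient i)"] by (simp add: orient_sq)
  then have eq: "b i (a (Suc i)) = of_int (orient i) * L"
    using a_Suc[OF i] by (simp add: branch_def tendsto_Lim)
  show "(\<tau> \<longlongrightarrow> b i (a (Suc i))) (at_left (a (Suc i)))" using * eq by simp
  show "of_int (orient i) * \<tau> x < of_int (orient i) * b i (a (Suc i))" if "a i < x" "x < a (Suc i)" for x
    using L(2) that by (simp add: eq orient_sq)
  have "\<forall>\<^sub>F x in at_left (a (Suc i)). 0 \<le> \<tau> x \<and> \<tau> x \<le> 1"
    unfolding eventually_at_left[OF a_Suc[OF i]]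
    using a_Suc[OF i] \<tau>_range a_range[of i] a_range[of "Suc i"] i 
    by (intro exI[of _ "a i"]) auto
  from limit_range[OF * _ this] show "0 \<le> b i (a (Suc i))" "b i (a (Suc i)) \<le> 1" by (auto simp: eq)
qed

lemma branch_cont:
  assumes i: "i < n"
  shows "continuous_on {a i..a (Suc i)} (b i)"
proof (rule continuous_on_IccI)
  have ev: "\<forall>\<^sub>F x in at_right (a i). b i x = \<tau> x"
    unfolding eventually_at_right[OF a_Suc[OF i]]
    using a_Suc[OF i] branch_eq by (intro exI[of _ "a (Suc i)"]) auto
  show "(b i \<longlongrightarrow> b i (a i)) (at_right (a i))"
    using branch_left(1)[OF i] by (subst tendsto_cong[OF ev])
  have ev: "\<forall>\<^sub>F x in at_left (a (Suc i)). b i x = \<tau> x"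
    unfolding eventually_at_left[OF a_Suc[OF i]]
    using a_Suc[OF i] branch_eq by (intro exI[of _ "a i"]) auto
  show "(b i \<longlongrightarrow> b i (a (Suc i))) (at_left (a (Suc i)))"
    using branch_right(1)[OF i] by (subst tendsto_cong[OF ev])
  show "b i \<midarrow>x\<rightarrow> b i x" if "a i < x" "x < a (Suc i)" for x
  proof -
    have "continuous_on {a i<..<a (Suc i)} \<tau>"
      using pts i by (auto simp: monotonicity_points_def cont_strict_monotonic_def)
    then have "continuous_on {a i<..<a (Suc i)} (b i)"
      by (rule continuous_on_cong[THEN iffD1, rotated -1]) (auto simp: branch_eq)
    then show ?thesis using that
      by (auto simp: continuous_on_eq_continuous_at isCont_def)
  qed
qed (use a_Suc[OF i] in auto)

text \<open>The midpoint of x and y is interior to the lap, and its value separates the other two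
  even when x or y is an end point.\<close>

lemma branch_mono:
  assumes i: "i < n" and x: "a i \<le> x" "x < y" "y \<le> a (Suc i)"
  shows "of_int (orient i) * b i x < of_int (orient i) * b i y"
proof -
  let ?z = "(x + y) / 2"
  have z: "a i < ?z" "?z < a (Suc i)" "x < ?z" "?z < y" using x by auto
  have "of_int (orient i) * b i x < of_int (orient i) * \<tau> ?z"
    using branch_left(2)[OF i z(1,2)] orient_mono[OF i _ z(3,2)] x z branch_eq[of i x]
    by (cases "x = a i") auto
  also have "\<dots> < of_int (orient i) * b i y"
    using branch_right(2)[OF i z(1,2)] orient_mono[OF i z(1,4)] x z branch_eq[of i y]
    by (cases "y = a (Suc i)") auto
  finally show ?thesis .
qed

lemma branch_mono_le:
  assumes "i < n" "a i \<le> x" "x \<le> y" "y \<le> a (Suc i)"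
  shows "of_int (orient i) * b i x \<le> of_int (orient i) * b i y"
  using branch_mono[of i x y] assms by (cases "x = y") auto

lemma branch_inj:
  assumes "i < n" "a i \<le> x" "x \<le> a (Suc i)" "a i \<le> y" "y \<le> a (Suc i)" "b i x = b i y"
  shows "x = y"
  using branch_mono[of i x y] branch_mono[of i y x] assms by (cases x y rule: linorder_cases) auto

lemma branch_range:
  assumes i: "i < n" and x: "a i \<le> x" "x \<le> a (Suc i)"
  shows "0 \<le> b i x \<and> b i x \<le> 1"
proof (cases "x = a i \<or> x = a (Suc i)")
  case True
  then show ?thesis using branch_left[OF i] branch_right[OF i] by auto
next
  case False
  then show ?thesis using branch_eq[of i x] \<tau>_range[of x] a_range[of i] a_range[of "Suc i"] i x by auto
qed

text \<open>For a side \<open>e = \<plusminus>1\<close> of \<open>x\<close>, \<open>lap_side i e x\<close> says that this side lies in the \<open>i\<close>-th lap.\<close>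

definition lap_side :: "nat \<Rightarrow> int \<Rightarrow> real \<Rightarrow> bool" where
  "lap_side i e x \<longleftrightarrow> e = 1 \<and> a i \<le> x \<and> x < a (Suc i) \<or> e = -1 \<and> a i < x \<and> x \<le> a (Suc i)"

text \<open>Membership is decided by a germ and not by position: the two halves of an interior
  partition point belong to different laps, which makes the laps disjoint and open.\<close>

definition lap :: "nat \<Rightarrow> (real \<times> int) set" where
  "lap i = {p \<in> XX. \<exists>e. has_germ p e \<and> lap_side i e (fst p)}"

lemma ex_lap_side:
  assumes "e = 1 \<and> 0 \<le> x \<and> x < 1 \<or> e = -1 \<and> 0 < x \<and> x \<le> 1"
  shows "\<exists>i<n. lap_side i e x"
proof -
  have "\<exists>i<m. lap_side i e x" if "e = 1 \<and> a 0 \<le> x \<and> x < a m \<or> e = -1 \<and> a 0 < x \<and> x \<le> a m" "m \<le> n" for m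
    using that
  proof (induction m)
    case (Suc m)
    show ?case
    proof (cases "e = 1 \<and> a 0 \<le> x \<and> x < a m \<or> e = -1 \<and> a 0 < x \<and> x \<le> a m")
      case True
      then show ?thesis using Suc less_Suc_eq by auto
    next
      case False
      then have "lap_side m e x" using Suc by (auto simp: lap_side_def)
      then show ?thesis by blast
    qed
  qed auto
  from this[of n] show ?thesis using assms a_0 a_n by auto
qed

lemma lap_side_unique:
  assumes "lap_side i e x" "lap_side j e x" "i < n" "j < n"
  shows "i = j"
proof (rule ccontr)
  assume "i \<noteq> j"
  then consider "Suc i \<le> j" | "Suc j \<le> i" by linarith
  then show False
    using assms a_mono[of "Suc i" j] a_mono[of "Suc j" i] by cases (auto simp: lap_side_def)
qed

section \<open>Invariance and countability of the set of split points\<close>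

lemma hat_image_Union: "hat_image \<tau> n a (\<Union>\<A>) = (\<Union>A\<in>\<A>. hat_image \<tau> n a A)"
  by (auto simp: hat_image_def)

lemma hat_preimage_Union: "hat_preimage \<tau> n a (\<Union>\<A>) = (\<Union>A\<in>\<A>. hat_preimage \<tau> n a A)"
  by (auto simp: hat_preimage_def)

lemma hat_image_unit: "hat_image \<tau> n a A \<subseteq> {0..1}"
  using branch_range by (auto simp: hat_image_def)

lemma hat_preimage_unit: "hat_preimage \<tau> n a A \<subseteq> {0..1}"
proof -
  have "0 \<le> x \<and> x \<le> 1" if "i < n" "a i \<le> x" "x \<le> a (Suc i)" for i x
    using a_range[of i] a_range[of "Suc i"] that by auto
  then show ?thesis by (force simp: hat_preimage_def)
qed

lemma generalized_orbit_closed: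
  "hat_image \<tau> n a (generalized_orbit \<tau> n a x) \<subseteq> generalized_orbit \<tau> n a x"
  "hat_preimage \<tau> n a (generalized_orbit \<tau> n a x) \<subseteq> generalized_orbit \<tau> n a x"
proof -
  have mono: "hat_image \<tau> n a A \<subseteq> hat_image \<tau> n a B" "hat_preimage \<tau> n a A \<subseteq> hat_preimage \<tau> n a B"
    if "A \<subseteq> B" for A B
    using that unfolding hat_image_def hat_preimage_def by blast+
  show "hat_image \<tau> n a (generalized_orbit \<tau> n a x) \<subseteq> generalized_orbit \<tau> n a x"
    unfolding generalized_orbit_def
  proof (rule Inter_greatest)
    fix A assume A: "A \<in> {A. A \<subseteq> {0..1} \<and> x \<in> A \<and> hat_image \<tau> n a A \<subseteq> A \<and> hat_preimage \<tau> n a A \<subseteq> A}"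
    from A have "hat_image \<tau> n a A \<subseteq> A" by blast
    with mono(1)[OF Inter_lower[OF A]] show "hat_image \<tau> n a (\<Inter> {A. A \<subseteq> {0..1} \<and> x \<in> A \<and>
        hat_image \<tau> n a A \<subseteq> A \<and> hat_preimage \<tau> n a A \<subseteq> A}) \<subseteq> A"
      by (rule order_trans)
  qed
  show "hat_preimage \<tau> n a (generalized_orbit \<tau> n a x) \<subseteq> generalized_orbit \<tau> n a x"
    unfolding generalized_orbit_def
  proof (rule Inter_greatest)
    fix A assume A: "A \<in> {A. A \<subseteq> {0..1} \<and> x \<in> A \<and> hat_image \<tau> n a A \<subseteq> A \<and> hat_preimage \<tau> n a A \<subseteq> A}"
    from A have "hat_preimage \<tau> n a A \<subseteq> A" by blast
    with mono(2)[OF Inter_lower[OF A]] show "hat_preimage \<tau> n a (\<Inter> {A. A \<subseteq> {0..1} \<and> x \<in> A \<and>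
        hat_image \<tau> n a A \<subseteq> A \<and> hat_preimage \<tau> n a A \<subseteq> A}) \<subseteq> A"
      by (rule order_trans)
  qed
qed

text \<open>The orbit lies in the union of the sets \<open>C k\<close> obtained by taking images and
  preimages k times. Each is countable, because there are finitely many branches and each is
  injective.\<close>

lemma countable_generalized_orbit:
  assumes "0 \<le> x" "x \<le> 1"
  shows "countable (generalized_orbit \<tau> n a x)"
proof -
  define C where "C = rec_nat {x} (\<lambda>_ A. hat_image \<tau> n a A \<union> hat_preimage \<tau> n a A)"
  have C: "C 0 = {x}" "C (Suc k) = hat_image \<tau> n a (C k) \<union> hat_preimage \<tau> n a (C k)" for k
    by (simp_all add: C_def)
  have "countable (C k)" for k
  proof (induction k)
    case (Suc k)
    have "countable {x \<in> {a i..a (Suc i)}. b i x \<in> C k}" if "i < n" for i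
    proof (rule countable_image_inj_on[of "b i"])
      show "countable (b i ` {x \<in> {a i..a (Suc i)}. b i x \<in> C k})"
        by (rule countable_subset[OF _ Suc]) auto
      show "inj_on (b i) {x \<in> {a i..a (Suc i)}. b i x \<in> C k}"
        using branch_inj[OF that] by (auto simp: inj_on_def)
    qed
    then have "countable (hat_preimage \<tau> n a (C k))" by (auto simp: hat_preimage_def)
    moreover have "countable (hat_image \<tau> n a (C k))" using Suc by (auto simp: hat_image_def)
    ultimately show ?case by (simp add: C)
  qed (simp add: C)
  then have "countable (\<Union>k. C k)" by simp
  moreover have "generalized_orbit \<tau> n a x \<subseteq> (\<Union>k. C k)"
    unfolding generalized_orbit_def
  proof (rule Inter_lower, intro CollectI conjI)
    have "C k \<subseteq> {0..1}" for k
      using hat_image_unit hat_preimage_unit assms by (cases k) (auto simp: C)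
    then show "(\<Union>k. C k) \<subseteq> {0..1}" by blast
    show "x \<in> (\<Union>k. C k)" using C(1) by blast
    show "hat_image \<tau> n a (\<Union>k. C k) \<subseteq> (\<Union>k. C k)"
      unfolding hat_image_Union using C(2) by blast
    show "hat_preimage \<tau> n a (\<Union>k. C k) \<subseteq> (\<Union>k. C k)"
      unfolding hat_preimage_Union using C(2) by blast
  qed
  ultimately show ?thesis by (rule countable_subset[rotated])
qed

lemma countable_S: "countable S"
  unfolding I\<^sub>1_def using a_range by (auto intro: countable_generalized_orbit)

lemma S_forward: "i < n \<Longrightarrow> a i \<le> x \<Longrightarrow> x \<le> a (Suc i) \<Longrightarrow> x \<in> S \<Longrightarrow> b i x \<in> S"
  using generalized_orbit_closed(1) unfolding I\<^sub>1_def hat_image_def by fastforce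

lemma S_backward: "i < n \<Longrightarrow> a i \<le> x \<Longrightarrow> x \<le> a (Suc i) \<Longrightarrow> b i x \<in> S \<Longrightarrow> x \<in> S"
  using generalized_orbit_closed(2) unfolding I\<^sub>1_def hat_preimage_def by fastforce

lemma a_in_S: "i \<le> n \<Longrightarrow> a i \<in> S"
  unfolding I\<^sub>1_def generalized_orbit_def by blast

lemma zero_in_S: "0 \<in> S" and one_in_S: "1 \<in> S"
  using a_in_S[of 0] a_in_S[of n] a_0 a_n by auto

text \<open>Countability of \<open>S\<close> leaves unsplit points in every interval. There
  \<open>\<sigma>\<close> is \<open>\<tau>\<close>, and continuity determines everything else from
  them.\<close>

lemma dense_I0:
  assumes "c < d"
  obtains x where "c < x" "x < d" "x \<notin> S"
proof -
  have "\<not> {c<..<d} \<subseteq> S"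
    using assms countable_S countable_subset uncountable_open_interval by blast
  then obtain x where "x \<in> {c<..<d}" "x \<notin> S" by blast
  then show ?thesis using that[of x] by simp
qed

lemma I0_point: "x \<in> {0..1} \<Longrightarrow> x \<notin> S \<Longrightarrow> (x, 0) \<in> XX \<and> has_germ (x, 0) 1 \<and> has_germ (x, 0) (-1)"
  using zero_in_S one_in_S by (cases "x = 0"; cases "x = 1") (auto simp: split_points_def has_germ_def)

lemma I0_germ: "p \<in> XX \<Longrightarrow> fst p \<notin> S \<Longrightarrow> p = (fst p, 0) \<and> has_germ p 1 \<and> has_germ p (-1)"
  using I0_point[of "fst p"] split_points_fst[of p S] split_points_snd[of p S]
  by (cases p) auto

text \<open>The definition of \<open>lap\<close> asks for one germ; here every germ is shown to lie
  in the lap. A point with two germs is off \<open>S\<close>, hence off the partition and interior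
  to its lap.\<close>

lemma lap_germ:
  assumes "p \<in> lap i" "has_germ p e" "i < n"
  shows "lap_side i e (fst p)"
proof -
  obtain e' where e': "has_germ p e'" "lap_side i e' (fst p)" "p \<in> XX"
    using assms by (auto simp: lap_def)
  show ?thesis
  proof (cases "e' = e")
    case False
    then have "fst p \<notin> S"
      using germ_both[OF e'(3)] e'(1) assms(2) by (auto simp: has_germ_def)
    then have "fst p \<noteq> a i" "fst p \<noteq> a (Suc i)" using a_in_S[of i] a_in_S[of "Suc i"] assms(3) by auto
    then show ?thesis using e'(2) assms(2) by (auto simp: lap_side_def has_germ_def)
  qed (use e' in auto)
qed

lemma lap_fst: "p \<in> lap i \<Longrightarrow> a i \<le> fst p \<and> fst p \<le> a (Suc i)"
  by (auto simp: lap_def lap_side_def)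

lemma lap_sub: "lap i \<subseteq> XX"
  by (auto simp: lap_def)

lemma lap_cover: "(\<Union>i<n. lap i) = XX"
proof -
  have "\<exists>i<n. p \<in> lap i" if p: "p \<in> XX" for p
  proof -
    obtain e where e: "has_germ p e" using germ_exists p by blast
    then have "\<exists>i<n. lap_side i e (fst p)"
      using split_points_fst[OF p] by (intro ex_lap_side) (auto simp: has_germ_def)
    then show ?thesis using e p by (auto simp: lap_def)
  qed
  then show ?thesis using lap_sub by blast
qed

lemma lap_disjoint: "disjoint_family_on lap {..<n}"
proof -
  have "i = j" if "i < n" "j < n" "p \<in> lap i" "p \<in> lap j" for i j p
  proof -
    have "p \<in> XX" using that(3) lap_sub by blast
    then obtain e where e: "has_germ p e" using germ_exists by blast
    show ?thesis using lap_germ[OF that(3) e that(1)] lap_germ[OF that(4) e that(2)] that(1,2)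
      by (rule lap_side_unique)
  qed
  then show ?thesis by (auto simp: disjoint_family_on_def)
qed

lemma lap_I0: "(x, 0) \<in> lap i \<longleftrightarrow> a i < x \<and> x < a (Suc i)"
  if "x \<in> {0..1}" "x \<notin> S" "i < n"
proof -
  have "x \<noteq> a i" "x \<noteq> a (Suc i)" using a_in_S[of i] a_in_S[of "Suc i"] that by auto
  then show ?thesis using I0_point[OF that(1,2)]
    by (auto simp: lap_def lap_side_def)
qed

lemma lap_interior:
  assumes "q \<in> XX" "a i < fst q" "fst q < a (Suc i)"
  shows "q \<in> lap i"
proof -
  obtain e where "has_germ q e" using germ_exists assms by blast
  then show ?thesis using assms by (auto simp: lap_def lap_side_def has_germ_def)
qed

lemma near_lap:
  assumes "p \<in> lap i" "has_germ p e" "i < n"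
  shows "near S p e (\<lambda>q. a i < fst q \<and> fst q < a (Suc i))"
  using lap_germ[OF assms] unfolding lap_side_def
  by (auto intro: nearI[of "a (Suc i) - fst p"] nearI[of "fst p - a i"])

lemma openin_lap: "i < n \<Longrightarrow> openin X (lap i)"
  unfolding X_top_def openin_split_iff
proof (intro conjI ballI allI impI)
  fix p e assume "i < n" "p \<in> lap i" "has_germ p e"
  then have "near S p e (\<lambda>q. a i < fst q \<and> fst q < a (Suc i))" using near_lap by blast
  then show "near S p e (\<lambda>q. q \<in> lap i)" by (rule near_mono) (use lap_interior in blast)
qed (rule lap_sub)

end

section \<open>The local homeomorphism on the laps\<close>

context interval_map begin

lemma \<sigma>_cont: "continuous_map X X \<sigma>"
  using homeo by (simp add: associated_local_homeo_def)

lemma \<sigma>_in: "p \<in> XX \<Longrightarrow> \<sigma> p \<in> XX"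
  using \<sigma>_cont by (auto simp: continuous_map_def)

lemma \<sigma>_near:
  assumes "p \<in> XX" "has_germ p e" "openin X W" "\<sigma> p \<in> W"
  shows "near S p e (\<lambda>q. \<sigma> q \<in> W)"
proof -
  have "openin (split_topology S) {q \<in> XX. \<sigma> q \<in> W}"
    using openin_continuous_map_preimage[OF \<sigma>_cont assms(3)] by (simp add: X_top_def)
  from openin_split_near[OF this _ assms(2)] assms(1,4)
  have "near S p e (\<lambda>q. q \<in> {q \<in> XX. \<sigma> q \<in> W})" by simp
  then show ?thesis by (rule near_mono) simp
qed

text \<open>What holds near p on one side holds at some unsplit point of the same lap, as close to p
  as desired. Continuity arguments about \<open>\<sigma>\<close> are thereby reduced to
  \<open>\<tau>\<close>.\<close>

lemma near_dense:
  assumes "near S p e Q" "p \<in> lap i" "has_germ p e" "i < n" "\<delta> > 0"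
  obtains y where "y \<notin> S" "0 < of_int e * (y - fst p)" "of_int e * (y - fst p) < \<delta>"
    "a i < y" "y < a (Suc i)" "Q (y, 0)"
proof -
  obtain \<epsilon> where \<epsilon>: "\<epsilon> > 0"
    "\<And>q. q \<in> XX \<Longrightarrow> 0 < of_int e * (fst q - fst p) \<Longrightarrow> of_int e * (fst q - fst p) < \<epsilon> \<Longrightarrow> Q q"
    using assms(1) by (elim nearE) blast
  have side: "lap_side i e (fst p)" using lap_germ assms by blast
  have *: "\<exists>y. y \<notin> S \<and> 0 < of_int e * (y - fst p) \<and> of_int e * (y - fst p) < min \<epsilon> \<delta> \<and>
    a i < y \<and> y < a (Suc i)"
  proof (cases "e = 1")
    case True
    have "fst p < min (fst p + min \<epsilon> \<delta>) (a (Suc i))"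
      using True side assms(5) \<epsilon>(1) by (auto simp: lap_side_def)
    then obtain y where "fst p < y" "y < min (fst p + min \<epsilon> \<delta>) (a (Suc i))" "y \<notin> S"
      by (rule dense_I0)
    then show ?thesis using True side by (intro exI[of _ y]) (auto simp: lap_side_def)
  next
    case False
    then have e: "e = -1" using side by (auto simp: lap_side_def)
    have "max (fst p - min \<epsilon> \<delta>) (a i) < fst p"
      using e side assms(5) \<epsilon>(1) by (auto simp: lap_side_def)
    then obtain y where "max (fst p - min \<epsilon> \<delta>) (a i) < y" "y < fst p" "y \<notin> S"
      by (rule dense_I0)
    then show ?thesis using e side by (intro exI[of _ y]) (auto simp: lap_side_def)
  qed
  then obtain y where y: "y \<notin> S" "0 < of_int e * (y - fst p)" "of_int e * (y - fst p) < min \<epsilon> \<delta>"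
    "a i < y" "y < a (Suc i)" by blast
  have "y \<in> {0..1}" using y a_range[of i] a_range[of "Suc i"] assms(4) by auto
  then have "(y, 0) \<in> XX" using I0_point y(1) by blast
  then have "Q (y, 0)" using \<epsilon>(2)[of "(y, 0)"] y by simp
  then show ?thesis using that[of y] y by simp
qed

lemma I0_lap:
  assumes "x \<in> {0..1}" "x \<notin> S"
  obtains i where "i < n" "a i < x" "x < a (Suc i)"
proof -
  have "x \<noteq> 0" "x \<noteq> 1" using assms zero_in_S one_in_S by auto
  then obtain i where i: "i < n" "lap_side i 1 x" using ex_lap_side[of 1 x] assms(1) by auto
  moreover have "x \<noteq> a i" using a_in_S[of i] i assms by auto
  ultimately show ?thesis using that by (auto simp: lap_side_def)
qed

lemma \<tau>_I0:
  assumes "x \<in> {0..1}" "x \<notin> S"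
  shows "\<tau> x \<in> {0..1}" "\<tau> x \<notin> S"
proof -
  obtain i where "i < n" "a i < x" "x < a (Suc i)" using I0_lap assms by blast
  then show "\<tau> x \<in> {0..1}" "\<tau> x \<notin> S"
    using S_backward[of i x] branch_eq[of i x] assms \<tau>_range[of x] by auto
qed

lemma \<sigma>_I0:
  assumes "x \<in> {0..1}" "x \<notin> S"
  shows "\<sigma> (x, 0) = (\<tau> x, 0)"
proof -
  have "fst (\<sigma> (x, 0)) = \<tau> x"
    using homeo I0_point[OF assms] assms by (auto simp: associated_local_homeo_def I\<^sub>0_def)
  then show ?thesis
    using I0_germ[of "\<sigma> (x, 0)"] \<sigma>_in I0_point[OF assms] \<tau>_I0[OF assms] by metis
qed

lemma openin_fst_ball: "openin X {q \<in> XX. \<bar>fst q - z\<bar> < \<delta>}"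
  unfolding X_top_def openin_split_iff
proof (intro conjI ballI allI impI)
  fix p e assume p: "p \<in> {q \<in> XX. \<bar>fst q - z\<bar> < \<delta>}" "has_germ p e"
  show "near S p e (\<lambda>q. q \<in> {q \<in> XX. \<bar>fst q - z\<bar> < \<delta>})"
    by (rule nearI[of "\<delta> - \<bar>fst p - z\<bar>"]) (use p in \<open>auto simp: has_germ_def\<close>)
qed auto

text \<open>\<open>\<sigma>\<close> and the branch agree at unsplit points, which accumulate at p
  along a germ. If they differed at p, a nearby unsplit point would have its image within half the
  difference of both values.\<close>

lemma \<sigma>_fst:
  assumes p: "p \<in> lap i" and i: "i < n"
  shows "fst (\<sigma> p) = b i (fst p)"
proof (rule ccontr)
  assume ne: "fst (\<sigma> p) \<noteq> b i (fst p)"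
  define \<delta> where "\<delta> = \<bar>fst (\<sigma> p) - b i (fst p)\<bar> / 2"
  have \<delta>: "\<delta> > 0" using ne by (simp add: \<delta>_def)
  have XXp: "p \<in> XX" using p lap_sub by blast
  obtain e where e: "has_germ p e" using germ_exists XXp by blast
  have near: "near S p e (\<lambda>q. \<sigma> q \<in> {q \<in> XX. \<bar>fst q - fst (\<sigma> p)\<bar> < \<delta>})"
    using \<sigma>_near[OF XXp e openin_fst_ball] \<sigma>_in[OF XXp] \<delta> by simp
  have "fst p \<in> {a i..a (Suc i)}" using lap_fst p by auto
  then obtain \<epsilon> where \<epsilon>: "\<epsilon> > 0" "\<And>y. y \<in> {a i..a (Suc i)} \<Longrightarrow> \<bar>y - fst p\<bar> < \<epsilon> \<Longrightarrow> \<bar>b i y - b i (fst p)\<bar> < \<delta>"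
    using branch_cont[OF i] \<delta> unfolding continuous_on_iff dist_real_def by metis
  obtain y where y: "y \<notin> S" "0 < of_int e * (y - fst p)" "of_int e * (y - fst p) < \<epsilon>"
    "a i < y" "y < a (Suc i)" "\<sigma> (y, 0) \<in> {q \<in> XX. \<bar>fst q - fst (\<sigma> p)\<bar> < \<delta>}"
    using near_dense[OF near p e i \<epsilon>(1)] by blast
  have "y \<in> {0..1}" using y a_range[of i] a_range[of "Suc i"] i by auto
  then have "\<bar>b i y - fst (\<sigma> p)\<bar> < \<delta>" using y(6) \<sigma>_I0[OF _ y(1)] branch_eq[OF y(4,5)] by simp
  moreover have "\<bar>b i y - b i (fst p)\<bar> < \<delta>"
    using \<epsilon>(2)[of y] y e by (auto simp: has_germ_def)
  ultimately show False unfolding \<delta>_def by (simp add: abs_if split: if_splits)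
qed

text \<open>An increasing branch keeps the side of approach and a decreasing one reverses it. At a
  split image this decides which half is hit.\<close>

lemma \<sigma>_germ:
  assumes p: "p \<in> lap i" and i: "i < n" and e: "has_germ p e"
  shows "has_germ (\<sigma> p) (orient i * e)"
proof (rule ccontr)
  assume no: "\<not> has_germ (\<sigma> p) (orient i * e)"
  define e' where "e' = orient i * e"
  have ee: "e = 1 \<or> e = -1" using e by (auto simp: has_germ_def)
  then have e': "e' = 1 \<or> e' = -1" using orient_cases[of i] by (auto simp: e'_def)
  have XXp: "p \<in> XX" using p lap_sub by blast
  \<comment> \<open>If \<open>\<sigma> p\<close> had no germ on the side \<open>e'\<close>, the
    points beyond it on the other side together with \<open>\<sigma> p\<close> would form an open
    set. Yet points close to p on the side e are mapped strictly to the side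
    \<open>e'\<close>.\<close>
  define W where "W = {q \<in> XX. q = \<sigma> p \<or> of_int e' * (fst q - fst (\<sigma> p)) < 0}"
  have "openin X W"
    unfolding X_top_def openin_split_iff
  proof (intro conjI ballI allI impI)
    fix q g assume q: "q \<in> W" "has_germ q g"
    show "near S q g (\<lambda>q. q \<in> W)"
    proof (cases "q = \<sigma> p")
      case True
      then have "g = - e'" using q(2) no e' by (auto simp: e'_def[symmetric] has_germ_def)
      then show ?thesis unfolding W_def True by (intro nearI[of 1]) auto
    next
      case False
      then have neg: "of_int e' * (fst q - fst (\<sigma> p)) < 0" using q by (auto simp: W_def)
      show ?thesis
        by (rule nearI[of "- (of_int e' * (fst q - fst (\<sigma> p)))"])
          (use e' q(2) neg in \<open>auto simp: W_def has_germ_def\<close>)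
    qed
  qed (auto simp: W_def)
  moreover have "\<sigma> p \<in> W" using \<sigma>_in[OF XXp] by (simp add: W_def)
  ultimately have near: "near S p e (\<lambda>q. \<sigma> q \<in> W)" by (rule \<sigma>_near[OF XXp e])
  obtain y where y: "y \<notin> S" "0 < of_int e * (y - fst p)" "a i < y" "y < a (Suc i)" "\<sigma> (y, 0) \<in> W"
    using near_dense[OF near p e i, of 1] by auto
  have "y \<in> {0..1}" using y a_range[of i] a_range[of "Suc i"] i by auto
  then have "\<sigma> (y, 0) = (b i y, 0)" using \<sigma>_I0[OF _ y(1)] branch_eq[OF y(3,4)] by simp
  then have "of_int e' * (b i y - b i (fst p)) \<le> 0"
    using y(5) \<sigma>_fst[OF p i] by (auto simp: W_def) (metis diff_self fst_conv mult_zero_right order_refl)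
  moreover have "of_int e' * (b i y - b i (fst p)) > 0"
    using branch_mono[OF i, of y "fst p"] branch_mono[OF i, of "fst p" y] y lap_fst[OF p] ee
    by (auto simp: e'_def algebra_simps)
  ultimately show False by simp
qed

text \<open>Equal images have equal positions by injectivity of the branch. If the points had
  different germs, the common image would carry both germs and lie off \<open>S\<close>; by
  invariance so does the position, which is then not split.\<close>

lemma \<sigma>_inj:
  assumes i: "i < n"
  shows "inj_on \<sigma> (lap i)"
proof (rule inj_onI)
  fix p q assume p: "p \<in> lap i" and q: "q \<in> lap i" and eq: "\<sigma> p = \<sigma> q"
  have XX: "p \<in> XX" "q \<in> XX" using p q lap_sub by auto
  have fst: "fst p = fst q"
    using branch_inj[OF i, of "fst p" "fst q"] lap_fst[OF p] lap_fst[OF q] \<sigma>_fst[OF p i] \<sigma>_fst[OF q i] eq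
    by simp
  obtain e g where e: "has_germ p e" and g: "has_germ q g" using germ_exists XX by blast
  show "p = q"
  proof (cases "e = g")
    case True
    then show ?thesis using germ_unique[OF XX fst e] g by simp
  next
    case False
    then have "has_germ (\<sigma> p) 1" "has_germ (\<sigma> p) (-1)"
      using \<sigma>_germ[OF p i e] \<sigma>_germ[OF q i g] e g eq orient_cases[of i] by (auto simp: has_germ_def)
    then have "fst (\<sigma> p) \<notin> S" using germ_both[OF \<sigma>_in[OF XX(1)]] by blast
    then have "fst p \<notin> S" using S_forward[OF i] lap_fst[OF p] \<sigma>_fst[OF p i] by auto
    then show ?thesis using I0_germ[of p] I0_germ[of q] XX fst by metis
  qed
qed

text \<open>A preimage of q is built by lifting its position and a germ; its image is q because
  position and germ determine a point.\<close>

lemma lap_lift: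
  assumes "q \<in> XX" "has_germ q e" "i < n" "lap_side i (orient i * e) x" "b i x = fst q"
  obtains p where "p \<in> lap i" "\<sigma> p = q" "fst p = x" "has_germ p (orient i * e)"
proof -
  have "0 \<le> a i" "a (Suc i) \<le> 1" using a_range[of i] a_range[of "Suc i"] assms(3) by auto
  then have "0 \<le> x" "x \<le> 1" "orient i * e = 1 \<and> x < 1 \<or> orient i * e = -1 \<and> 0 < x"
    using assms(4) by (auto simp: lap_side_def)
  then obtain p where p: "p \<in> XX" "fst p = x" "has_germ p (orient i * e)" by (rule germ_point)
  then have lap: "p \<in> lap i" using assms(4) by (auto simp: lap_def)
  have "orient i * (orient i * e) = e" using orient_cases[of i] by auto
  then have "has_germ (\<sigma> p) e" using \<sigma>_germ[OF lap assms(3) p(3)] by metis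
  then have "\<sigma> p = q"
    using germ_unique[OF \<sigma>_in[OF p(1)] assms(1) _ _ assms(2)] \<sigma>_fst[OF lap assms(3)] p(2) assms(5) by simp
  then show ?thesis using that lap p by blast
qed

lemma \<sigma>_germ_back:
  assumes p: "p \<in> lap i" and i: "i < n" and e: "has_germ (\<sigma> p) e"
  shows "has_germ p (orient i * e)"
proof -
  have XXp: "p \<in> XX" using p lap_sub by blast
  obtain g where g: "has_germ p g" using germ_exists XXp by blast
  have og: "has_germ (\<sigma> p) (orient i * g)" using \<sigma>_germ[OF p i g] .
  show ?thesis
  proof (cases "orient i * g = e")
    case True
    then show ?thesis using g orient_cases[of i] by auto
  next
    case False
    then have "has_germ (\<sigma> p) 1" "has_germ (\<sigma> p) (-1)"
      using og e by (auto simp: has_germ_def)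
    then have "fst (\<sigma> p) \<notin> S" using germ_both[OF \<sigma>_in[OF XXp]] by blast
    then have "fst p \<notin> S" using S_forward[OF i] lap_fst[OF p] \<sigma>_fst[OF p i] by auto
    then have "has_germ p 1 \<and> has_germ p (-1)" using I0_germ[OF XXp] by blast
    then show ?thesis using e orient_cases[of i] by (auto simp: has_germ_def)
  qed
qed

section \<open>The transfer operator along a single lap\<close>

definition lap_transfer :: "nat \<Rightarrow> (real \<times> int \<Rightarrow> int) \<Rightarrow> real \<times> int \<Rightarrow> int" where
  "lap_transfer i f p = (\<Sum>y | y \<in> lap i \<and> \<sigma> y = p. f y)"

lemma lap_transfer_image: "i < n \<Longrightarrow> y \<in> lap i \<Longrightarrow> lap_transfer i f (\<sigma> y) = f y"
proof -
  assume "i < n" "y \<in> lap i"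
  then have "{z. z \<in> lap i \<and> \<sigma> z = \<sigma> y} = {y}" using \<sigma>_inj by (auto simp: inj_on_def)
  then show ?thesis by (simp add: lap_transfer_def)
qed

lemma lap_transfer_outside: "p \<notin> \<sigma> ` lap i \<Longrightarrow> lap_transfer i f p = 0"
  unfolding lap_transfer_def by (rule sum.neutral) auto

lemma branch_between:
  assumes "i < n" "x \<in> {a i..a (Suc i)}" "y \<in> {a i..a (Suc i)}"
    "0 < of_int e * (z - b i x)" "of_int e * (z - b i x) < of_int e * (b i y - b i x)"
    "e = 1 \<or> e = -1"
  obtains w where "b i w = z" "x < w \<and> w < y \<or> y < w \<and> w < x"
proof -
  have cont: "continuous_on {min x y..max x y} (b i)"
    using assms by (intro continuous_on_subset[OF branch_cont[OF assms(1)]]) auto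
  have "\<exists>w\<ge>min x y. w \<le> max x y \<and> b i w = z"
    using IVT'[of "b i" "min x y" z "max x y"] IVT2'[of "b i" "max x y" z "min x y"] cont assms(4,5,6)
    by (cases "x \<le> y") (auto simp: min_def max_def)
  then obtain w where w: "min x y \<le> w" "w \<le> max x y" "b i w = z" by blast
  moreover have "w \<noteq> x" "w \<noteq> y" using w(3) assms(4,5) by auto
  ultimately show ?thesis using that[of w] by (auto simp: min_def max_def split: if_splits)
qed

text \<open>In terms of functions, \<open>\<sigma>\<close> maps the lap homeomorphically onto a
  clopen set. If p is the image of y, points close to p on one side are images of points close to y,
  where f is constant; if p is not hit, neither are the points close to it on that side.\<close>

lemma C_int_lap_transfer:
  assumes i: "i < n" and f: "f \<in> C_int X"
  shows "lap_transfer i f \<in> C_int X"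
  unfolding X_top_def C_int_split_iff
proof (intro conjI allI impI ballI)
  fix p assume "p \<notin> XX"
  then have "p \<notin> \<sigma> ` lap i" using \<sigma>_in lap_sub by blast
  then show "lap_transfer i f p = 0" by (rule lap_transfer_outside)
next
  fix p e assume p: "p \<in> XX" and e: "has_germ p e"
  have ee: "e = 1 \<or> e = -1" using e by (auto simp: has_germ_def)
  define o' where "o' = orient i"
  have oo: "o' = 1 \<or> o' = -1" using orient_cases by (simp add: o'_def)
  show "near S p e (\<lambda>q. lap_transfer i f q = lap_transfer i f p)"
  proof (cases "p \<in> \<sigma> ` lap i")
    case True
    then obtain y where y: "y \<in> lap i" "p = \<sigma> y" by blast
    have germ: "has_germ y (o' * e)" using \<sigma>_germ_back[OF y(1) i] e y(2) by (simp add: o'_def)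
    have side: "lap_side i (o' * e) (fst y)" using lap_germ[OF y(1) germ i] .
    have fst_p: "fst p = b i (fst y)" using \<sigma>_fst[OF y(1) i] y(2) by simp
    have "near S y (o' * e) (\<lambda>q. f q = f y)"
      using f y(1) lap_sub germ unfolding X_top_def C_int_split_iff by blast
    then obtain \<epsilon> where \<epsilon>: "\<epsilon> > 0" "\<And>q. q \<in> XX \<Longrightarrow> 0 < of_int (o' * e) * (fst q - fst y) \<Longrightarrow>
        of_int (o' * e) * (fst q - fst y) < \<epsilon> \<Longrightarrow> f q = f y"
      by (elim nearE) blast
    \<comment> \<open>\<open>x1\<close> bounds a one-sided interval at y that stays in the lap and
      on which f is constant; its value under the branch bounds the required interval at p.\<close>
    obtain x1 where x1: "0 < of_int (o' * e) * (x1 - fst y)" "of_int (o' * e) * (x1 - fst y) < \<epsilon>"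
      "x1 \<in> {a i..a (Suc i)}"
    proof (cases "o' * e = 1")
      case True
      then show ?thesis using that[of "min (a (Suc i)) (fst y + \<epsilon> / 2)"] side \<epsilon>(1)
        by (auto simp: lap_side_def)
    next
      case False
      then have oe: "o' * e = -1" using oo ee by auto
      show ?thesis using that[of "max (a i) (fst y - \<epsilon> / 2)"] side \<epsilon>(1)
        by (auto simp: lap_side_def oe)
    qed
    have pos: "0 < of_int e * (b i x1 - b i (fst y))"
      using branch_mono[OF i, of x1 "fst y"] branch_mono[OF i, of "fst y" x1] x1 lap_fst[OF y(1)] oo ee
      by (auto simp: o'_def[symmetric])
    show ?thesis
    proof (rule nearI[OF pos])
      fix q assume q: "q \<in> XX" "0 < of_int e * (fst q - fst p)"
        "of_int e * (fst q - fst p) < of_int e * (b i x1 - b i (fst y))"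
      obtain w where w: "b i w = fst q" "fst y < w \<and> w < x1 \<or> x1 < w \<and> w < fst y"
        using branch_between[OF i _ x1(3), of "fst y" e "fst q"] lap_fst[OF y(1)] q ee fst_p by auto
      have int: "a i < w" "w < a (Suc i)" using w(2) lap_fst[OF y(1)] x1(3) by auto
      obtain g where g: "has_germ q g" using germ_exists q(1) by blast
      have "lap_side i (orient i * g) w" using int g orient_cases[of i] by (auto simp: lap_side_def has_germ_def)
      then obtain y' where y': "y' \<in> lap i" "\<sigma> y' = q" "fst y' = w"
        using lap_lift[OF q(1) g i _ w(1)] by blast
      have "f y' = f y"
      proof (rule \<epsilon>(2))
        show "y' \<in> XX" using y'(1) lap_sub by blast
        show "0 < of_int (o' * e) * (fst y' - fst y)" "of_int (o' * e) * (fst y' - fst y) < \<epsilon>"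
          using w(2) x1(1,2) oo ee y'(3) by auto
      qed
      then show "lap_transfer i f q = lap_transfer i f p"
        using lap_transfer_image[OF i] y y' by metis
    qed
  next
    case False
    have zero: "lap_transfer i f p = 0" using lap_transfer_outside False by blast
    \<comment> \<open>Either the position of p is the value of the branch at an end of the lap, with
      the image on the other side of p, or it has positive distance from the compact image of the
      branch.\<close>
    have "\<exists>\<epsilon>>0. \<forall>y\<in>lap i. \<not> (0 < of_int e * (b i (fst y) - fst p) \<and> of_int e * (b i (fst y) - fst p) < \<epsilon>)"
    proof (cases "fst p \<in> b i ` {a i..a (Suc i)}")
      case True
      then obtain x where x: "x \<in> {a i..a (Suc i)}" "b i x = fst p" by auto
      have "\<not> lap_side i (o' * e) x"
        using lap_lift[OF p e i _ x(2)] False by (metis imageI o'_def)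
      then have end': "o' * e = 1 \<and> x = a (Suc i) \<or> o' * e = -1 \<and> x = a i"
        using x(1) oo ee by (auto simp: lap_side_def)
      have "of_int e * (b i (fst y) - fst p) \<le> 0" if "y \<in> lap i" for y
        using end' branch_mono_le[OF i, of "fst y" x] branch_mono_le[OF i, of x "fst y"] lap_fst[OF that]
          x oo ee by (auto simp: o'_def[symmetric])
      then show ?thesis by (intro exI[of _ 1]) force
    next
      case False
      have "closed (b i ` {a i..a (Suc i)})"
        by (intro compact_imp_closed compact_continuous_image branch_cont[OF i] compact_Icc)
      then have "open (- (b i ` {a i..a (Suc i)}))" by (simp add: open_Compl)
      then obtain \<epsilon> where \<epsilon>: "\<epsilon> > 0" "ball (fst p) \<epsilon> \<subseteq> - (b i ` {a i..a (Suc i)})"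
        using False unfolding open_contains_ball by (meson ComplI)
      have "\<not> (0 < of_int e * (b i (fst y) - fst p) \<and> of_int e * (b i (fst y) - fst p) < \<epsilon>)"
        if "y \<in> lap i" for y
      proof -
        have "b i (fst y) \<notin> ball (fst p) \<epsilon>" using lap_fst[OF that] \<epsilon>(2) by auto
        then have "\<epsilon> \<le> \<bar>b i (fst y) - fst p\<bar>" by (simp add: dist_real_def abs_minus_commute)
        then show ?thesis using ee by (auto simp: abs_if split: if_splits)
      qed
      then show ?thesis using \<epsilon>(1) by blast
    qed
    then obtain \<epsilon> where \<epsilon>: "\<epsilon> > 0"
      "\<forall>y\<in>lap i. \<not> (0 < of_int e * (b i (fst y) - fst p) \<and> of_int e * (b i (fst y) - fst p) < \<epsilon>)" by blast
    show ?thesis unfolding zero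
      by (rule nearI[OF \<epsilon>(1)], rule lap_transfer_outside) (use \<epsilon>(2) \<sigma>_fst[OF _ i] in auto)
  qed
qed

end

section \<open>The transfer operator and the scaled measure\<close>

lemma C_int_iff:
  "f \<in> C_int X \<longleftrightarrow> (\<forall>v. openin X {x \<in> topspace X. f x = v}) \<and> (\<forall>x. x \<notin> topspace X \<longrightarrow> f x = 0)"
proof
  assume f: "f \<in> C_int X"
  have "openin X {x \<in> topspace X. f x = v}" for v
    using openin_continuous_map_preimage[of X "discrete_topology UNIV" f "{v}"] f
    by (simp add: C_int_def)
  then show "(\<forall>v. openin X {x \<in> topspace X. f x = v}) \<and> (\<forall>x. x \<notin> topspace X \<longrightarrow> f x = 0)"
    using f by (auto simp: C_int_def)
next
  assume f: "(\<forall>v. openin X {x \<in> topspace X. f x = v}) \<and> (\<forall>x. x \<notin> topspace X \<longrightarrow> f x = 0)"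
  have "openin X {x \<in> topspace X. f x \<in> U}" for U
  proof -
    have "{x \<in> topspace X. f x \<in> U} = (\<Union>v\<in>U. {x \<in> topspace X. f x = v})" by auto
    then show ?thesis using f by auto
  qed
  then show "f \<in> C_int X" using f by (auto simp: C_int_def continuous_map_def)
qed

lemma C_int_openin: "f \<in> C_int X \<Longrightarrow> openin X {x \<in> topspace X. P (f x)}"
  using openin_continuous_map_preimage[of X "discrete_topology UNIV" f "Collect P"]
  by (simp add: C_int_def)

lemma C_int_closedin: "f \<in> C_int X \<Longrightarrow> closedin X {x \<in> topspace X. P (f x)}"
  using C_int_openin[of f X "\<lambda>v. \<not> P v"]
  by (auto simp: closedin_def Diff_eq Int_def cong: conj_cong)

lemma C_int_outside: "f \<in> C_int X \<Longrightarrow> x \<notin> topspace X \<Longrightarrow> f x = 0"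
  by (simp add: C_int_def)

lemma C_int_binop:
  assumes f: "f \<in> C_int X" and g: "g \<in> C_int X" and h: "h 0 0 = 0"
  shows "(\<lambda>x. h (f x) (g x)) \<in> C_int X"
  unfolding C_int_iff
proof (intro conjI allI impI)
  fix v
  have "{x \<in> topspace X. h (f x) (g x) = v} =
    (\<Union>k\<in>{k. h (fst k) (snd k) = v}. {x \<in> topspace X. f x = fst k} \<inter> {x \<in> topspace X. g x = snd k})"
    by auto
  moreover have "openin X ({x \<in> topspace X. f x = fst k} \<inter> {x \<in> topspace X. g x = snd k})" for k
    using f g unfolding C_int_iff by (intro openin_Int) auto
  ultimately show "openin X {x \<in> topspace X. h (f x) (g x) = v}" by (auto intro!: openin_Union)
qed (use f g h in \<open>simp add: C_int_def\<close>)

lemma C_int_zero: "(\<lambda>x. 0) \<in> C_int X"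
  by (simp add: C_int_def)

lemma C_int_add: "f \<in> C_int X \<Longrightarrow> g \<in> C_int X \<Longrightarrow> (\<lambda>x. f x + g x) \<in> C_int X"
  and C_int_diff: "f \<in> C_int X \<Longrightarrow> g \<in> C_int X \<Longrightarrow> (\<lambda>x. f x - g x) \<in> C_int X"
  and C_int_mult: "f \<in> C_int X \<Longrightarrow> g \<in> C_int X \<Longrightarrow> (\<lambda>x. f x * g x) \<in> C_int X"
  and C_int_max: "f \<in> C_int X \<Longrightarrow> g \<in> C_int X \<Longrightarrow> (\<lambda>x. max (f x) (g x)) \<in> C_int X"
  using C_int_binop[where h = "(+)"] C_int_binop[where h = "(-)"] C_int_binop[where h = "(*)"]
    C_int_binop[where h = max] by auto

lemma C_int_scale: "f \<in> C_int X \<Longrightarrow> (\<lambda>x. c * f x) \<in> C_int X"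
  and C_int_minus: "f \<in> C_int X \<Longrightarrow> (\<lambda>x. - f x) \<in> C_int X"
  and C_int_abs: "f \<in> C_int X \<Longrightarrow> (\<lambda>x. \<bar>f x\<bar>) \<in> C_int X"
  using C_int_binop[of f X f "\<lambda>u v. c * u"] C_int_binop[of f X f "\<lambda>u v. - u"]
    C_int_binop[of f X f "\<lambda>u v. \<bar>u\<bar>"] by auto

lemma C_int_sum: "(\<And>i. i \<in> A \<Longrightarrow> f i \<in> C_int X) \<Longrightarrow> (\<lambda>x. \<Sum>i\<in>A. f i x) \<in> C_int X"
  by (induction A rule: infinite_finite_induct) (auto intro: C_int_zero C_int_add)

lemma C_int_indicator:
  assumes "openin X U" "closedin X U"
  shows "indicator U \<in> C_int X"
  unfolding C_int_iff
proof (intro conjI allI impI)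
  fix v :: int
  have "{x \<in> topspace X. indicator U x = v} =
    (if v = 1 then U else if v = 0 then topspace X - U else {})"
    using openin_subset[OF assms(1)] by (auto simp: indicator_def split: if_splits)
  then show "openin X {x \<in> topspace X. indicator U x = v}" using assms by auto
qed (use openin_subset[OF assms(1)] in \<open>auto simp: indicator_def\<close>)

lemma C_int_compose:
  assumes f: "f \<in> C_int X" and g: "continuous_map X X g"
  shows "(\<lambda>x. if x \<in> topspace X then f (g x) else 0) \<in> C_int X"
  unfolding C_int_iff
proof (intro conjI allI impI)
  fix v
  have "{x \<in> topspace X. (if x \<in> topspace X then f (g x) else 0) = v}
    = {x \<in> topspace X. g x \<in> {y \<in> topspace X. f y = v}}"
    using g by (auto simp: continuous_map_def)
  moreover have "openin X {x \<in> topspace X. g x \<in> {y \<in> topspace X. f y = v}}"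
    by (rule openin_continuous_map_preimage[OF g]) (use f in \<open>simp add: C_int_iff\<close>)
  ultimately show "openin X {x \<in> topspace X. (if x \<in> topspace X then f (g x) else 0) = v}" by simp
qed simp

section \<open>Algebraic rules for the transfer operator\<close>

lemma transfer_add: "transfer X \<sigma> (\<lambda>x. f x + g x) = (\<lambda>x. transfer X \<sigma> f x + transfer X \<sigma> g x)"
  and transfer_diff: "transfer X \<sigma> (\<lambda>x. f x - g x) = (\<lambda>x. transfer X \<sigma> f x - transfer X \<sigma> g x)"
  and transfer_scale: "transfer X \<sigma> (\<lambda>x. c * f x) = (\<lambda>x. c * transfer X \<sigma> f x)"
  and transfer_zero: "transfer X \<sigma> (\<lambda>x. 0) = (\<lambda>x. 0)"
  by (auto simp: transfer_def fun_eq_iff sum.distrib sum_subtractf sum_distrib_left)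

lemma transfer_sum:
  "transfer X \<sigma> (\<lambda>x. \<Sum>i\<in>A. f i x) = (\<lambda>x. \<Sum>i\<in>A. transfer X \<sigma> (f i) x)"
  by (induction A rule: infinite_finite_induct) (simp_all add: transfer_zero transfer_add)

lemma transfer_mono:
  "(\<And>x. x \<in> topspace X \<Longrightarrow> f x \<le> g x) \<Longrightarrow> transfer X \<sigma> f x \<le> transfer X \<sigma> g x"
  by (auto simp: transfer_def intro: sum_mono)

lemma transfer_cong:
  "(\<And>x. x \<in> topspace X \<Longrightarrow> f x = g x) \<Longrightarrow> transfer X \<sigma> f = transfer X \<sigma> g"
  by (auto simp: transfer_def fun_eq_iff intro: sum.cong)

text \<open>\<open>g \<circ> \<sigma>\<close> is constant on each fibre and so comes out of the
  sum.\<close>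

lemma transfer_module:
  "transfer X \<sigma> (\<lambda>y. f y * g (\<sigma> y)) = (\<lambda>x. transfer X \<sigma> f x * g x)"
  by (auto simp: transfer_def fun_eq_iff sum_distrib_right intro!: sum.cong)

lemma transfer_pow_add: "(transfer X \<sigma> ^^ k) (\<lambda>x. f x + g x) = (\<lambda>x. (transfer X \<sigma> ^^ k) f x + (transfer X \<sigma> ^^ k) g x)"
  and transfer_pow_diff: "(transfer X \<sigma> ^^ k) (\<lambda>x. f x - g x) = (\<lambda>x. (transfer X \<sigma> ^^ k) f x - (transfer X \<sigma> ^^ k) g x)"
  and transfer_pow_scale: "(transfer X \<sigma> ^^ k) (\<lambda>x. c * f x) = (\<lambda>x. c * (transfer X \<sigma> ^^ k) f x)"
  and transfer_pow_zero: "(transfer X \<sigma> ^^ k) (\<lambda>x. 0) = (\<lambda>x. 0)"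
  by (induction k) (simp_all add: transfer_add transfer_diff transfer_scale transfer_zero)

lemma transfer_pow_sum:
  "(transfer X \<sigma> ^^ k) (\<lambda>x. \<Sum>i\<in>A. f i x) = (\<lambda>x. \<Sum>i\<in>A. (transfer X \<sigma> ^^ k) (f i) x)"
  by (induction k) (simp_all add: transfer_sum)

lemma transfer_pow_mono:
  "(\<And>x. f x \<le> g x) \<Longrightarrow> (transfer X \<sigma> ^^ k) f x \<le> (transfer X \<sigma> ^^ k) g x"
  by (induction k arbitrary: x) (auto intro!: transfer_mono)

lemma transfer_pow_nonneg: "(\<And>x. 0 \<le> f x) \<Longrightarrow> 0 \<le> (transfer X \<sigma> ^^ k) f x"
  using transfer_pow_mono[of "\<lambda>_. 0" f k X \<sigma> x] by (simp add: transfer_pow_zero)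

text \<open>Of the interval only the clopen laps with injective \<open>\<sigma>\<close> are kept.
  \<open>C_lap\<close> encodes that \<open>\<sigma>\<close> is open on each lap, and
  \<open>finite_range\<close> is the consequence of compactness that integration needs.\<close>

locale lap_system =
  fixes X :: "'a topology" and \<sigma> :: "'a \<Rightarrow> 'a" and E :: "nat \<Rightarrow> 'a set" and n :: nat
  assumes \<sigma>_cont: "continuous_map X X \<sigma>"
    and E_open: "i < n \<Longrightarrow> openin X (E i)"
    and E_cover: "(\<Union>i<n. E i) = topspace X"
    and E_disj: "disjoint_family_on E {..<n}"
    and \<sigma>_inj: "i < n \<Longrightarrow> inj_on \<sigma> (E i)"
    and C_lap: "i < n \<Longrightarrow> f \<in> C_int X \<Longrightarrow> (\<lambda>p. \<Sum>y | y \<in> E i \<and> \<sigma> y = p. f y) \<in> C_int X"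
    and finite_range: "f \<in> C_int X \<Longrightarrow> finite (range f)"
begin

abbreviation "L \<equiv> transfer X \<sigma>"

lemma \<sigma>_in: "x \<in> topspace X \<Longrightarrow> \<sigma> x \<in> topspace X"
  using \<sigma>_cont by (auto simp: continuous_map_def)

lemma \<sigma>_pow_in: "x \<in> topspace X \<Longrightarrow> (\<sigma> ^^ k) x \<in> topspace X"
  by (induction k) (auto intro: \<sigma>_in)

lemma E_sub: "i < n \<Longrightarrow> E i \<subseteq> topspace X"
  using E_cover by auto

lemma E_unique: "x \<in> E i \<Longrightarrow> x \<in> E j \<Longrightarrow> i < n \<Longrightarrow> j < n \<Longrightarrow> i = j"
  using E_disj unfolding disjoint_family_on_def by blast

lemma E_closed: "i < n \<Longrightarrow> closedin X (E i)"
proof -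
  assume i: "i < n"
  have "topspace X - E i = (\<Union>j\<in>{..<n} - {i}. E j)"
    using E_cover E_disj i by (fastforce simp: disjoint_family_on_def)
  then show "closedin X (E i)" using E_open E_sub[OF i] by (auto simp: closedin_def)
qed

lemma C_E: "i < n \<Longrightarrow> indicator (E i) \<in> C_int X"
  by (intro C_int_indicator E_open E_closed)

lemma C_X: "indicator (topspace X) \<in> C_int X"
  by (intro C_int_indicator) auto

lemma lap_fibre: "i < n \<Longrightarrow> y \<in> E i \<Longrightarrow> {z. z \<in> E i \<and> \<sigma> z = \<sigma> y} = {y}"
  using \<sigma>_inj by (auto simp: inj_on_def)

lemma finite_lap_fibre: "i < n \<Longrightarrow> finite {y. y \<in> E i \<and> \<sigma> y = x}"
proof (cases "\<exists>y\<in>E i. \<sigma> y = x")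
  case True
  then show "i < n \<Longrightarrow> finite {y. y \<in> E i \<and> \<sigma> y = x}" using lap_fibre by fastforce
next
  case False
  then have "{y. y \<in> E i \<and> \<sigma> y = x} = {}" by blast
  then show ?thesis by (metis finite.emptyI)
qed

lemma fibre_eq: "{y. y \<in> topspace X \<and> \<sigma> y = x} = (\<Union>i<n. {y. y \<in> E i \<and> \<sigma> y = x})"
  using E_cover by auto

lemma finite_fibre: "finite {y. y \<in> topspace X \<and> \<sigma> y = x}"
  unfolding fibre_eq using finite_lap_fibre by auto

lemma L_eq: "L f x = (\<Sum>i<n. \<Sum>y | y \<in> E i \<and> \<sigma> y = x. f y)"
proof (cases "x \<in> topspace X")
  case True
  then have "L f x = (\<Sum>y\<in>(\<Union>i<n. {y. y \<in> E i \<and> \<sigma> y = x}). f y)"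
    by (simp add: transfer_def fibre_eq)
  also have "\<dots> = (\<Sum>i<n. \<Sum>y | y \<in> E i \<and> \<sigma> y = x. f y)"
    using finite_lap_fibre E_unique by (intro sum.UNION_disjoint) (simp, simp, blast)
  finally show ?thesis .
next
  case False
  have "(\<Sum>y | y \<in> E i \<and> \<sigma> y = x. f y) = 0" if "i < n" for i
    by (rule sum.neutral) (use \<sigma>_in E_sub[OF that] False in blast)
  then show ?thesis using False by (simp add: transfer_def)
qed

lemma C_L: "f \<in> C_int X \<Longrightarrow> L f \<in> C_int X"
proof -
  assume "f \<in> C_int X"
  then have "(\<lambda>x. \<Sum>i<n. \<Sum>y | y \<in> E i \<and> \<sigma> y = x. f y) \<in> C_int X"
    by (intro C_int_sum C_lap) auto
  moreover have "L f = (\<lambda>x. \<Sum>i<n. \<Sum>y | y \<in> E i \<and> \<sigma> y = x. f y)"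
    using L_eq by blast
  ultimately show ?thesis by simp
qed

lemma C_L_pow: "f \<in> C_int X \<Longrightarrow> (L ^^ k) f \<in> C_int X"
  by (induction k) (auto intro: C_L)

lemma L_ge_fibre:
  assumes "\<And>x. 0 \<le> f x" "y \<in> topspace X"
  shows "f y \<le> L f (\<sigma> y)"
proof -
  have "f y = (\<Sum>z\<in>{y}. f z)" by simp
  also have "\<dots> \<le> (\<Sum>z | z \<in> topspace X \<and> \<sigma> z = \<sigma> y. f z)"
    using assms finite_fibre by (intro sum_mono2) auto
  finally show ?thesis using assms(2) \<sigma>_in by (simp add: transfer_def)
qed

lemma L_pow_ge_fibre:
  assumes f: "\<And>x. 0 \<le> f x" and y: "y \<in> topspace X"
  shows "f y \<le> (L ^^ k) f ((\<sigma> ^^ k) y)"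
proof (induction k)
  case (Suc k)
  have "\<And>x. 0 \<le> (L ^^ k) f x" by (rule transfer_pow_nonneg) (rule f)
  then show ?case
    using Suc L_ge_fibre[of "(L ^^ k) f" "(\<sigma> ^^ k) y"] \<sigma>_pow_in[OF y] by fastforce
qed simp

lemma L_inj_on:
  assumes g: "{x. g x \<noteq> 0} \<subseteq> U" and U: "U \<subseteq> topspace X" "inj_on \<sigma> U"
  shows "y \<in> U \<Longrightarrow> L g (\<sigma> y) = g y" and "x \<notin> \<sigma> ` U \<Longrightarrow> L g x = 0"
proof -
  assume y: "y \<in> U"
  have "(\<Sum>z | z \<in> topspace X \<and> \<sigma> z = \<sigma> y. g z) = (\<Sum>z\<in>{y}. g z)"
    using y g U finite_fibre by (intro sum.mono_neutral_right) (auto dest: inj_onD)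
  then show "L g (\<sigma> y) = g y" using y U(1) \<sigma>_in by (auto simp: transfer_def)
next
  assume "x \<notin> \<sigma> ` U"
  then have "g z = 0" if "\<sigma> z = x" for z using g that by blast
  then show "L g x = 0" by (auto simp: transfer_def intro: sum.neutral)
qed

text \<open>Each fibre of the k-th iterate of \<open>\<sigma>\<close> meets U at most once, so g is
  transported without overlap. The induction strips the first application of \<open>\<sigma>\<close>
  and replaces U by its image.\<close>

lemma L_pow_inj_on:
  assumes g: "{x. g x \<noteq> 0} \<subseteq> U" and U: "U \<subseteq> topspace X" "inj_on (\<sigma> ^^ k) U"
  shows "(\<forall>y\<in>U. (L ^^ k) g ((\<sigma> ^^ k) y) = g y) \<and> (\<forall>x. x \<notin> (\<sigma> ^^ k) ` U \<longrightarrow> (L ^^ k) g x = 0)"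
  using assms
proof (induction k arbitrary: g U)
  case 0
  then show ?case by auto
next
  case (Suc k)
  have inj: "inj_on \<sigma> U" "inj_on (\<sigma> ^^ k) (\<sigma> ` U)"
    using Suc.prems(3) inj_on_imageI2[of "\<sigma> ^^ k" \<sigma> U] inj_on_imageI[of "\<sigma> ^^ k" \<sigma> U]
    by (simp_all only: funpow_Suc_right)
  note L = L_inj_on[OF Suc.prems(1,2) inj(1)]
  have "{x. L g x \<noteq> 0} \<subseteq> \<sigma> ` U" using L(2) by blast
  moreover have "\<sigma> ` U \<subseteq> topspace X" using Suc.prems(2) \<sigma>_in by blast
  ultimately have IH: "\<forall>y\<in>\<sigma> ` U. (L ^^ k) (L g) ((\<sigma> ^^ k) y) = L g y"
    "\<forall>x. x \<notin> (\<sigma> ^^ k) ` \<sigma> ` U \<longrightarrow> (L ^^ k) (L g) x = 0"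
    using Suc.IH[OF _ _ inj(2)] by blast+
  then show ?case using L(1) by (simp add: funpow_Suc_right image_comp del: funpow.simps)
qed

lemma L_indicator:
  assumes "U \<subseteq> E i" "i < n"
  shows "L (indicator U) = indicator (\<sigma> ` U)"
proof
  fix x
  have "{x. indicator U x \<noteq> (0::int)} \<subseteq> U" by (auto simp: indicator_def split: if_splits)
  moreover have "U \<subseteq> topspace X" using assms E_sub by blast
  moreover have "inj_on \<sigma> U" using \<sigma>_inj[OF assms(2)] assms(1) by (rule inj_on_subset)
  ultimately show "L (indicator U) x = indicator (\<sigma> ` U) x"
    using L_inj_on[of "indicator U" U] by (cases "x \<in> \<sigma> ` U") auto
qed

text \<open>f is lifted lap by lap: its part over the image of lap m is lifted along that lap, and
  the remainder is supported on the images of the earlier laps. Later this yields that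
  multiplication by s maps \<open>M i\<close> onto all of \<open>M (succ i)\<close>.\<close>

lemma L_surj:
  assumes f: "f \<in> C_int X" and onto: "\<sigma> ` topspace X = topspace X"
  obtains g where "g \<in> C_int X" "L g = f"
proof -
  have "\<exists>g\<in>C_int X. L g = f" if "m \<le> n" "f \<in> C_int X" "\<And>x. f x \<noteq> 0 \<Longrightarrow> x \<in> (\<Union>i<m. \<sigma> ` E i)" for m f
    using that
  proof (induction m arbitrary: f)
    case 0
    then have "f = (\<lambda>x. 0)" by auto
    then show ?case using transfer_zero C_int_zero by metis
  next
    case (Suc m)
    have m: "m < n" using Suc by auto
    define u where "u = (indicator (\<sigma> ` E m) :: 'a \<Rightarrow> int)"
    have "u = L (indicator (E m))" unfolding u_def using L_indicator[of "E m" m] m by simp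
    then have u: "u \<in> C_int X" using C_L C_E[OF m] by simp
    have "\<exists>g\<in>C_int X. L g = (\<lambda>x. f x * (indicator (topspace X) x - u x))"
    proof (rule Suc.IH)
      show "(\<lambda>x. f x * (indicator (topspace X) x - u x)) \<in> C_int X"
        using Suc.prems u C_X by (intro C_int_mult C_int_diff)
      fix x assume "f x * (indicator (topspace X) x - u x) \<noteq> 0"
      then have "f x \<noteq> 0" "x \<notin> \<sigma> ` E m"
        using C_int_outside[OF Suc.prems(2)] by (auto simp: u_def indicator_def split: if_splits)
      then show "x \<in> (\<Union>i<m. \<sigma> ` E i)" using Suc.prems(3)[of x] less_Suc_eq by blast
    qed (use m in simp)
    then obtain g where g: "g \<in> C_int X" "L g = (\<lambda>x. f x * (indicator (topspace X) x - u x))" by blast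
    define h where "h = (\<lambda>x. indicator (E m) x * f (\<sigma> x))"
    have "h = (\<lambda>x. indicator (E m) x * (if x \<in> topspace X then f (\<sigma> x) else 0))"
      using E_sub[OF m] unfolding h_def by (intro ext) (auto simp: indicator_def)
    then have hC: "h \<in> C_int X" using C_int_mult[OF C_E[OF m] C_int_compose[OF Suc.prems(2) \<sigma>_cont]] by simp
    have "L h = (\<lambda>x. u x * f x)"
      unfolding h_def transfer_module u_def using L_indicator[of "E m" m] m by simp
    then have "L (\<lambda>x. g x + h x) = (\<lambda>x. f x * indicator (topspace X) x)"
      by (simp add: transfer_add g algebra_simps)
    also have "\<dots> = f" using C_int_outside[OF Suc.prems(2)] by (intro ext) (auto simp: indicator_def)
    finally show ?case using g hC C_int_add by blast
  qed
  moreover have "x \<in> (\<Union>i<n. \<sigma> ` E i)" if "f x \<noteq> 0" for x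
    using C_int_outside[OF f, of x] that onto unfolding E_cover[symmetric] by blast
  ultimately show ?thesis using that f by blast
qed

end

section \<open>Integration against the scaled measure\<close>

locale scaled_lap_system = lap_system +
  fixes s :: real and \<mu> :: "'a measure"
  assumes scaled: "scaled_measure X \<sigma> s \<mu>"
begin

sublocale prob_space \<mu>
  using scaled by (simp add: scaled_measure_def)

lemma s_pos: "0 < s" and space_\<mu>: "space \<mu> = topspace X"
  using scaled by (auto simp: scaled_measure_def)

lemma open_sets: "openin X U \<Longrightarrow> U \<in> sets \<mu>"
  using scaled by (auto simp: scaled_measure_def intro: sigma_sets.Basic)

definition I :: "('a \<Rightarrow> int) \<Rightarrow> real" where "I f = (\<integral>x. of_int (f x) \<partial>\<mu>)"

lemma C_int_integrable:
  assumes f: "f \<in> C_int X"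
  shows "integrable \<mu> (\<lambda>x. of_int (f x) :: real)"
proof -
  have "f \<in> measurable \<mu> (count_space UNIV)"
    unfolding measurable_count_space_eq2_countable
  proof (intro conjI ballI)
    fix v
    have "f -` {v} \<inter> space \<mu> = {x \<in> topspace X. f x = v}" by (auto simp: space_\<mu>)
    then show "f -` {v} \<inter> space \<mu> \<in> sets \<mu>" using f open_sets by (simp add: C_int_iff)
  qed auto
  then have meas: "(\<lambda>x. of_int (f x) :: real) \<in> borel_measurable \<mu>"
    by (rule measurable_compose) simp
  obtain B where B: "\<bar>f x\<bar> \<le> B" for x
  proof -
    have "finite (abs ` range f)" using finite_range[OF f] by simp
    then show ?thesis using that[of "Max (abs ` range f)"] by (auto intro: Max_ge)
  qed
  have "norm (of_int (f x) :: real) \<le> of_int B" for x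
    using B[of x] by (simp flip: of_int_abs)
  then show ?thesis by (intro integrable_const_bound[of _ "of_int B"] meas) auto
qed

lemma I_add: "f \<in> C_int X \<Longrightarrow> g \<in> C_int X \<Longrightarrow> I (\<lambda>x. f x + g x) = I f + I g"
  and I_diff: "f \<in> C_int X \<Longrightarrow> g \<in> C_int X \<Longrightarrow> I (\<lambda>x. f x - g x) = I f - I g"
  using C_int_integrable by (auto simp: I_def)

lemma I_scale: "I (\<lambda>x. c * f x) = of_int c * I f"
  by (simp add: I_def)

lemma I_zero: "I (\<lambda>x. 0) = 0"
  by (simp add: I_def)

lemma I_sum: "(\<And>i. i \<in> A \<Longrightarrow> f i \<in> C_int X) \<Longrightarrow> I (\<lambda>x. \<Sum>i\<in>A. f i x) = (\<Sum>i\<in>A. I (f i))"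
  using C_int_integrable by (auto simp: I_def intro!: Bochner_Integration.integral_sum)

lemma I_mono:
  assumes "f \<in> C_int X" "g \<in> C_int X" "\<And>x. x \<in> topspace X \<Longrightarrow> f x \<le> g x"
  shows "I f \<le> I g"
  unfolding I_def using assms C_int_integrable by (intro integral_mono) (auto simp: space_\<mu>)

lemma I_nonneg: "(\<And>x. 0 \<le> f x) \<Longrightarrow> 0 \<le> I f"
  unfolding I_def by (intro integral_nonneg_AE) auto

lemma I_indicator:
  assumes "indicator U \<in> C_int X" "U \<subseteq> topspace X"
  shows "I (indicator U) = measure \<mu> U"
proof -
  have "U = {x \<in> topspace X. indicator U x = (1::int)}" using assms(2) by (auto simp: indicator_def)
  then have "U \<in> sets \<mu>" using C_int_openin[OF assms(1), of "\<lambda>v. v = 1"] open_sets by simp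
  moreover have "I (indicator U) = (\<integral>x. indicator U x \<partial>\<mu>)"
    unfolding I_def by (intro Bochner_Integration.integral_cong) (auto simp: indicator_def)
  ultimately show ?thesis using assms(2) by (simp add: space_\<mu> Int_absorb2)
qed

lemma I_X: "I (indicator (topspace X)) = 1"
  using I_indicator[OF C_X] prob_space by (simp add: space_\<mu>)

lemma I_L_indicator:
  assumes "openin X U" "closedin X U" "U \<subseteq> E i" "i < n"
  shows "I (L (indicator U)) = s * I (indicator U)"
proof -
  have U: "indicator U \<in> C_int X" using assms C_int_indicator by blast
  have "I (indicator (\<sigma> ` U)) = measure \<mu> (\<sigma> ` U)"
    using C_L[OF U] L_indicator[OF assms(3,4)] \<sigma>_in openin_subset[OF assms(1)]
    by (intro I_indicator) auto
  also have "\<dots> = s * measure \<mu> U"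
    using scaled open_sets[OF assms(1)] inj_on_subset[OF \<sigma>_inj[OF assms(4)] assms(3)]
    by (auto simp: scaled_measure_def)
  finally show ?thesis
    using L_indicator[OF assms(3,4)] I_indicator[OF U openin_subset[OF assms(1)]] by simp
qed

text \<open>The scaling property concerns sets on which \<open>\<sigma>\<close> is injective. f is a
  finite combination of indicators of its level sets inside the laps, and the transfer of such an
  indicator is the indicator of the image.\<close>

lemma I_L: "f \<in> C_int X \<Longrightarrow> I (L f) = s * I f"
proof -
  assume f: "f \<in> C_int X"
  define U where "U = (\<lambda>(i, v). {x \<in> E i. f x = v})"
  define K where "K = {..<n} \<times> range f"
  have fin: "finite K" using finite_range[OF f] by (simp add: K_def)
  have U: "openin X (U k)" "closedin X (U k)" "U k \<subseteq> E (fst k)" "fst k < n" if k: "k \<in> K" for k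
  proof -
    have i: "fst k < n" using k by (auto simp: K_def)
    have "U k = E (fst k) \<inter> {x \<in> topspace X. f x = snd k}"
      using E_sub[OF i] by (auto simp: U_def split_def)
    then show "openin X (U k)" "closedin X (U k)" "U k \<subseteq> E (fst k)" "fst k < n"
      using i E_open[OF i] E_closed[OF i] C_int_openin[OF f, of "\<lambda>v. v = snd k"]
        C_int_closedin[OF f, of "\<lambda>v. v = snd k"] by (auto intro: openin_Int closedin_Int)
  qed
  have CU: "indicator (U k) \<in> C_int X" if "k \<in> K" for k
    using U that by (intro C_int_indicator) auto
  have eq: "f = (\<lambda>x. \<Sum>k\<in>K. snd k * indicator (U k) x)"
  proof
    fix x
    show "f x = (\<Sum>k\<in>K. snd k * indicator (U k) x)"
    proof (cases "x \<in> topspace X")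
      case True
      then obtain i where i: "i < n" "x \<in> E i" using E_cover by auto
      have "(\<Sum>k\<in>K. snd k * indicator (U k) x) = (\<Sum>k\<in>{(i, f x)}. snd k * indicator (U k) x)"
        using i E_disj fin
        by (intro sum.mono_neutral_right) (auto simp: K_def U_def indicator_def disjoint_family_on_def)
      then show ?thesis using i by (simp add: U_def)
    next
      case False
      then have "(\<Sum>k\<in>K. snd k * indicator (U k) x) = 0"
        using U(3,4) E_sub by (intro sum.neutral) (fastforce simp: indicator_def)
      then show ?thesis using C_int_outside[OF f False] by simp
    qed
  qed
  have "I (L f) = (\<Sum>k\<in>K. of_int (snd k) * I (L (indicator (U k))))"
    by (subst eq, subst transfer_sum, subst I_sum)
      (auto simp: transfer_scale I_scale intro!: C_int_scale C_L CU)
  also have "\<dots> = (\<Sum>k\<in>K. s * (of_int (snd k) * I (indicator (U k))))"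
    using I_L_indicator[OF U(1-4)] by (intro sum.cong) (auto simp: mult.left_commute)
  also have "\<dots> = s * (\<Sum>k\<in>K. of_int (snd k) * I (indicator (U k)))"
    by (simp add: sum_distrib_left)
  also have "(\<Sum>k\<in>K. of_int (snd k) * I (indicator (U k))) = I f"
    by (subst eq, subst I_sum) (auto simp: I_scale intro!: C_int_scale CU)
  finally show ?thesis .
qed

lemma I_L_pow: "f \<in> C_int X \<Longrightarrow> I ((L ^^ k) f) = s ^ k * I f"
  by (induction k) (simp_all add: I_L C_L_pow)

lemma I_restrict:
  assumes U: "openin X U" "closedin X U" and g: "g \<in> C_int X"
  shows "(\<And>x. x \<in> U \<Longrightarrow> c \<le> of_int (g x)) \<Longrightarrow> c * I (indicator U) \<le> I (\<lambda>x. g x * indicator U x)"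
    and "(\<And>x. x \<in> U \<Longrightarrow> of_int (g x) \<le> c) \<Longrightarrow> I (\<lambda>x. g x * indicator U x) \<le> c * I (indicator U)"
proof -
  have CU: "indicator U \<in> C_int X" using U C_int_indicator by blast
  have int: "integrable \<mu> (\<lambda>x. c * of_int (indicator U x))"
    "integrable \<mu> (\<lambda>x. of_int (g x * indicator U x) :: real)"
    using C_int_integrable[OF CU] C_int_integrable[OF C_int_mult[OF g CU]] by simp_all
  have eq: "c * I (indicator U) = (\<integral>x. c * of_int (indicator U x) \<partial>\<mu>)" by (simp add: I_def)
  show "c * I (indicator U) \<le> I (\<lambda>x. g x * indicator U x)" if "\<And>x. x \<in> U \<Longrightarrow> c \<le> of_int (g x)"
    unfolding eq unfolding I_def using that by (intro integral_mono int) (auto simp: indicator_def)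
  show "I (\<lambda>x. g x * indicator U x) \<le> c * I (indicator U)" if "\<And>x. x \<in> U \<Longrightarrow> of_int (g x) \<le> c"
    unfolding eq unfolding I_def using that by (intro integral_mono int) (auto simp: indicator_def)
qed

lemma I_ge:
  assumes "openin X U" "closedin X U" "g \<in> C_int X" "\<And>x. 0 \<le> g x" "\<And>x. x \<in> U \<Longrightarrow> c \<le> of_int (g x)"
  shows "c * I (indicator U) \<le> I g"
proof -
  have "c * I (indicator U) \<le> I (\<lambda>x. g x * indicator U x)" using assms by (intro I_restrict)
  also have "\<dots> \<le> I g"
    using assms by (intro I_mono C_int_mult C_int_indicator) (auto simp: indicator_def)
  finally show ?thesis .
qed

end

section \<open>Exact cycles\<close>

locale exact_lap_system = scaled_lap_system +
  fixes N :: nat and Y :: "nat \<Rightarrow> 'a set"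
  assumes cycle: "exact_cycle X \<sigma> N Y"
begin

definition succ :: "nat \<Rightarrow> nat" where "succ i = i mod N + 1"

definition restr :: "nat \<Rightarrow> ('a \<Rightarrow> int) \<Rightarrow> 'a \<Rightarrow> int" where
  "restr i f = (\<lambda>x. f x * indicator (Y i) x)"

lemma N_pos: "0 < N" and Y_cover: "(\<Union>i\<in>{1..N}. Y i) = topspace X"
  and Y_disj: "disjoint_family_on Y {1..N}"
  using cycle by (auto simp: exact_cycle_def)

lemma Y_props:
  assumes "i \<in> {1..N}"
  shows "Y i \<noteq> {}" "openin X (Y i)" "closedin X (Y i)" "\<sigma> ` Y i = Y (succ i)" "Y i \<subseteq> topspace X"
  using cycle assms openin_subset by (auto simp: exact_cycle_def succ_def)

lemma Y_exact:
  assumes "i \<in> {1..N}" "openin X V" "V \<subseteq> Y i" "V \<noteq> {}"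
  obtains k where "(\<sigma> ^^ (N * k)) ` V = Y i"
proof -
  have ex: "topologically_exact (subtopology X (Y i)) (\<sigma> ^^ N)"
    using cycle assms(1) by (auto simp: exact_cycle_def)
  have "openin (subtopology X (Y i)) V"
    using assms(2,3) Y_props(2)[OF assms(1)] by (auto simp: openin_open_subtopology)
  then obtain k where "((\<sigma> ^^ N) ^^ k) ` V = topspace (subtopology X (Y i))"
    using ex assms(4) unfolding topologically_exact_def by blast
  moreover have "topspace (subtopology X (Y i)) = Y i"
    using Y_props(5)[OF assms(1)] by auto
  ultimately show ?thesis using that[of k] by (simp add: funpow_mult)
qed

lemma Y_unique: "x \<in> Y i \<Longrightarrow> x \<in> Y j \<Longrightarrow> i \<in> {1..N} \<Longrightarrow> j \<in> {1..N} \<Longrightarrow> i = j"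
  using Y_disj unfolding disjoint_family_on_def by blast

lemma succ_in: "succ i \<in> {1..N}"
  using N_pos by (simp add: succ_def Suc_leI)

lemma succ_pow: "i \<in> {1..N} \<Longrightarrow> (succ ^^ k) i = (i - 1 + k) mod N + 1"
proof (induction k)
  case 0
  then show ?case using N_pos by auto
next
  case (Suc k)
  then show ?case by (simp add: succ_def mod_Suc_eq)
qed

lemma succ_pow_in: "i \<in> {1..N} \<Longrightarrow> (succ ^^ k) i \<in> {1..N}"
  using succ_in by (cases k) auto

lemma succ_pow_N: "i \<in> {1..N} \<Longrightarrow> (succ ^^ (N * k)) i = i"
  by (cases i) (auto simp: succ_pow)

lemma succ_pred: "i \<in> {1..N} \<Longrightarrow> succ (if i = 1 then N else i - 1) = i"
  by (auto simp: succ_def)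

lemma pred_succ: "i \<in> {1..N} \<Longrightarrow> (if succ i = 1 then N else succ i - 1) = i"
  using N_pos by (cases "i = N") (auto simp: succ_def)

lemma inj_succ: "inj_on succ {1..N}"
  by (rule inj_on_inverseI[where g = "\<lambda>i. if i = 1 then N else i - 1"]) (rule pred_succ)

lemma \<sigma>_Y_iff:
  assumes "x \<in> topspace X" "i \<in> {1..N}"
  shows "\<sigma> x \<in> Y (succ i) \<longleftrightarrow> x \<in> Y i"
proof
  assume "\<sigma> x \<in> Y (succ i)"
  moreover obtain j where j: "j \<in> {1..N}" "x \<in> Y j" using assms(1) Y_cover by blast
  moreover have "\<sigma> x \<in> Y (succ j)" using Y_props(4)[OF j(1)] j(2) by blast
  ultimately have "succ i = succ j" using Y_unique succ_in by blast
  then show "x \<in> Y i" using j assms(2) inj_succ by (auto dest: inj_onD)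
qed (use Y_props(4)[OF assms(2)] in blast)

lemma \<sigma>_pow_Y: "i \<in> {1..N} \<Longrightarrow> (\<sigma> ^^ k) ` Y i = Y ((succ ^^ k) i)"
proof (induction k)
  case (Suc k)
  then show ?case using Y_props(4)[OF succ_pow_in[OF Suc.prems]] by (metis funpow.simps(2) image_comp o_apply)
qed simp

lemma \<sigma>_onto: "\<sigma> ` topspace X = topspace X"
proof
  show "\<sigma> ` topspace X \<subseteq> topspace X" using \<sigma>_in by blast
  show "topspace X \<subseteq> \<sigma> ` topspace X"
  proof
    fix x assume "x \<in> topspace X"
    then obtain j where j: "j \<in> {1..N}" "x \<in> Y j" using Y_cover by blast
    have i: "(if j = 1 then N else j - 1) \<in> {1..N}" using j(1) by auto
    have "x \<in> \<sigma> ` Y (if j = 1 then N else j - 1)"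
      using Y_props(4)[OF i] succ_pred[OF j(1)] j(2) by metis
    then show "x \<in> \<sigma> ` topspace X" using Y_props(5)[OF i] by blast
  qed
qed

lemma C_Y: "i \<in> {1..N} \<Longrightarrow> indicator (Y i) \<in> C_int X"
  by (intro C_int_indicator Y_props)

lemma C_restr: "i \<in> {1..N} \<Longrightarrow> f \<in> C_int X \<Longrightarrow> restr i f \<in> C_int X"
  unfolding restr_def by (intro C_int_mult C_Y)

text \<open>A point lies in \<open>Y i\<close> exactly when its image lies in the next piece, so the
  cut-off is composed with \<open>\<sigma>\<close> and comes out of the transfer.\<close>

lemma L_restr:
  assumes "i \<in> {1..N}"
  shows "L (restr i f) = restr (succ i) (L f)"
proof -
  have "L (restr i f) = L (\<lambda>y. f y * indicator (Y (succ i)) (\<sigma> y))"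
    by (rule transfer_cong) (simp add: restr_def indicator_def \<sigma>_Y_iff[OF _ assms])
  also have "\<dots> = restr (succ i) (L f)" by (simp add: transfer_module restr_def)
  finally show ?thesis .
qed

lemma L_pow_restr: "i \<in> {1..N} \<Longrightarrow> (L ^^ k) (restr i f) = restr ((succ ^^ k) i) ((L ^^ k) f)"
  by (induction k) (auto simp: L_restr succ_pow_in[THEN L_restr])

lemma restr_sum: "f \<in> C_int X \<Longrightarrow> f = (\<lambda>x. \<Sum>i\<in>{1..N}. restr i f x)"
proof
  fix x assume f: "f \<in> C_int X"
  show "f x = (\<Sum>i\<in>{1..N}. restr i f x)"
  proof (cases "x \<in> topspace X")
    case True
    then obtain j where j: "j \<in> {1..N}" "x \<in> Y j" using Y_cover by blast
    have "(\<Sum>i\<in>{1..N}. restr i f x) = (\<Sum>i\<in>{j}. restr i f x)"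
      using j Y_unique by (intro sum.mono_neutral_right) (auto simp: restr_def indicator_def)
    then show ?thesis using j by (simp add: restr_def)
  qed (use C_int_outside[OF f] in \<open>simp add: restr_def\<close>)
qed

lemma restr_restr: "i \<in> {1..N} \<Longrightarrow> j \<in> {1..N} \<Longrightarrow> restr i (restr j f) = (if i = j then restr i f else (\<lambda>x. 0))"
  using Y_unique by (fastforce simp: restr_def indicator_def fun_eq_iff)

lemma restr_id: "{x. f x \<noteq> 0} \<subseteq> Y i \<Longrightarrow> restr i f = f"
  by (auto simp: restr_def indicator_def fun_eq_iff)

lemma restr_supp: "{x. restr i f x \<noteq> 0} \<subseteq> Y i"
  by (auto simp: restr_def indicator_def split: if_splits)

lemma restr_nonneg: "(\<And>x. 0 \<le> f x) \<Longrightarrow> 0 \<le> restr i f x"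
  by (simp add: restr_def)

section \<open>Full support of the measure and expansion\<close>

lemma indicator_le_L_pow:
  assumes "openin X V" "closedin X V" "W \<subseteq> (\<sigma> ^^ k) ` V"
  shows "indicator W x \<le> (L ^^ k) (indicator V) x"
proof (cases "x \<in> W")
  case True
  then obtain y where y: "y \<in> V" "x = (\<sigma> ^^ k) y" using assms(3) by blast
  then show ?thesis
    using L_pow_ge_fibre[of "indicator V" y k] openin_subset[OF assms(1)] True by auto
next
  case False
  then show ?thesis using transfer_pow_nonneg[of "indicator V" k X \<sigma> x] by simp
qed

text \<open>An iterate of \<open>\<sigma>\<close> maps \<open>Y i\<close> onto any given piece and
  multiplies integrals by a power of s. A null piece would make every piece null, against total mass
  1.\<close>

lemma I_Y_pos:
  assumes "i \<in> {1..N}"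
  shows "0 < I (indicator (Y i))"
proof (rule ccontr)
  assume "\<not> 0 < I (indicator (Y i))"
  then have zero: "I (indicator (Y i)) = 0" using I_nonneg[of "indicator (Y i)"] by auto
  have "I (indicator (Y j)) \<le> 0" if j: "j \<in> {1..N}" for j
  proof -
    \<comment> \<open>From piece i, N - i steps reach the last piece and j more reach piece
      j.\<close>
    define k where "k = (N - i) + j"
    have "(i - 1 + k) = N + (j - 1)" using assms j by (auto simp: k_def)
    then have "(succ ^^ k) i = j" using j by (cases j) (auto simp: succ_pow[OF assms])
    then have "(\<sigma> ^^ k) ` Y i = Y j" using \<sigma>_pow_Y[OF assms] by simp
    then have "I (indicator (Y j)) \<le> I ((L ^^ k) (indicator (Y i)))"
      using Y_props[OF assms] C_Y assms j
      by (intro I_mono C_L_pow indicator_le_L_pow) auto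
    then show ?thesis using I_L_pow[OF C_Y[OF assms]] zero by simp
  qed
  then have "(\<Sum>j\<in>{1..N}. I (indicator (Y j))) \<le> 0" by (intro sum_nonpos) auto
  moreover have "(\<Sum>j\<in>{1..N}. I (indicator (Y j))) = I (\<lambda>x. \<Sum>j\<in>{1..N}. indicator (Y j) x)"
    by (rule I_sum[symmetric]) (rule C_Y)
  moreover have "(\<lambda>x. \<Sum>j\<in>{1..N}. indicator (Y j) x :: int) = indicator (topspace X)"
  proof -
    have "restr j (indicator (topspace X)) = indicator (Y j)" if "j \<in> {1..N}" for j
      using Y_props(5)[OF that] by (auto simp: restr_def indicator_def fun_eq_iff)
    then show ?thesis using restr_sum[OF C_X] by simp
  qed
  ultimately show False using I_X by simp
qed

text \<open>Exactness spreads part of V over a whole piece in finitely many steps, and the piece has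
  positive measure.\<close>

lemma I_open_pos:
  assumes V: "openin X V" "closedin X V" "V \<noteq> {}"
  shows "0 < I (indicator V)"
proof -
  have CV: "indicator V \<in> C_int X" using V C_int_indicator by blast
  obtain x where x: "x \<in> V" using V(3) by blast
  then obtain i where i: "i \<in> {1..N}" "x \<in> Y i" using openin_subset[OF V(1)] Y_cover by blast
  have "openin X (V \<inter> Y i)" using V(1) Y_props(2)[OF i(1)] by blast
  then obtain k where k: "(\<sigma> ^^ (N * k)) ` (V \<inter> Y i) = Y i"
    using Y_exact[OF i(1)] x i(2) by (metis IntI empty_iff inf_le2)
  then have "Y i \<subseteq> (\<sigma> ^^ (N * k)) ` V" by blast
  then have "I (indicator (Y i)) \<le> I ((L ^^ (N * k)) (indicator V))"
    using CV C_Y[OF i(1)] V by (intro I_mono C_L_pow indicator_le_L_pow) auto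
  also have "\<dots> = s ^ (N * k) * I (indicator V)" by (rule I_L_pow[OF CV])
  finally have "0 < s ^ (N * k) * I (indicator V)" using I_Y_pos[OF i(1)] by simp
  then show ?thesis using s_pos by (simp add: zero_less_mult_iff)
qed

text \<open>\<open>u = L 1\<close> counts preimages: it is at least 1 by surjectivity and at least 2
  on a nonempty clopen V. Its integral is s, so s is at least 1 + \<mu>(V).\<close>

lemma s_gt_1:
  assumes "\<not> inj_on \<sigma> (topspace X)"
  shows "1 < s"
proof -
  define u where "u = L (indicator (topspace X))"
  have Cu: "u \<in> C_int X" unfolding u_def by (intro C_L C_X)
  have ge1: "indicator (topspace X) x \<le> u x" for x
    using indicator_le_L_pow[of "topspace X" "topspace X" 1 x] \<sigma>_onto by (simp add: u_def)
  obtain x y where xy: "x \<in> topspace X" "y \<in> topspace X" "x \<noteq> y" "\<sigma> x = \<sigma> y"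
    using assms by (auto simp: inj_on_def)
  have "2 = (\<Sum>z\<in>{x, y}. indicator (topspace X) z :: int)" using xy by simp
  also have "\<dots> \<le> (\<Sum>z | z \<in> topspace X \<and> \<sigma> z = \<sigma> x. indicator (topspace X) z)"
    using xy finite_fibre by (intro sum_mono2) auto
  also have "\<dots> = u (\<sigma> x)" using xy(1) \<sigma>_in by (simp add: u_def transfer_def)
  finally have 2: "2 \<le> u (\<sigma> x)" .
  define V where "V = {z \<in> topspace X. 2 \<le> u z}"
  have V: "openin X V" "closedin X V" "V \<noteq> {}"
    unfolding V_def using C_int_openin[OF Cu] C_int_closedin[OF Cu] 2 \<sigma>_in[OF xy(1)] by auto
  then have CV: "indicator V \<in> C_int X" using C_int_indicator by blast
  have "I (\<lambda>z. indicator (topspace X) z + indicator V z) \<le> I u"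
  proof (rule I_mono)
    fix z assume "z \<in> topspace X"
    then show "indicator (topspace X) z + indicator V z \<le> u z"
      using ge1[of z] by (auto simp: V_def indicator_def)
  qed (intro C_int_add C_X CV Cu)+
  then have "1 + I (indicator V) \<le> s * 1"
    using I_add[OF C_X CV] I_L[OF C_X] I_X by (simp add: u_def)
  then show ?thesis using I_open_pos[OF V] by simp
qed

end

section \<open>Positive integral implies eventual positivity\<close>

text \<open>\<open>ctrl f B\<close> reads as a bound B on the variation of f. The constant in
  \<open>ctrl_L\<close>, the Lasota-Yorke inequality, depends on k but not on f, and the finite
  family in \<open>ctrl_floor\<close> depends only on the ratio B of variation to mass.\<close>

locale variation_system = exact_lap_system +
  fixes ctrl :: "('a \<Rightarrow> int) \<Rightarrow> real \<Rightarrow> bool"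
  assumes s_gt: "1 < s"
    and ctrl_ex: "f \<in> C_int X \<Longrightarrow> \<exists>B. ctrl f B"
    and ctrl_mono: "ctrl f B \<Longrightarrow> B \<le> B' \<Longrightarrow> ctrl f B'"
    and ctrl_lip: "ctrl f B \<Longrightarrow> (\<And>x y. \<bar>g x - g y\<bar> \<le> \<bar>f x - f y\<bar>) \<Longrightarrow> ctrl g B"
    and ctrl_L: "\<exists>C\<ge>0. \<forall>f B. f \<in> C_int X \<longrightarrow> ctrl f B \<longrightarrow>
                   ctrl ((L ^^ k) f) (3 * B + C * I (\<lambda>x. \<bar>f x\<bar>))"
    and ctrl_sup: "f \<in> C_int X \<Longrightarrow> ctrl f B \<Longrightarrow> x \<in> topspace X \<Longrightarrow>
                   \<bar>of_int (f x)\<bar> \<le> B + I (\<lambda>x. \<bar>f x\<bar>)"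
    and ctrl_floor: "\<exists>\<U>. finite \<U> \<and> (\<forall>U\<in>\<U>. openin X U \<and> U \<noteq> {}) \<and>
      (\<forall>g\<in>C_int X. (\<forall>x. 0 \<le> g x) \<longrightarrow> 0 < I g \<longrightarrow> ctrl g (B * I g) \<longrightarrow>
         (\<exists>U\<in>\<U>. \<forall>x\<in>U. I g / 2 \<le> of_int (g x)))"
begin

text \<open>A minorization of Doeblin type: its constant depends only on the ratio of variation to mass.\<close>

lemma minorization:
  assumes i: "i \<in> {1..N}"
  obtains K where "\<And>K' g x. K \<le> K' \<Longrightarrow> g \<in> C_int X \<Longrightarrow> (\<And>x. 0 \<le> g x) \<Longrightarrow> {x. g x \<noteq> 0} \<subseteq> Y i \<Longrightarrow>
    0 < I g \<Longrightarrow> ctrl g (B * I g) \<Longrightarrow> x \<in> Y i \<Longrightarrow> I g / 2 \<le> of_int ((L ^^ (N * K')) g x)"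
proof -
  obtain \<U> where U: "finite \<U> \<and> (\<forall>U\<in>\<U>. openin X U \<and> U \<noteq> {}) \<and>
      (\<forall>g\<in>C_int X. (\<forall>x. 0 \<le> g x) \<longrightarrow> 0 < I g \<longrightarrow> ctrl g (B * I g) \<longrightarrow>
         (\<exists>U\<in>\<U>. \<forall>x\<in>U. I g / 2 \<le> of_int (g x)))"
    using ctrl_floor[of B] by (rule exE)
  have \<U>: "finite \<U>" "\<And>U. U \<in> \<U> \<Longrightarrow> openin X U \<and> U \<noteq> {}"
    using U by simp_all
  \<comment> \<open>Only sets inside the piece can be selected, because g is bounded below by a
    positive number on the selected set and vanishes off \<open>Y i\<close>.\<close>
  define \<V> where "\<V> = {U \<in> \<U>. U \<subseteq> Y i}"
  have "\<exists>k. (\<sigma> ^^ (N * k)) ` U = Y i" if "U \<in> \<V>" for U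
  proof -
    have "openin X U" "U \<subseteq> Y i" "U \<noteq> {}" using \<U>(2)[of U] that by (auto simp: \<V>_def)
    then obtain k where "(\<sigma> ^^ (N * k)) ` U = Y i" by (rule Y_exact[OF i])
    then show ?thesis ..
  qed
  then obtain k where k: "\<And>U. U \<in> \<V> \<Longrightarrow> (\<sigma> ^^ (N * k U)) ` U = Y i"
    by (metis (no_types))
  \<comment> \<open>The sum bounds every \<open>k U\<close>, and further multiples of N steps map
    the piece onto itself, so every larger \<open>K'\<close> works too.\<close>
  show ?thesis
  proof (rule that[of "sum k \<V>"])
    fix K' g x
    assume K': "sum k \<V> \<le> K'" and g: "g \<in> C_int X" "\<And>x. 0 \<le> g x" "{x. g x \<noteq> 0} \<subseteq> Y i"
      "0 < I g" "ctrl g (B * I g)" and x: "x \<in> Y i"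
    have "\<exists>U\<in>\<U>. \<forall>x\<in>U. I g / 2 \<le> of_int (g x)" using U g by simp
    then obtain U where U: "U \<in> \<U>" "\<forall>x\<in>U. I g / 2 \<le> of_int (g x)" by (rule bexE)
    have "U \<subseteq> Y i" using U(2) g(3,4) by fastforce
    then have V: "U \<in> \<V>" using U(1) by (simp add: \<V>_def)
    then have "k U \<le> K'" using K' member_le_sum[of U \<V> k] \<U>(1) by (auto simp: \<V>_def)
    then have "N * K' = N * (K' - k U) + N * k U" by (simp flip: distrib_left)
    then have "(\<sigma> ^^ (N * K')) ` U = (\<sigma> ^^ (N * (K' - k U))) ` (\<sigma> ^^ (N * k U)) ` U"
      by (simp add: funpow_add image_comp)
    also have "\<dots> = Y i" using k[OF V] \<sigma>_pow_Y[OF i] succ_pow_N[OF i] by simp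
    finally have "x \<in> (\<sigma> ^^ (N * K')) ` U" using x by simp
    then obtain y where y: "y \<in> U" "(\<sigma> ^^ (N * K')) y = x" by (auto simp del: funpow.simps)
    have "y \<in> topspace X" using y(1) \<U>(2)[OF U(1)] openin_subset[of X U] by auto
    then have "g y \<le> (L ^^ (N * K')) g x" using L_pow_ge_fibre[of g y "N * K'", OF g(2)] y(2) by simp
    then show "I g / 2 \<le> of_int ((L ^^ (N * K')) g x)" using U(2) y(1) by fastforce
  qed
qed

lemma abs_L_pow_le: "\<bar>(L ^^ k) f x\<bar> \<le> (L ^^ k) (\<lambda>x. \<bar>f x\<bar>) x"
proof -
  have "(L ^^ k) f x \<le> (L ^^ k) (\<lambda>x. \<bar>f x\<bar>) x" by (rule transfer_pow_mono) simp
  moreover have "(L ^^ k) (\<lambda>x. (-1) * f x) x \<le> (L ^^ k) (\<lambda>x. \<bar>f x\<bar>) x" by (rule transfer_pow_mono) simp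
  ultimately show ?thesis unfolding transfer_pow_scale by linarith
qed

lemma I_abs_L_pow: "f \<in> C_int X \<Longrightarrow> I (\<lambda>x. \<bar>(L ^^ k) f x\<bar>) \<le> s ^ k * I (\<lambda>x. \<bar>f x\<bar>)"
  using I_mono[of "\<lambda>x. \<bar>(L ^^ k) f x\<bar>" "(L ^^ k) (\<lambda>x. \<bar>f x\<bar>)"] abs_L_pow_le I_L_pow[OF C_int_abs]
    C_L_pow C_int_abs by metis

text \<open>Time advances in multiples of N q, so supports return to \<open>Y i\<close>, and
  quantities at time j are divided by \<open>R^j\<close>. In this normalisation the integral of f is
  the constant \<delta>, and the Lasota-Yorke inequality halves the variation up to a multiple of
  the \<open>L^1\<close> norm.\<close>

lemma eventually_nonneg:
  assumes i: "i \<in> {1..N}" and f: "f \<in> C_int X" "{x. f x \<noteq> 0} \<subseteq> Y i" and pos: "0 < I f"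
  shows "\<exists>k. \<forall>x. 0 \<le> (L ^^ k) f x"
proof -
  \<comment> \<open>The Lasota-Yorke factor is 3; a growth of at least 6 per step makes the
    normalised factor at most 1/2.\<close>
  obtain m where m: "6 < s ^ m" using real_arch_pow[OF s_gt] by blast
  \<comment> \<open>q is positive, so that q * K is at least K as the minorization requires, and the
    exponent N * q is at least m.\<close>
  define q where "q = m + 1"
  define R where "R = s ^ (N * q)"
  have "m \<le> N * q" using N_pos by (simp add: q_def trans_le_add2)
  then have "s ^ m \<le> R" unfolding R_def using s_gt by (intro power_increasing) auto
  then have R6: "6 \<le> R" using m by linarith
  then have "0 < R" by linarith
  then have R0: "0 < R" "0 < R ^ j" for j by simp_all
  define P where "P j = (L ^^ (N * (q * j)))" for j
  have P_add: "P (j + k) g = P k (P j g)" for j k g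
  proof -
    have "N * (q * (j + k)) = N * (q * k) + N * (q * j)" by (simp add: distrib_left)
    then show ?thesis by (simp only: P_def funpow_add o_apply)
  qed
  have CP: "P j g \<in> C_int X" if "g \<in> C_int X" for j g using that by (simp add: P_def C_L_pow)
  have IP: "I (P j g) = R ^ j * I g" if "g \<in> C_int X" for j g
    using I_L_pow[OF that] by (simp add: P_def R_def power_mult)
  have P_supp: "{x. P j g x \<noteq> 0} \<subseteq> Y i" if "{x. g x \<noteq> 0} \<subseteq> Y i" for j g
    using L_pow_restr[OF i, of "N * (q * j)" g] restr_supp[of i] succ_pow_N[OF i] restr_id[OF that]
    unfolding P_def by metis
  obtain C where C: "0 \<le> C" "\<And>g B. g \<in> C_int X \<Longrightarrow> ctrl g B \<Longrightarrow>
      ctrl (P 1 g) (3 * B + C * I (\<lambda>x. \<bar>g x\<bar>))"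
    using ctrl_L[of "N * q"] by (auto simp: P_def)
  \<comment> \<open>With C = 3 D the additive term reproduces itself: 3 D + 3 D = 6 D, and 6 is at
    most R.\<close>
  define D where "D = C / 3"
  have D: "0 \<le> D" "C = 3 * D" using C by (auto simp: D_def)
  have iter: "ctrl (P j g) (R ^ j * (B / 2 ^ j + D * I (\<lambda>x. \<bar>g x\<bar>)))"
    if g: "g \<in> C_int X" "ctrl g B" "0 \<le> B" for g B j
  proof (induction j)
    case 0
    have "0 \<le> I (\<lambda>x. \<bar>g x\<bar>)" by (rule I_nonneg) simp
    then show ?case using g D by (auto simp: P_def intro: ctrl_mono)
  next
    case (Suc j)
    let ?A = "I (\<lambda>x. \<bar>g x\<bar>)"
    have A: "0 \<le> ?A" by (rule I_nonneg) simp
    have "ctrl (P (Suc j) g) (3 * (R ^ j * (B / 2 ^ j + D * ?A)) + C * I (\<lambda>x. \<bar>P j g x\<bar>))"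
      using C(2)[OF CP[OF g(1)] Suc] P_add[of j 1 g] by simp
    moreover have "3 * (R ^ j * (B / 2 ^ j + D * ?A)) + C * I (\<lambda>x. \<bar>P j g x\<bar>)
      \<le> R ^ Suc j * (B / 2 ^ Suc j + D * ?A)"
    proof -
      have "I (\<lambda>x. \<bar>P j g x\<bar>) \<le> R ^ j * ?A"
        using I_abs_L_pow[OF g(1), of "N * (q * j)"] by (simp add: P_def R_def power_mult)
      then have "C * I (\<lambda>x. \<bar>P j g x\<bar>) \<le> 3 * D * (R ^ j * ?A)" unfolding D(2) using D(1)
        by (intro mult_left_mono) auto
      then have "3 * (R ^ j * (B / 2 ^ j + D * ?A)) + C * I (\<lambda>x. \<bar>P j g x\<bar>)
        \<le> R ^ j * (6 * (B / 2 ^ Suc j + D * ?A))" by (simp add: algebra_simps)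
      also have "\<dots> \<le> R ^ j * (R * (B / 2 ^ Suc j + D * ?A))"
        using R6 g(3) D(1) A R0 by (intro mult_left_mono mult_right_mono) auto
      finally show ?thesis by (simp add: algebra_simps)
    qed
    ultimately show ?case by (rule ctrl_mono)
  qed
  obtain B0 where "ctrl f B0" using ctrl_ex[OF f(1)] by blast
  then obtain B where B: "ctrl f B" "0 \<le> B" using ctrl_mono[of f B0 "max B0 0"] by auto
  define \<delta> where "\<delta> = I f"
  have \<delta>: "0 < \<delta>" using pos by (simp add: \<delta>_def)
  \<comment> \<open>This bounds the normalised variation of all iterates of f at once, and also that
    of their positive and negative parts, since passing to such a part does not increase
    differences.\<close>
  define V where "V = B + D * I (\<lambda>x. \<bar>f x\<bar>)"
  have V: "0 \<le> V" unfolding V_def using B D I_nonneg[of "\<lambda>x. \<bar>f x\<bar>"] by simp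
  define F where "F j = P j f" for j
  define u where "u j = (\<lambda>x. max (F j x) 0)" for j
  define v where "v j = (\<lambda>x. max (- F j x) 0)" for j
  have CF: "F j \<in> C_int X" for j unfolding F_def using CP f(1) by simp
  have Cu: "u j \<in> C_int X" and Cv: "v j \<in> C_int X" for j
    unfolding u_def v_def by (intro C_int_max C_int_minus CF C_int_zero)+
  have uv: "0 \<le> u j x" "0 \<le> v j x" "F j x = u j x - v j x" for j x
    by (auto simp: u_def v_def)
  have F_eq: "F j = (\<lambda>x. u j x - v j x)" for j using uv by blast
  have F_supp: "{x. F j x \<noteq> 0} \<subseteq> Y i" for j unfolding F_def using P_supp f(2) by blast
  then have F_out: "F j x = 0" if "x \<notin> Y i" for j x using that by blast
  then have "u j x = 0 \<and> v j x = 0" if "x \<notin> Y i" for j x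
    using that by (simp add: u_def v_def)
  then have supp: "{x. u j x \<noteq> 0} \<subseteq> Y i" "{x. v j x \<noteq> 0} \<subseteq> Y i" for j by blast+
  have "ctrl (F j) (R ^ j * V)" for j
  proof (rule ctrl_mono[OF iter[OF f(1) B, of j, folded F_def]])
    have "B / 2 ^ j \<le> B" using B(2) by (simp add: divide_le_eq mult_le_cancel_left1)
    then show "R ^ j * (B / 2 ^ j + D * I (\<lambda>x. \<bar>f x\<bar>)) \<le> R ^ j * V"
      unfolding V_def using R0(2) by (intro mult_left_mono) (auto intro: less_imp_le)
  qed
  then have ctrl_u: "ctrl (u j) (R ^ j * V)" and ctrl_v: "ctrl (v j) (R ^ j * V)" for j
    unfolding u_def v_def by (rule ctrl_lip, auto simp: max_def abs_if)+
  define \<alpha> where "\<alpha> j = I (v j) / R ^ j" for j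
  have \<alpha>: "0 \<le> \<alpha> j" "I (v j) = R ^ j * \<alpha> j" for j
    using R0(1) R0(2)[of j] I_nonneg[of "v j"] uv by (auto simp: \<alpha>_def)
  \<comment> \<open>The positive part carries the integral of f in addition to the mass of the
    negative part, so its normalised mass never falls below \<delta>.\<close>
  have Iu: "I (u j) = R ^ j * (\<delta> + \<alpha> j)" for j
  proof -
    have "I (F j) = I (u j) - I (v j)" unfolding F_eq by (rule I_diff[OF Cu Cv])
    moreover have "I (F j) = R ^ j * \<delta>" unfolding F_def \<delta>_def by (rule IP[OF f(1)])
    ultimately show ?thesis using \<alpha>(2) by (simp add: algebra_simps)
  qed
  have F_add: "F (j + k) x = P k (u j) x - P k (v j) x" for j k x
    using P_add[of j k f] F_eq[of j] unfolding F_def[symmetric] by (simp add: P_def transfer_pow_diff)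
  have P_nonneg: "0 \<le> P k g x" if "\<And>x. 0 \<le> g x" for k g x
    unfolding P_def using that by (rule transfer_pow_nonneg)
  have Pu: "0 \<le> P k (u j) x" and Pv: "0 \<le> P k (v j) x" for k j x
    by (rule P_nonneg, rule uv)+
  have I_Y: "0 < I (indicator (Y i))" by (rule I_Y_pos[OF i])
  \<comment> \<open>If the negative part always kept normalised mass \<epsilon>, both parts would
    exceed a common multiple of \<open>R^j\<close> on \<open>Y i\<close> after K steps. Cancelling
    it lowers \<alpha> by the fixed amount \<eta> each time, until \<alpha> is negative.\<close>
  have small: "\<exists>j. \<alpha> j < \<epsilon>" if \<epsilon>: "0 < \<epsilon>" for \<epsilon>
  proof (rule ccontr)
    assume "\<not> (\<exists>j. \<alpha> j < \<epsilon>)"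
    then have ge: "\<epsilon> \<le> \<alpha> j" for j by (simp add: not_less)
    obtain K where K: "\<And>K' g x. K \<le> K' \<Longrightarrow> g \<in> C_int X \<Longrightarrow> (\<And>x. 0 \<le> g x) \<Longrightarrow> {x. g x \<noteq> 0} \<subseteq> Y i \<Longrightarrow>
      0 < I g \<Longrightarrow> ctrl g (V / \<epsilon> * I g) \<Longrightarrow> x \<in> Y i \<Longrightarrow> I g / 2 \<le> of_int ((L ^^ (N * K')) g x)"
      using minorization[OF i, of "V / \<epsilon>"] by blast
    \<comment> \<open>The lower bound \<epsilon>/2 from the minorization is integrated over the
      piece; division by \<open>R^K\<close> renormalises from time j to time j + K.\<close>
    define \<eta> where "\<eta> = \<epsilon> * I (indicator (Y i)) / (2 * R ^ K)"
    have \<eta>: "0 < \<eta>" using \<epsilon> I_Y R0 by (simp add: \<eta>_def)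
    have low: "R ^ j * \<epsilon> / 2 \<le> of_int (P K g x)"
      if g: "g \<in> C_int X" "\<And>x. 0 \<le> g x" "{x. g x \<noteq> 0} \<subseteq> Y i" "ctrl g (R ^ j * V)" "R ^ j * \<epsilon> \<le> I g"
        and x: "x \<in> Y i" for g j x
    proof -
      have "R ^ j * V = V / \<epsilon> * (R ^ j * \<epsilon>)" using \<epsilon> by simp
      also have "\<dots> \<le> V / \<epsilon> * I g" using g(5) V \<epsilon> by (intro mult_left_mono) auto
      finally have "ctrl g (V / \<epsilon> * I g)" using g(4) ctrl_mono by blast
      moreover have "0 < I g" using g(5) \<epsilon> R0(2)[of j] by (smt (verit) mult_pos_pos)
      ultimately have "I g / 2 \<le> of_int (P K g x)"
        unfolding P_def using g x by (intro K) (auto simp: q_def)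
      then show ?thesis using g(5) by simp
    qed
    have step: "\<alpha> (j + K) \<le> \<alpha> j - \<eta>" for j
    proof -
      \<comment> \<open>An integer above the real bound is also above its ceiling, and an integer
        multiple of an indicator stays in \<open>C_int X\<close>.\<close>
      define h where "h = \<lceil>R ^ j * \<epsilon> / 2\<rceil>"
      have Rj: "R ^ j * \<epsilon> \<le> R ^ j * \<alpha> j" "R ^ j * \<epsilon> \<le> R ^ j * (\<delta> + \<alpha> j)"
        using ge[of j] R0(2)[of j] \<delta> by (auto intro: mult_left_mono)
      have hu: "h \<le> P K (u j) x" and hv: "h \<le> P K (v j) x" if "x \<in> Y i" for x
        unfolding h_def using low[OF Cu uv(1) supp(1) ctrl_u _ that] low[OF Cv uv(2) supp(2) ctrl_v _ that]
          Rj Iu[of j] \<alpha>(2)[of j] by (auto intro: ceiling_le)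
      \<comment> \<open>F (j + K) is the difference of the two transported parts. Where both are at
        least h, its negative part is at most the transported negative part minus h.\<close>
      have "I (v (j + K)) \<le> I (\<lambda>x. P K (v j) x - h * indicator (Y i) x)"
      proof (rule I_mono)
        fix x
        show "v (j + K) x \<le> P K (v j) x - h * indicator (Y i) x"
          using hu[of x] hv[of x] Pu[of K j x] Pv[of K j x] F_add[of j K x]
          by (auto simp: v_def indicator_def)
      qed (intro C_int_diff C_int_scale CP Cv C_Y i)+
      also have "\<dots> = R ^ K * I (v j) - of_int h * I (indicator (Y i))"
        by (simp add: I_diff I_scale IP C_int_scale CP Cv C_Y[OF i])
      also have "\<dots> \<le> R ^ K * I (v j) - R ^ j * \<epsilon> / 2 * I (indicator (Y i))"
        using I_Y unfolding h_def by (intro diff_left_mono mult_right_mono le_of_int_ceiling) simp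
      also have "\<dots> = R ^ (j + K) * (\<alpha> j - \<eta>)"
        using R0(1) by (simp add: \<alpha>(2) \<eta>_def power_add field_simps)
      finally show ?thesis using \<alpha>(2)[of "j + K"] R0(2)[of "j + K"] by simp
    qed
    have "\<alpha> (m * K) \<le> \<alpha> 0 - real m * \<eta>" for m
    proof (induction m)
      case (Suc m)
      have "\<alpha> (Suc m * K) \<le> \<alpha> (m * K) - \<eta>" using step[of "m * K"] by (simp add: add.commute)
      then show ?case using Suc by (simp add: algebra_simps)
    qed simp
    moreover obtain m where "\<alpha> 0 < real m * \<eta>" using reals_Archimedean3[OF \<eta>] by blast
    ultimately show False using \<alpha>(1)[of "m * K"] by (smt (verit))
  qed
  \<comment> \<open>The ratio V/\<delta> + D fits the transported positive part for all l and j, so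
    K can be fixed before both.\<close>
  obtain K where K: "\<And>K' g x. K \<le> K' \<Longrightarrow> g \<in> C_int X \<Longrightarrow> (\<And>x. 0 \<le> g x) \<Longrightarrow> {x. g x \<noteq> 0} \<subseteq> Y i \<Longrightarrow>
    0 < I g \<Longrightarrow> ctrl g ((V / \<delta> + D) * I g) \<Longrightarrow> x \<in> Y i \<Longrightarrow> I g / 2 \<le> of_int ((L ^^ (N * K')) g x)"
    using minorization[OF i, of "V / \<delta> + D"] by blast
  \<comment> \<open>The steps l wear down the variation of the negative part. The factor
    \<open>R^K\<close> is the growth forgone in the last K steps, where the minorization gives a
    bound that does not grow with K.\<close>
  obtain l where l: "4 * (R ^ K * V) / \<delta> < 2 ^ l" using real_arch_pow[of 2] by auto
  have l': "R ^ K * V / 2 ^ (l + K) \<le> \<delta> / 4"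
  proof -
    have "4 * (R ^ K * V) \<le> \<delta> * 2 ^ l" using l \<delta> by (simp add: field_simps)
    also have "\<dots> \<le> \<delta> * 2 ^ (l + K)" using \<delta> by simp
    finally show ?thesis by (simp add: field_simps)
  qed
  \<comment> \<open>Only now is the negative mass made small, again against \<open>R^K\<close>. In D
    + 1, D accounts for the \<open>L^1\<close> term in the variation and 1 for the mean in
    \<open>ctrl_sup\<close>.\<close>
  obtain j where j: "\<alpha> j < \<delta> / (4 * (R ^ K * (D + 1)))"
    using small[of "\<delta> / (4 * (R ^ K * (D + 1)))"] \<delta> R0 D(1) by auto
  have j': "R ^ K * ((D + 1) * \<alpha> j) \<le> \<delta> / 4"
  proof -
    have "0 < 4 * (R ^ K * (D + 1))" using R0(2)[of K] D(1) by simp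
    with j have "\<alpha> j * (4 * (R ^ K * (D + 1))) < \<delta>" by (simp only: pos_less_divide_eq)
    then show ?thesis by (simp add: algebra_simps)
  qed
  \<comment> \<open>Both transported parts are compared with \<open>R^(l+j) * \<delta> / 2\<close>.
    The minorization keeps the positive part above it; variation and mass of the negative part
    contribute at most half of it each.\<close>
  have "0 \<le> F (j + (l + K)) x" for x
  proof (cases "x \<in> Y i")
    case True
    have "R ^ (l + j) * \<delta> / 2 \<le> of_int (P (l + K) (u j) x)"
    proof -
      let ?w = "P l (u j)"
      have Iw: "I ?w = R ^ l * I (u j)" using IP Cu by simp
      have Iu_ge: "R ^ j * \<delta> \<le> I (u j)" using Iu[of j] \<alpha>(1)[of j] R0(2)[of j] by simp
      then have Iu_pos: "0 < I (u j)" using \<delta> R0(2)[of j] by (smt (verit) mult_pos_pos)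
      have abs_u: "(\<lambda>x. \<bar>u j x\<bar>) = u j" using uv(1) by simp
      have "ctrl ?w (R ^ l * (R ^ j * V / 2 ^ l + D * I (u j)))"
        using iter[OF Cu ctrl_u, of j l] R0(2)[of j] V unfolding abs_u by simp
      moreover have "R ^ l * (R ^ j * V / 2 ^ l + D * I (u j)) \<le> (V / \<delta> + D) * I ?w"
      proof -
        have "0 \<le> R ^ j * V" using R0(2)[of j] V by simp
        then have "R ^ j * V / 2 ^ l \<le> R ^ j * V"
          by (simp add: divide_le_eq mult_le_cancel_left1)
        also have "\<dots> = V / \<delta> * (R ^ j * \<delta>)" using \<delta> by simp
        also have "\<dots> \<le> V / \<delta> * I (u j)" using Iu_ge V \<delta> by (intro mult_left_mono) auto
        finally have "R ^ l * (R ^ j * V / 2 ^ l + D * I (u j)) \<le> R ^ l * (V / \<delta> * I (u j) + D * I (u j))"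
          using R0(2)[of l] by simp
        then show ?thesis unfolding Iw by (simp add: algebra_simps)
      qed
      ultimately have "ctrl ?w ((V / \<delta> + D) * I ?w)" by (rule ctrl_mono)
      then have "I ?w / 2 \<le> of_int (P K ?w x)"
        unfolding P_def[of K] using CP[OF Cu] Pu P_supp[OF supp(1)] True Iw Iu_pos R0(2)[of l]
        by (intro K) (auto simp: q_def)
      moreover have "R ^ l * (R ^ j * \<delta>) \<le> I ?w" unfolding Iw using Iu_ge R0(2)[of l] by simp
      ultimately show ?thesis unfolding P_add by (simp add: power_add mult.assoc)
    qed
    moreover have "of_int (P (l + K) (v j) x) \<le> R ^ (l + j) * \<delta> / 2"
    proof -
      have abs_v: "(\<lambda>x. \<bar>v j x\<bar>) = v j" "(\<lambda>x. \<bar>P (l + K) (v j) x\<bar>) = P (l + K) (v j)"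
        using uv(2) Pv by simp_all
      have "ctrl (P (l + K) (v j)) (R ^ (l + K) * (R ^ j * V / 2 ^ (l + K) + D * I (v j)))"
        using iter[OF Cv ctrl_v, of j "l + K"] R0(2)[of j] V unfolding abs_v by simp
      from ctrl_sup[OF CP[OF Cv] this] True Y_props(5)[OF i]
      have "of_int (P (l + K) (v j) x) \<le> R ^ (l + K) * (R ^ j * V / 2 ^ (l + K) + D * I (v j)) + I (P (l + K) (v j))"
        unfolding abs_v by fastforce
      also have "\<dots> = R ^ (l + j) * (R ^ K * V / 2 ^ (l + K) + R ^ K * ((D + 1) * \<alpha> j))"
        unfolding IP[OF Cv] \<alpha>(2) by (simp add: power_add algebra_simps)
      also have "\<dots> \<le> R ^ (l + j) * (\<delta> / 4 + \<delta> / 4)"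
        using l' j' R0(2)[of "l + j"] by (intro mult_left_mono add_mono) auto
      finally show ?thesis by simp
    qed
    ultimately have "(of_int (P (l + K) (v j) x) :: real) \<le> of_int (P (l + K) (u j) x)" by linarith
    then show ?thesis using F_add[of j "l + K" x] by simp
  qed (use F_out in simp)
  then show ?thesis unfolding F_def P_def by blast
qed

end

section \<open>Variation of integer-valued functions\<close>

text \<open>A finitely additive measure on all subsets of the line. Finite additivity suffices for
  summing over cylinders, and the absence of a sigma-algebra makes restrictions and push-forwards
  immediate.\<close>

definition charge :: "(real set \<Rightarrow> real) \<Rightarrow> bool" where
  "charge \<nu> \<longleftrightarrow> (\<forall>A. 0 \<le> \<nu> A) \<and> (\<forall>A B. A \<inter> B = {} \<longrightarrow> \<nu> (A \<union> B) = \<nu> A + \<nu> B)"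

lemma charge_nonneg: "charge \<nu> \<Longrightarrow> 0 \<le> \<nu> A"
  and charge_Un: "charge \<nu> \<Longrightarrow> A \<inter> B = {} \<Longrightarrow> \<nu> (A \<union> B) = \<nu> A + \<nu> B"
  by (auto simp: charge_def)

lemma charge_mono: "charge \<nu> \<Longrightarrow> A \<subseteq> B \<Longrightarrow> \<nu> A \<le> \<nu> B"
  using charge_Un[of \<nu> A "B - A"] charge_nonneg[of \<nu> "B - A"] by (auto simp: Un_absorb1)

lemma charge_empty: "charge \<nu> \<Longrightarrow> \<nu> {} = 0"
  using charge_Un[of \<nu> "{}" "{}"] by simp

lemma charge_UN:
  assumes "charge \<nu>" "finite K" "disjoint_family_on A K"
  shows "(\<Sum>i\<in>K. \<nu> (A i)) = \<nu> (\<Union>i\<in>K. A i)"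
  using assms(2,3)
proof (induction K rule: finite_induct)
  case empty
  then show ?case using charge_empty[OF assms(1)] by simp
next
  case (insert i K)
  then have "A i \<inter> (\<Union>j\<in>K. A j) = {}" by (fastforce simp: disjoint_family_on_def)
  then show ?case
    using insert charge_Un[OF assms(1), of "A i" "\<Union>j\<in>K. A j"]
    by (simp add: disjoint_family_on_def)
qed

context interval_map
begin

definition J0 :: "real set" where "J0 = {0..1} - S"

text \<open>\<nu> dominates f in the way the total variation measure of f would. Closed intervals
  let atoms at their ends count. Testing pairs over \<open>J0\<close> loses nothing, by
  density.\<close>

definition controls :: "(real set \<Rightarrow> real) \<Rightarrow> (real \<times> int \<Rightarrow> int) \<Rightarrow> real set \<Rightarrow> bool" where
  "controls \<nu> f A \<longleftrightarrow> (\<forall>x\<in>J0 \<inter> A. \<forall>y\<in>J0 \<inter> A. x < y \<longrightarrow> of_int \<bar>f (y, 0) - f (x, 0)\<bar> \<le> \<nu> {x..y})"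

definition ctrl :: "(real \<times> int \<Rightarrow> int) \<Rightarrow> real \<Rightarrow> bool" where
  "ctrl f B \<longleftrightarrow> (\<exists>\<nu>. charge \<nu> \<and> controls \<nu> f UNIV \<and> \<nu> UNIV \<le> B)"

lemma J0_point: "x \<in> J0 \<Longrightarrow> (x, 0) \<in> XX"
  using I0_point by (auto simp: J0_def)

text \<open>Along a germ of p the function is constant and the points stay in U, and unsplit points
  occur arbitrarily close. Bounds over \<open>J0\<close> thus extend to X.\<close>

lemma attained:
  assumes f: "f \<in> C_int X" and U: "openin X U" "p \<in> U"
  obtains x where "x \<in> J0" "(x, 0) \<in> U" "f (x, 0) = f p"
proof -
  have p: "p \<in> XX" using U openin_subset by fastforce
  obtain e where e: "has_germ p e" using germ_exists[OF p] by blast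
  obtain i where i: "i < n" "p \<in> lap i" using p lap_cover by blast
  have "near S p e (\<lambda>q. q \<in> U \<and> f q = f p)"
    using openin_split_near[of S U p e] U e f p
    by (intro near_conj) (auto simp: X_top_def C_int_split_iff)
  from near_dense[OF this i(2) e i(1) zero_less_one]
  obtain y where y: "y \<notin> S" "a i < y" "y < a (Suc i)" "(y, 0) \<in> U \<and> f (y, 0) = f p" by blast
  then have "y \<in> J0" using a_range[of i] a_range[of "Suc i"] i(1) by (auto simp: J0_def)
  then show ?thesis using y that by blast
qed

lemma locally_constant_side:
  assumes f: "f \<in> C_int X" and t: "0 \<le> t" "t \<le> 1" and e: "e = 1 \<or> e = -1"
  shows "\<exists>\<epsilon>>0. \<exists>c. \<forall>x\<in>J0. 0 < of_int e * (x - t) \<and> of_int e * (x - t) < \<epsilon> \<longrightarrow> f (x, 0) = c"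
proof (cases "e = 1 \<and> t < 1 \<or> e = -1 \<and> 0 < t")
  case True
  then obtain p where p: "p \<in> XX" "fst p = t" "has_germ p e" using germ_point[OF t] by blast
  then have "near S p e (\<lambda>q. f q = f p)" using f by (auto simp: X_top_def C_int_split_iff)
  then show ?thesis using J0_point p(2) by (elim nearE) force
next
  case False
  then have "\<not> 0 < of_int e * (x - t)" if "x \<in> J0" for x using that t e by (auto simp: J0_def)
  then show ?thesis by (intro exI[of _ 1]) auto
qed

text \<open>Bisection plays the role of compactness: a control exists near each point, and controls
  on adjacent intervals glue. The bound K on the values is carried along because gluing needs
  it.\<close>

lemma ex_control:
  assumes f: "f \<in> C_int X"
  shows "\<exists>\<nu> K. charge \<nu> \<and> (\<forall>x\<in>J0 \<inter> {0..1}. \<bar>f (x, 0)\<bar> \<le> K) \<and> controls \<nu> f {0..1}"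
proof -
  define P where "P c d \<longleftrightarrow>
    (\<exists>\<nu> K. charge \<nu> \<and> (\<forall>x\<in>J0 \<inter> {c..d}. \<bar>f (x, 0)\<bar> \<le> K) \<and> controls \<nu> f {c..d})" for c d
  have "(0::real) \<le> 1" by simp
  then have "P 0 1"
  proof (induction rule: Bolzano)
    case (trans a1 b1 c1)
    obtain \<nu>1 K1 where 1: "charge \<nu>1" "\<forall>x\<in>J0 \<inter> {a1..b1}. \<bar>f (x, 0)\<bar> \<le> K1" "controls \<nu>1 f {a1..b1}"
      using trans(1) unfolding P_def by blast
    obtain \<nu>2 K2 where 2: "charge \<nu>2" "\<forall>x\<in>J0 \<inter> {b1..c1}. \<bar>f (x, 0)\<bar> \<le> K2" "controls \<nu>2 f {b1..c1}"
      using trans(2) unfolding P_def by blast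
    define K where "K = \<bar>K1\<bar> + \<bar>K2\<bar>"
    \<comment> \<open>An atom at the common end pays for pairs lying on different sides of
      it.\<close>
    define \<nu> where "\<nu> A = \<nu>1 A + \<nu>2 A + of_int K * of_bool (b1 \<in> A)" for A
    have nn: "0 \<le> \<nu>1 A" "0 \<le> \<nu>2 A" for A using 1(1) 2(1) charge_nonneg by auto
    have "charge \<nu>" unfolding charge_def
    proof (intro conjI allI impI)
      show "0 \<le> \<nu> A" for A unfolding \<nu>_def using nn by (simp add: K_def)
      show "\<nu> (A \<union> B) = \<nu> A + \<nu> B" if "A \<inter> B = {}" for A B
        using that charge_Un[OF 1(1) that] charge_Un[OF 2(1) that] unfolding \<nu>_def by auto
    qed
    moreover have "\<bar>f (x, 0)\<bar> \<le> K" if "x \<in> J0 \<inter> {a1..c1}" for x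
    proof -
      have "\<bar>f (x, 0)\<bar> \<le> K1 \<or> \<bar>f (x, 0)\<bar> \<le> K2" using 1(2) 2(2) that by (cases "x \<le> b1") auto
      then show ?thesis unfolding K_def by linarith
    qed
    moreover have "controls \<nu> f {a1..c1}" unfolding controls_def
    proof (intro ballI impI)
      fix x y assume x: "x \<in> J0 \<inter> {a1..c1}" and y: "y \<in> J0 \<inter> {a1..c1}" and xy: "x < y"
      consider "y \<le> b1" | "b1 \<le> x" | "x < b1" "b1 < y" by linarith
      then show "of_int \<bar>f (y, 0) - f (x, 0)\<bar> \<le> \<nu> {x..y}"
      proof cases
        case 1
        then have "of_int \<bar>f (y, 0) - f (x, 0)\<bar> \<le> \<nu>1 {x..y}"
          using \<open>controls \<nu>1 f {a1..b1}\<close> x y xy unfolding controls_def by auto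
        then show ?thesis unfolding \<nu>_def using nn(2)[of "{x..y}"] by (simp add: K_def add_increasing2)
      next
        case 2
        then have "of_int \<bar>f (y, 0) - f (x, 0)\<bar> \<le> \<nu>2 {x..y}"
          using \<open>controls \<nu>2 f {b1..c1}\<close> x y xy unfolding controls_def by auto
        then show ?thesis unfolding \<nu>_def using nn(1)[of "{x..y}"] by (simp add: K_def add_increasing2)
      next
        case 3
        have "\<bar>f (x, 0)\<bar> \<le> K1" using 1(2) x 3 by auto
        moreover have "\<bar>f (y, 0)\<bar> \<le> K2" using 2(2) y 3 by auto
        ultimately have "\<bar>f (y, 0) - f (x, 0)\<bar> \<le> K" unfolding K_def by linarith
        then have "of_int \<bar>f (y, 0) - f (x, 0)\<bar> \<le> (of_int K :: real)" by linarith
        then show ?thesis unfolding \<nu>_def using nn[of "{x..y}"] 3 by simp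
      qed
    qed
    ultimately show ?case unfolding P_def by blast
  next
    case (local t)
    obtain \<epsilon>1 c1 where 1: "\<epsilon>1 > 0" "\<And>x. x \<in> J0 \<Longrightarrow> t < x \<Longrightarrow> x < t + \<epsilon>1 \<Longrightarrow> f (x, 0) = c1"
      using locally_constant_side[OF f local, of 1] by (auto simp: algebra_simps)
    obtain \<epsilon>2 c2 where 2: "\<epsilon>2 > 0" "\<And>x. x \<in> J0 \<Longrightarrow> x < t \<Longrightarrow> t - \<epsilon>2 < x \<Longrightarrow> f (x, 0) = c2"
      using locally_constant_side[OF f local, of "-1"] by (auto simp: algebra_simps)
    define K where "K = \<bar>c1\<bar> + \<bar>c2\<bar> + \<bar>f (t, 0)\<bar>"
    \<comment> \<open>f is constant on each side of t, so one atom at t, of twice the bound on f,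
      suffices.\<close>
    define \<nu> :: "real set \<Rightarrow> real" where "\<nu> A = 2 * of_int K * of_bool (t \<in> A)" for A
    have "charge \<nu>" unfolding charge_def \<nu>_def K_def by auto
    moreover have bd: "\<bar>f (x, 0)\<bar> \<le> K" if "x \<in> J0 \<inter> {c..d}" "c \<le> t \<and> t \<le> d \<and> d - c < min \<epsilon>1 \<epsilon>2" for x c d
      using 1(2)[of x] 2(2)[of x] that unfolding K_def by (cases x t rule: linorder_cases) auto
    moreover have "controls \<nu> f {c..d}" if cd: "c \<le> t \<and> t \<le> d \<and> d - c < min \<epsilon>1 \<epsilon>2" for c d
      unfolding controls_def
    proof (intro ballI impI)
      fix x y assume x: "x \<in> J0 \<inter> {c..d}" and y: "y \<in> J0 \<inter> {c..d}" and xy: "x < y"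
      show "of_int \<bar>f (y, 0) - f (x, 0)\<bar> \<le> \<nu> {x..y}"
      proof (cases "t \<in> {x..y}")
        case True
        have "\<bar>f (y, 0) - f (x, 0)\<bar> \<le> 2 * K" using bd[OF x cd] bd[OF y cd] by linarith
        then have "of_int \<bar>f (y, 0) - f (x, 0)\<bar> \<le> (of_int (2 * K) :: real)" by linarith
        then show ?thesis using True by (simp add: \<nu>_def)
      next
        case False
        then have "f (x, 0) = f (y, 0)"
          using 1(2)[of x] 1(2)[of y] 2(2)[of x] 2(2)[of y] x y xy cd by (cases "t < x") auto
        then show ?thesis by (simp add: \<nu>_def K_def)
      qed
    qed
    ultimately have "\<forall>c d. c \<le> t \<and> t \<le> d \<and> d - c < min \<epsilon>1 \<epsilon>2 \<longrightarrow> P c d"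
      unfolding P_def by blast
    then show ?case using 1(1) 2(1) by (intro exI[of _ "min \<epsilon>1 \<epsilon>2"]) auto
  qed
  then show ?thesis unfolding P_def .
qed

lemma J0_unit: "J0 \<inter> {0..1} = J0 \<inter> UNIV"
  by (auto simp: J0_def)

lemma ctrl_ex: "f \<in> C_int X \<Longrightarrow> \<exists>B. ctrl f B"
  using ex_control[of f] unfolding ctrl_def controls_def J0_unit by blast

lemma C_int_finite_range: "f \<in> C_int X \<Longrightarrow> finite (range f)"
proof -
  assume f: "f \<in> C_int X"
  obtain K where K: "\<And>x. x \<in> J0 \<Longrightarrow> \<bar>f (x, 0)\<bar> \<le> K"
    using ex_control[OF f] unfolding J0_unit by auto
  have "f p \<in> insert 0 {-K..K}" for p
  proof (cases "p \<in> XX")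
    case True
    then have "p \<in> topspace X" by simp
    with openin_topspace obtain x where "x \<in> J0" "f (x, 0) = f p" by (rule attained[OF f])
    then show ?thesis using K[of x] by auto
  qed (use C_int_outside[OF f] in simp)
  then show ?thesis by (meson finite.insertI finite_atLeastAtMost_int finite_subset image_subsetI)
qed

sublocale laps: lap_system X \<sigma> lap n
proof
  show "continuous_map X X \<sigma>" by (rule \<sigma>_cont)
  show "i < n \<Longrightarrow> openin X (lap i)" for i by (rule openin_lap)
  show "(\<Union>i<n. lap i) = topspace X" using lap_cover by simp
  show "disjoint_family_on lap {..<n}" by (rule lap_disjoint)
  show "i < n \<Longrightarrow> inj_on \<sigma> (lap i)" for i by (rule \<sigma>_inj)
  show "(\<lambda>p. \<Sum>y | y \<in> lap i \<and> \<sigma> y = p. f y) \<in> C_int X" if "i < n" "f \<in> C_int X" for i f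
    using C_int_lap_transfer[OF that] unfolding lap_transfer_def .
  show "f \<in> C_int X \<Longrightarrow> finite (range f)" for f by (rule C_int_finite_range)
qed

section \<open>Cylinders and the branches of the iterates\<close>

fun cyl :: "nat list \<Rightarrow> (real \<times> int) set" where
  "cyl [] = XX"
| "cyl (i # v) = {p \<in> lap i. \<sigma> p \<in> cyl v}"

text \<open>The shadow of a cylinder on the line, without the partition points. It agrees with
  \<open>cyl\<close> over \<open>J0\<close>, and it is an interval on which the iterate of \<tau> is
  continuous and strictly monotone.\<close>

fun cyl_real :: "nat list \<Rightarrow> real set" where
  "cyl_real [] = UNIV"
| "cyl_real (i # v) = {x. a i < x \<and> x < a (Suc i) \<and> \<tau> x \<in> cyl_real v}"

definition words :: "nat \<Rightarrow> nat list set" where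
  "words k = {v. set v \<subseteq> {..<n} \<and> length v = k}"

lemma finite_words: "finite (words k)"
  unfolding words_def by (rule finite_lists_length_eq) simp

lemma words_0: "words 0 = {[]}" by (auto simp: words_def)

lemma words_Suc: "i # v \<in> words (Suc k) \<longleftrightarrow> i < n \<and> v \<in> words k"
  by (auto simp: words_def)

lemma words_cases:
  assumes "w \<in> words (Suc k)"
  obtains i v where "w = i # v" "i < n" "v \<in> words k"
  using assms by (cases w) (auto simp: words_def)

lemma cyl_sub: "cyl v \<subseteq> XX"
  using lap_sub by (cases v) auto

lemma cyl_clopen: "v \<in> words k \<Longrightarrow> openin X (cyl v) \<and> closedin X (cyl v)"
proof (induction v arbitrary: k)
  case Nil
  then show ?case using openin_topspace[of X] closedin_topspace[of X] by simp
next
  case (Cons i v)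
  then have i: "i < n" and v: "openin X (cyl v)" "closedin X (cyl v)" by (auto simp: words_def)
  have "cyl (i # v) = lap i \<inter> {p \<in> topspace X. \<sigma> p \<in> cyl v}" using lap_sub by auto
  moreover have "openin X (lap i \<inter> {p \<in> topspace X. \<sigma> p \<in> cyl v})"
    by (rule openin_Int[OF openin_lap[OF i] openin_continuous_map_preimage[OF \<sigma>_cont v(1)]])
  moreover have "closedin X (lap i \<inter> {p \<in> topspace X. \<sigma> p \<in> cyl v})"
    by (rule closedin_Int[OF laps.E_closed[OF i] closedin_continuous_map_preimage[OF \<sigma>_cont v(2)]])
  ultimately show ?case by simp
qed

lemma cyl_cover: "p \<in> XX \<Longrightarrow> \<exists>v\<in>words k. p \<in> cyl v"
proof (induction k arbitrary: p)
  case 0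
  then show ?case by (simp add: words_0)
next
  case (Suc k)
  obtain i where i: "i < n" "p \<in> lap i" using Suc.prems lap_cover by blast
  obtain v where "v \<in> words k" "\<sigma> p \<in> cyl v" using Suc.IH[OF \<sigma>_in[OF Suc.prems]] by blast
  then show ?case using i by (intro bexI[of _ "i # v"]) (auto simp: words_Suc)
qed

lemma cyl_unique: "v \<in> words k \<Longrightarrow> w \<in> words k \<Longrightarrow> p \<in> cyl v \<Longrightarrow> p \<in> cyl w \<Longrightarrow> v = w"
proof (induction k arbitrary: p v w)
  case 0
  then show ?case by (simp add: words_0)
next
  case (Suc k)
  obtain i v' where v: "v = i # v'" "i < n" "v' \<in> words k" using Suc.prems(1) by (rule words_cases)
  obtain j w' where w: "w = j # w'" "j < n" "w' \<in> words k" using Suc.prems(2) by (rule words_cases)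
  have "i = j" using laps.E_unique[of p i j] Suc.prems v w by auto
  moreover have "v' = w'" using Suc.IH[OF v(3) w(3), of "\<sigma> p"] Suc.prems(3,4) v(1) w(1) by simp
  ultimately show ?case using v w by simp
qed

lemma cyl_inj: "v \<in> words k \<Longrightarrow> inj_on (\<sigma> ^^ k) (cyl v)"
proof (induction k arbitrary: v)
  case 0
  then show ?case by simp
next
  case (Suc k)
  obtain i v' where v: "v = i # v'" "i < n" "v' \<in> words k" using Suc.prems by (rule words_cases)
  show ?case
  proof (rule inj_onI)
    fix p q assume pq: "p \<in> cyl v" "q \<in> cyl v" "(\<sigma> ^^ Suc k) p = (\<sigma> ^^ Suc k) q"
    then have "\<sigma> p = \<sigma> q" using Suc.IH[OF v(3)] v(1)
      by (auto simp: funpow_Suc_right inj_on_def simp del: funpow.simps)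
    then show "p = q" using pq v \<sigma>_inj[OF v(2)] by (auto dest: inj_onD)
  qed
qed

lemma cyl_J0:
  assumes "x \<in> J0" "v \<in> words k"
  shows "(x, 0) \<in> cyl v \<longleftrightarrow> x \<in> cyl_real v"
  using assms
proof (induction k arbitrary: x v)
  case 0
  then show ?case using J0_point by (simp add: words_0)
next
  case (Suc k)
  obtain i v' where v: "v = i # v'" "i < n" "v' \<in> words k" using Suc.prems(2) by (rule words_cases)
  have x: "x \<in> {0..1}" "x \<notin> S" using Suc.prems(1) by (auto simp: J0_def)
  have "\<tau> x \<in> J0" using \<tau>_I0[OF x] by (auto simp: J0_def)
  then show ?case using Suc.IH[OF _ v(3)] v lap_I0[OF x v(2)] \<sigma>_I0[OF x] by auto
qed

lemma cyl_real_disjoint: "disjoint_family_on cyl_real (words k)"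
proof -
  have "v = w" if "v \<in> words k" "w \<in> words k" "x \<in> cyl_real v" "x \<in> cyl_real w" for v w x
    using that
  proof (induction k arbitrary: x v w)
    case 0
    then show ?case by (simp add: words_0)
  next
    case (Suc k)
    obtain i v' where v: "v = i # v'" "i < n" "v' \<in> words k" using Suc.prems(1) by (rule words_cases)
    obtain j w' where w: "w = j # w'" "j < n" "w' \<in> words k" using Suc.prems(2) by (rule words_cases)
    have "lap_side i 1 x" "lap_side j 1 x" using Suc.prems v w by (auto simp: lap_side_def)
    then have "i = j" using lap_side_unique v(2) w(2) by blast
    moreover have "v' = w'" using Suc.IH[OF v(3) w(3)] Suc.prems v w by auto
    ultimately show ?case using v w by simp
  qed
  then show ?thesis unfolding disjoint_family_on_def by blast
qed

text \<open>The first lap is peeled off: \<tau> is monotone there, so the preimage of an interval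
  within the lap is an interval, and the signs of the two monotonicities multiply.\<close>

lemma cyl_real_mono:
  assumes "v \<in> words k"
  shows "is_interval (cyl_real v) \<and> continuous_on (cyl_real v) (\<tau> ^^ k) \<and>
    (\<exists>e::real. (e = 1 \<or> e = -1) \<and>
       (\<forall>x\<in>cyl_real v. \<forall>y\<in>cyl_real v. x < y \<longrightarrow> e * (\<tau> ^^ k) x < e * (\<tau> ^^ k) y))"
  using assms
proof (induction k arbitrary: v)
  case 0
  then show ?case by (auto simp: words_0 intro!: exI[of _ 1])
next
  case (Suc k)
  obtain i v' where v: "v = i # v'" "i < n" "v' \<in> words k" using Suc.prems by (rule words_cases)
  obtain e :: real where IH: "is_interval (cyl_real v')" "continuous_on (cyl_real v') (\<tau> ^^ k)"
    "e = 1 \<or> e = -1"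
    "\<And>x y. x \<in> cyl_real v' \<Longrightarrow> y \<in> cyl_real v' \<Longrightarrow> x < y \<Longrightarrow> e * (\<tau> ^^ k) x < e * (\<tau> ^^ k) y"
    using Suc.IH[OF v(3)] by blast
  define o' :: real where "o' = of_int (orient i)"
  have o': "o' = 1 \<or> o' = -1" using orient_cases[of i] by (auto simp: o'_def)
  have mono: "o' * \<tau> x < o' * \<tau> y" if "a i < x" "x < y" "y < a (Suc i)" for x y
    using orient_mono[OF v(2) that] by (simp add: o'_def)
  have cv: "cyl_real v = {x. a i < x \<and> x < a (Suc i) \<and> \<tau> x \<in> cyl_real v'}" by (simp add: v(1))
  have "is_interval (cyl_real v)" unfolding is_interval_1
  proof (intro ballI allI impI)
    fix x y z assume xy: "x \<in> cyl_real v" "y \<in> cyl_real v" "x \<le> z \<and> z \<le> y"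
    have "o' * \<tau> x \<le> o' * \<tau> z" using mono[of x z] xy unfolding cv by (cases "x = z") auto
    moreover have "o' * \<tau> z \<le> o' * \<tau> y" using mono[of z y] xy unfolding cv by (cases "z = y") auto
    ultimately have "\<tau> x \<le> \<tau> z \<and> \<tau> z \<le> \<tau> y \<or> \<tau> y \<le> \<tau> z \<and> \<tau> z \<le> \<tau> x" using o' by auto
    then have "\<tau> z \<in> cyl_real v'" using IH(1) xy unfolding is_interval_1 cv by blast
    then show "z \<in> cyl_real v" using xy unfolding cv by auto
  qed
  moreover have "continuous_on (cyl_real v) (\<tau> ^^ Suc k)"
    unfolding funpow_Suc_right
  proof (rule continuous_on_compose)
    have "continuous_on {a i<..<a (Suc i)} \<tau>"
      using pts v(2) by (auto simp: monotonicity_points_def cont_strict_monotonic_def)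
    then show "continuous_on (cyl_real v) \<tau>" by (rule continuous_on_subset) (auto simp: cv)
    show "continuous_on (\<tau> ` cyl_real v) (\<tau> ^^ k)"
      using IH(2) by (rule continuous_on_subset) (auto simp: cv)
  qed
  moreover have "(e * o') * (\<tau> ^^ Suc k) x < (e * o') * (\<tau> ^^ Suc k) y"
    if xy: "x \<in> cyl_real v" "y \<in> cyl_real v" "x < y" for x y
    using mono[of x y] IH(4)[of "\<tau> x" "\<tau> y"] IH(4)[of "\<tau> y" "\<tau> x"] xy o' IH(3)
    by (auto simp: cv funpow_Suc_right simp del: funpow.simps)
  moreover have "e * o' = 1 \<or> e * o' = -1" using IH(3) o' by auto
  ultimately show ?case by blast
qed

lemma \<tau>_pow_J0: "x \<in> J0 \<Longrightarrow> (\<tau> ^^ k) x \<in> J0 \<and> (\<sigma> ^^ k) (x, 0) = ((\<tau> ^^ k) x, 0)"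
proof (induction k)
  case (Suc k)
  then have "(\<tau> ^^ k) x \<in> {0..1}" "(\<tau> ^^ k) x \<notin> S" by (auto simp: J0_def)
  then show ?case using Suc \<tau>_I0[of "(\<tau> ^^ k) x"] \<sigma>_I0[of "(\<tau> ^^ k) x"] by (auto simp: J0_def)
qed simp

text \<open>\<open>S\<close> is forward invariant under the branches, so a point with an unsplit
  image is itself unsplit.\<close>

lemma \<sigma>_pow_J0_back: "p \<in> XX \<Longrightarrow> fst ((\<sigma> ^^ k) p) \<notin> S \<Longrightarrow> fst p \<in> J0 \<and> p = (fst p, 0)"
proof (induction k arbitrary: p)
  case 0
  then show ?case using I0_germ[of p] split_points_fst[of p S] by (auto simp: J0_def)
next
  case (Suc k)
  then have "fst (\<sigma> p) \<in> J0" using Suc.IH[OF \<sigma>_in] by (simp add: funpow_Suc_right del: funpow.simps)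
  then have ns: "fst (\<sigma> p) \<notin> S" by (simp add: J0_def)
  obtain i where i: "i < n" "p \<in> lap i" using Suc.prems lap_cover by blast
  have "fst p \<notin> S" using ns S_forward[OF i(1)] lap_fst[OF i(2)] \<sigma>_fst[OF i(2,1)] by auto
  then show ?case using I0_germ[of p] split_points_fst[of p S] Suc.prems(1) by (auto simp: J0_def)
qed

text \<open>Both values are attained at unsplit points of the cylinder, and its shadow, being an
  interval, contains everything between them.\<close>

lemma osc_le:
  assumes \<nu>: "charge \<nu>" "controls \<nu> f UNIV" and f: "f \<in> C_int X"
    and v: "v \<in> words k" and pq: "p \<in> cyl v" "q \<in> cyl v"
  shows "of_int \<bar>f p - f q\<bar> \<le> \<nu> (cyl_real v)"
proof -
  have op: "openin X (cyl v)" using cyl_clopen[OF v] by blast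
  obtain x where x: "x \<in> J0" "(x, 0) \<in> cyl v" "f (x, 0) = f p" using attained[OF f op pq(1)] .
  obtain y where y: "y \<in> J0" "(y, 0) \<in> cyl v" "f (y, 0) = f q" using attained[OF f op pq(2)] .
  have xv: "x \<in> cyl_real v" "y \<in> cyl_real v" using cyl_J0[OF _ v] x y by auto
  have int: "is_interval (cyl_real v)" using cyl_real_mono[OF v] by blast
  have *: "of_int \<bar>f (y, 0) - f (x, 0)\<bar> \<le> \<nu> (cyl_real v)"
    if "x < y" "x \<in> J0" "y \<in> J0" "x \<in> cyl_real v" "y \<in> cyl_real v" for x y
  proof -
    have "of_int \<bar>f (y, 0) - f (x, 0)\<bar> \<le> \<nu> {x..y}" using \<nu>(2) that by (simp add: controls_def)
    also have "\<dots> \<le> \<nu> (cyl_real v)"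
    proof (rule charge_mono[OF \<nu>(1)], rule subsetI)
      fix z assume "z \<in> {x..y}"
      then show "z \<in> cyl_real v" using int that(4,5) unfolding is_interval_1 by (meson atLeastAtMost_iff)
    qed
    finally show ?thesis .
  qed
  show ?thesis
    using *[of x y] *[of y x] x y xv charge_nonneg[OF \<nu>(1)]
    by (cases x y rule: linorder_cases) (auto simp: abs_minus_commute)
qed

end

section \<open>The Lasota--Yorke inequality\<close>

context interval_map
begin

lemma S_pow: "v \<in> words k \<Longrightarrow> x \<in> cyl_real v \<Longrightarrow> x \<in> S \<Longrightarrow> (\<tau> ^^ k) x \<in> S"
proof (induction k arbitrary: x v)
  case 0
  then show ?case by simp
next
  case (Suc k)
  obtain i v' where v: "v = i # v'" "i < n" "v' \<in> words k" using Suc.prems(1) by (rule words_cases)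
  then have x: "a i < x" "x < a (Suc i)" "\<tau> x \<in> cyl_real v'" using Suc.prems(2) by auto
  have "\<tau> x \<in> S" using S_forward[OF v(2), of x] branch_eq[OF x(1,2)] x Suc.prems(3) by simp
  then show ?case using Suc.IH[OF v(3) x(3)] by (simp add: funpow_Suc_right del: funpow.simps)
qed

lemma cyl_sum:
  assumes "f \<in> C_int X"
  shows "f = (\<lambda>p. \<Sum>v\<in>words k. f p * indicator (cyl v) p)"
proof
  fix p
  show "f p = (\<Sum>v\<in>words k. f p * indicator (cyl v) p)"
  proof (cases "p \<in> XX")
    case True
    then obtain v where v: "v \<in> words k" "p \<in> cyl v" using cyl_cover by blast
    have "(\<Sum>w\<in>words k. f p * indicator (cyl w) p) = (\<Sum>w\<in>{v}. f p * indicator (cyl w) p)"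
    proof (rule sum.mono_neutral_right[OF finite_words])
      show "\<forall>w\<in>words k - {v}. f p * indicator (cyl w) p = 0"
        using cyl_unique[OF v(1) _ v(2)] by (auto simp: indicator_def)
    qed (use v in simp)
    then show ?thesis using v by simp
  qed (use C_int_outside[OF assms] in simp)
qed

end

locale interval_cycle = interval_map +
  fixes s :: real and \<mu> :: "(real \<times> int) measure" and N :: nat and Y :: "nat \<Rightarrow> (real \<times> int) set"
  assumes scaled: "scaled_measure X \<sigma> s \<mu>" and cycle: "exact_cycle X \<sigma> N Y"
begin

sublocale laps: exact_lap_system X \<sigma> lap n s \<mu> N Y
  by unfold_locales (rule scaled, rule cycle)

lemma C_cyl: "v \<in> words k \<Longrightarrow> indicator (cyl v) \<in> C_int X"
  using cyl_clopen C_int_indicator by blast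

lemma cyl_measure_pos: "v \<in> words k \<Longrightarrow> cyl v \<noteq> {} \<Longrightarrow> 0 < laps.I (indicator (cyl v))"
  using cyl_clopen laps.I_open_pos by blast

text \<open>The iterate of \<open>\<sigma>\<close> is injective on the cylinder, so the transferred
  indicator is at most 1, while its integral is \<open>s^k\<close> times the measure.\<close>

lemma cyl_measure_le:
  assumes v: "v \<in> words k"
  shows "laps.I (indicator (cyl v)) \<le> 1 / s ^ k"
proof -
  have sub: "cyl v \<subseteq> topspace X" using cyl_sub by simp
  have "{x. indicator (cyl v) x \<noteq> (0::int)} \<subseteq> cyl v" by (auto simp: indicator_def split: if_splits)
  note L = laps.L_pow_inj_on[OF this sub cyl_inj[OF v]]
  have "laps.I ((laps.L ^^ k) (indicator (cyl v))) \<le> laps.I (indicator (topspace X))"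
  proof (rule laps.I_mono)
    fix x assume x: "x \<in> topspace X"
    show "(laps.L ^^ k) (indicator (cyl v)) x \<le> indicator (topspace X) x"
    proof (cases "x \<in> (\<sigma> ^^ k) ` cyl v")
      case True
      then show ?thesis using L x by auto
    next
      case False
      then have "(laps.L ^^ k) (indicator (cyl v)) x = 0" using L by blast
      then show ?thesis by simp
    qed
  qed (use laps.C_L_pow[OF C_cyl[OF v]] laps.C_X in auto)
  then have "s ^ k * laps.I (indicator (cyl v)) \<le> 1"
    using laps.I_L_pow[OF C_cyl[OF v], of k] laps.I_X by simp
  then show ?thesis using laps.s_pos by (simp add: field_simps)
qed

lemma cyl_measure_sum: "(\<Sum>v\<in>words k. laps.I (indicator (cyl v))) = 1"
proof -
  have "indicator (topspace X) p * indicator (cyl v) p = (indicator (cyl v) p :: int)" for v p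
    using cyl_sub[of v] by (auto simp: indicator_def)
  then have "(indicator (topspace X) :: _ \<Rightarrow> int) = (\<lambda>p. \<Sum>v\<in>words k. indicator (cyl v) p)"
    by (intro trans[OF cyl_sum[OF laps.C_X, of k]]) (simp only:)
  then show ?thesis using laps.I_X laps.I_sum[of "words k" "\<lambda>v. indicator (cyl v)"] C_cyl by simp
qed

text \<open>For each q in the cylinder, |f p| is at most |f q| plus the oscillation; averaging over
  q replaces |f q| by a mean.\<close>

lemma mean_bound:
  assumes f: "f \<in> C_int X" and v: "v \<in> words k" and p: "p \<in> cyl v"
    and osc: "\<And>q. q \<in> cyl v \<Longrightarrow> of_int \<bar>f p - f q\<bar> \<le> B"
  shows "of_int \<bar>f p\<bar> \<le> B + laps.I (\<lambda>x. \<bar>f x\<bar>) / laps.I (indicator (cyl v))"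
proof -
  have "(of_int \<bar>f p\<bar> - B) * laps.I (indicator (cyl v)) \<le> laps.I (\<lambda>x. \<bar>f x\<bar>)"
  proof (rule laps.I_ge)
    fix q assume "q \<in> cyl v"
    from osc[OF this] show "of_int \<bar>f p\<bar> - B \<le> of_int \<bar>f q\<bar>" by linarith
  qed (use cyl_clopen[OF v] C_int_abs[OF f] in auto)
  moreover have "0 < laps.I (indicator (cyl v))" using cyl_measure_pos[OF v] p by blast
  ultimately show ?thesis by (simp add: field_simps)
qed

text \<open>The cylinder of the empty word is all of X and has measure 1.\<close>

lemma ctrl_sup:
  assumes f: "f \<in> C_int X" and B: "ctrl f B" and p: "p \<in> topspace X"
  shows "\<bar>of_int (f p)\<bar> \<le> B + laps.I (\<lambda>x. \<bar>f x\<bar>)"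
proof -
  obtain \<nu> where \<nu>: "charge \<nu>" "controls \<nu> f UNIV" "\<nu> UNIV \<le> B" using B by (auto simp: ctrl_def)
  have w: "[] \<in> words 0" by (simp add: words_0)
  have "of_int \<bar>f p\<bar> \<le> B + laps.I (\<lambda>x. \<bar>f x\<bar>) / laps.I (indicator (cyl []))"
  proof (rule mean_bound[OF f w])
    show "p \<in> cyl []" using p by simp
    show "of_int \<bar>f p - f q\<bar> \<le> B" if "q \<in> cyl []" for q
      using osc_le[OF \<nu>(1,2) f w _ that, of p] p \<nu>(3) by simp
  qed
  then show ?thesis using laps.I_X by simp
qed

text \<open>Over the image T of the cylinder the transferred function is f read along the inverse
  branch, and it vanishes elsewhere. Its variation is that of f on the cylinder plus a jump at each
  end of T; both jumps are bounded by \<beta>, an oscillation plus a mean.\<close>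

lemma branch_control:
  assumes f: "f \<in> C_int X" and \<nu>: "charge \<nu>" "controls \<nu> f UNIV" and v: "v \<in> words k"
  defines "\<beta> \<equiv> \<nu> (cyl_real v) + laps.I (\<lambda>x. \<bar>f x\<bar>) / laps.I (indicator (cyl v))"
  shows "\<exists>\<nu>'. charge \<nu>' \<and> controls \<nu>' ((laps.L ^^ k) (\<lambda>x. f x * indicator (cyl v) x)) UNIV \<and>
    \<nu>' UNIV \<le> \<nu> (cyl_real v) + 2 * \<beta>"
proof -
  define T where "T = (\<tau> ^^ k) ` (cyl_real v \<inter> J0)"
  define h where "h = (laps.L ^^ k) (\<lambda>x. f x * indicator (cyl v) x)"
  \<comment> \<open>The push-forward of \<nu> restricted to the shadow, with one atom for each end
    of T.\<close>
  define \<nu>' where "\<nu>' Z = \<nu> (cyl_real v \<inter> (\<tau> ^^ k) -` Z) + \<beta> * of_bool (Inf T \<in> Z) + \<beta> * of_bool (Sup T \<in> Z)" for Z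
  have m: "0 \<le> laps.I (indicator (cyl v))" by (rule laps.I_nonneg) simp
  have "0 \<le> laps.I (\<lambda>x. \<bar>f x\<bar>)" by (rule laps.I_nonneg) simp
  then have \<beta>: "0 \<le> \<beta>" unfolding \<beta>_def using m charge_nonneg[OF \<nu>(1)] by simp
  have cont: "charge \<nu>'" unfolding charge_def
  proof (intro conjI allI impI)
    show "0 \<le> \<nu>' Z" for Z unfolding \<nu>'_def using \<beta> charge_nonneg[OF \<nu>(1)] by simp
    show "\<nu>' (Z \<union> W) = \<nu>' Z + \<nu>' W" if "Z \<inter> W = {}" for Z W
    proof -
      have "cyl_real v \<inter> (\<tau> ^^ k) -` (Z \<union> W) =
        (cyl_real v \<inter> (\<tau> ^^ k) -` Z) \<union> (cyl_real v \<inter> (\<tau> ^^ k) -` W)" by blast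
      moreover have "(cyl_real v \<inter> (\<tau> ^^ k) -` Z) \<inter> (cyl_real v \<inter> (\<tau> ^^ k) -` W) = {}"
        using that by blast
      moreover have "of_bool (t \<in> Z \<union> W) = (of_bool (t \<in> Z) + of_bool (t \<in> W) :: real)" for t
        using that by auto
      ultimately show ?thesis unfolding \<nu>'_def using charge_Un[OF \<nu>(1)] by (simp add: algebra_simps)
    qed
  qed
  have supp: "{x. f x * indicator (cyl v) x \<noteq> 0} \<subseteq> cyl v"
    by (auto simp: indicator_def split: if_splits)
  have "cyl v \<subseteq> topspace X" using cyl_sub by simp
  note L = laps.L_pow_inj_on[OF supp this cyl_inj[OF v], folded h_def]
  have h_in: "h ((\<tau> ^^ k) x', 0) = f (x', 0)" if "x' \<in> cyl_real v" "x' \<in> J0" for x'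
    using L cyl_J0[OF that(2) v] \<tau>_pow_J0[OF that(2), of k] that(1) by force
  have h_out: "h (x, 0) = 0" if x: "x \<in> J0" "x \<notin> T" for x
  proof -
    have "(x, 0) \<notin> (\<sigma> ^^ k) ` cyl v"
    proof
      assume "(x, 0) \<in> (\<sigma> ^^ k) ` cyl v"
      then obtain p where p: "p \<in> cyl v" "(\<sigma> ^^ k) p = (x, 0)" by (metis imageE)
      have XXp: "p \<in> XX" using p(1) cyl_sub by blast
      have "fst ((\<sigma> ^^ k) p) \<notin> S" using p(2) x(1) by (simp add: J0_def)
      then have q: "fst p \<in> J0" "p = (fst p, 0)" using \<sigma>_pow_J0_back[OF XXp] by auto
      then have "fst p \<in> cyl_real v" using cyl_J0[OF q(1) v] p(1) by simp
      moreover have "(\<tau> ^^ k) (fst p) = x" using \<tau>_pow_J0[OF q(1), of k] q(2) p(2) by simp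
      ultimately show False using x(2) q(1) unfolding T_def by blast
    qed
    then show ?thesis using L by blast
  qed
  obtain e :: real where int: "is_interval (cyl_real v)" and ct: "continuous_on (cyl_real v) (\<tau> ^^ k)"
    and e: "e = 1 \<or> e = -1" and mono: "\<And>x y. x \<in> cyl_real v \<Longrightarrow> y \<in> cyl_real v \<Longrightarrow> x < y \<Longrightarrow>
      e * (\<tau> ^^ k) x < e * (\<tau> ^^ k) y"
    using cyl_real_mono[OF v] by blast
  have between: "z \<in> cyl_real v" if "x \<in> cyl_real v" "y \<in> cyl_real v" "x \<le> z" "z \<le> y" for x y z
    using int that unfolding is_interval_1 by blast
  \<comment> \<open>T is an interval relative to \<open>J0\<close>: the intermediate value theorem
    gives a preimage, which is unsplit by forward invariance of \<open>S\<close>.\<close>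
  have T_convex: "x \<in> T" if t: "t1 \<in> T" "t2 \<in> T" and x: "x \<in> J0" "t1 \<le> x" "x \<le> t2" for t1 t2 x
  proof -
    obtain x1 x2 where x12: "x1 \<in> cyl_real v" "x1 \<in> J0" "t1 = (\<tau> ^^ k) x1"
      "x2 \<in> cyl_real v" "x2 \<in> J0" "t2 = (\<tau> ^^ k) x2" using t unfolding T_def by auto
    have sub: "z \<in> cyl_real v" if "min x1 x2 \<le> z" "z \<le> max x1 x2" for z
      using between[of x1 x2 z] between[of x2 x1 z] x12 that by (auto simp: min_def max_def split: if_splits)
    then have "continuous_on {min x1 x2..max x1 x2} (\<tau> ^^ k)"
      by (intro continuous_on_subset[OF ct]) auto
    then have "\<exists>z\<ge>min x1 x2. z \<le> max x1 x2 \<and> (\<tau> ^^ k) z = x"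
      using IVT'[of "\<tau> ^^ k" "min x1 x2" x "max x1 x2"] IVT2'[of "\<tau> ^^ k" "max x1 x2" x "min x1 x2"] x x12
      by (cases "x1 \<le> x2") (auto simp: min_def max_def)
    then obtain z where z: "min x1 x2 \<le> z" "z \<le> max x1 x2" "(\<tau> ^^ k) z = x" by blast
    have "z \<notin> S" using S_pow[OF v sub[OF z(1,2)]] z(3) x(1) by (auto simp: J0_def)
    then have "z \<in> J0" using z x12 by (auto simp: J0_def min_def max_def split: if_splits)
    then show ?thesis using sub[OF z(1,2)] z(3) unfolding T_def by blast
  qed
  have small: "of_int \<bar>h (x, 0)\<bar> \<le> \<beta>" if xT: "x \<in> T" for x
  proof -
    obtain x' where x': "x' \<in> cyl_real v" "x' \<in> J0" "x = (\<tau> ^^ k) x'"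
      using xT unfolding T_def by blast
    have p: "(x', 0) \<in> cyl v" using cyl_J0[OF x'(2) v] x'(1) by simp
    have "of_int \<bar>f (x', 0)\<bar> \<le> \<beta>"
      unfolding \<beta>_def by (rule mean_bound[OF f v p osc_le[OF \<nu> f v p]])
    then show ?thesis using h_in x' by simp
  qed
  have *: "of_int \<bar>f (y, 0) - f (x, 0)\<bar> \<le> \<nu> (cyl_real v \<inter> (\<tau> ^^ k) -` Z)"
    if xy: "x < y" "x \<in> cyl_real v" "y \<in> cyl_real v" "x \<in> J0" "y \<in> J0"
      and Z: "Z = {min ((\<tau> ^^ k) x) ((\<tau> ^^ k) y)..max ((\<tau> ^^ k) x) ((\<tau> ^^ k) y)}" for x y Z
  proof -
    have "of_int \<bar>f (y, 0) - f (x, 0)\<bar> \<le> \<nu> {x..y}" using \<nu>(2) xy by (simp add: controls_def)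
    also have "\<dots> \<le> \<nu> (cyl_real v \<inter> (\<tau> ^^ k) -` Z)"
    proof (rule charge_mono[OF \<nu>(1)], rule subsetI)
      fix z assume z: "z \<in> {x..y}"
      then have zv: "z \<in> cyl_real v" using between[of x y z] xy by simp
      have "e * (\<tau> ^^ k) x \<le> e * (\<tau> ^^ k) z" using mono[of x z] xy z zv by (cases "x = z") auto
      moreover have "e * (\<tau> ^^ k) z \<le> e * (\<tau> ^^ k) y" using mono[of z y] xy z zv by (cases "z = y") auto
      ultimately show "z \<in> cyl_real v \<inter> (\<tau> ^^ k) -` Z" using zv e by (auto simp: Z)
    qed
    finally show ?thesis .
  qed
  have "controls \<nu>' h UNIV" unfolding controls_def
  proof (intro ballI impI)
    fix x y assume x: "x \<in> J0 \<inter> UNIV" and y: "y \<in> J0 \<inter> UNIV" and xy: "x < y"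
    have part: "\<nu> (cyl_real v \<inter> (\<tau> ^^ k) -` {x..y}) \<le> \<nu>' {x..y}" unfolding \<nu>'_def using \<beta> by simp
    have nn: "0 \<le> \<nu> (cyl_real v \<inter> (\<tau> ^^ k) -` {x..y})" by (rule charge_nonneg[OF \<nu>(1)])
    consider "x \<in> T" "y \<in> T" | "x \<notin> T" "y \<in> T" | "x \<in> T" "y \<notin> T" | "x \<notin> T" "y \<notin> T" by blast
    then show "of_int \<bar>h (y, 0) - h (x, 0)\<bar> \<le> \<nu>' {x..y}"
    proof cases
      case 1
      obtain x' where x': "x' \<in> cyl_real v" "x' \<in> J0" "x = (\<tau> ^^ k) x'" using 1(1) unfolding T_def by auto
      obtain y' where y': "y' \<in> cyl_real v" "y' \<in> J0" "y = (\<tau> ^^ k) y'" using 1(2) unfolding T_def by auto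
      have Z: "{x..y} = {min x y..max x y}" "{x..y} = {min y x..max y x}" using xy by auto
      have "of_int \<bar>f (y', 0) - f (x', 0)\<bar> \<le> \<nu> (cyl_real v \<inter> (\<tau> ^^ k) -` {x..y})"
      proof (cases "x' < y'")
        case True
        then show ?thesis using *[of x' y' "{x..y}"] x' y' Z by simp
      next
        case False
        then have "y' < x'" using x' y' xy by (metis less_irrefl linorder_neqE_linordered_idom)
        then show ?thesis using *[of y' x' "{x..y}"] x' y' Z by (simp add: abs_minus_commute)
      qed
      then show ?thesis using part h_in x' y' by simp
    next
      \<comment> \<open>With x outside T and y inside it, the lower end of T lies between them, so
        the interval contains the first atom.\<close>
      case 2
      have lb: "x \<le> t" if "t \<in> T" for t
        using T_convex[OF that 2(2), of x] 2(1) x xy by force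
      have "Inf T \<le> y" using 2(2) lb by (intro cInf_lower bdd_belowI) auto
      moreover have "x \<le> Inf T" using 2(2) lb by (intro cInf_greatest) auto
      ultimately have "\<beta> \<le> \<nu>' {x..y}" unfolding \<nu>'_def using nn \<beta> by simp
      then show ?thesis using small[OF 2(2)] h_out[of x] 2(1) x by simp
    next
      case 3
      have ub: "t \<le> y" if "t \<in> T" for t
        using T_convex[OF 3(1) that, of y] 3(2) y xy by force
      have "x \<le> Sup T" using 3(1) ub by (intro cSup_upper bdd_aboveI) auto
      moreover have "Sup T \<le> y" using 3(1) ub by (intro cSup_least) auto
      ultimately have "\<beta> \<le> \<nu>' {x..y}" unfolding \<nu>'_def using nn \<beta> by simp
      then show ?thesis using small[OF 3(1)] h_out[of y] 3(2) y by simp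
    next
      case 4
      then show ?thesis using h_out x y part nn by simp
    qed
  qed
  moreover have "\<nu>' UNIV = \<nu> (cyl_real v) + 2 * \<beta>" by (simp add: \<nu>'_def)
  ultimately show ?thesis using cont unfolding h_def by (intro exI[of _ \<nu>']) simp
qed

text \<open>Summed over all words, the charges of the disjoint shadows total at most B, which gives
  3 B; the means add up to C times the \<open>L^1\<close> norm.\<close>

lemma ctrl_L_pow:
  "\<exists>C\<ge>0. \<forall>f B. f \<in> C_int X \<longrightarrow> ctrl f B \<longrightarrow>
     ctrl ((laps.L ^^ k) f) (3 * B + C * laps.I (\<lambda>x. \<bar>f x\<bar>))"
proof -
  define m where "m v = laps.I (indicator (cyl v))" for v
  \<comment> \<open>An empty cylinder has \<open>m v = 0\<close> and contributes 2 / 0 = 0, in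
    agreement with the mean term used for it.\<close>
  define C where "C = (\<Sum>v\<in>words k. 2 / m v)"
  have "0 \<le> m v" for v unfolding m_def by (rule laps.I_nonneg) simp
  then have C: "0 \<le> C" unfolding C_def by (intro sum_nonneg) simp
  have "ctrl ((laps.L ^^ k) f) (3 * B + C * laps.I (\<lambda>x. \<bar>f x\<bar>))" if f: "f \<in> C_int X" and B: "ctrl f B" for f B
  proof -
    obtain \<nu> where \<nu>: "charge \<nu>" "controls \<nu> f UNIV" "\<nu> UNIV \<le> B" using B by (auto simp: ctrl_def)
    define A where "A = laps.I (\<lambda>x. \<bar>f x\<bar>)"
    define h where "h v = (laps.L ^^ k) (\<lambda>x. f x * indicator (cyl v) x)" for v
    have "\<exists>\<nu>'. charge \<nu>' \<and> controls \<nu>' (h v) UNIV \<and>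
      \<nu>' UNIV \<le> \<nu> (cyl_real v) + 2 * (\<nu> (cyl_real v) + A / m v)" if "v \<in> words k" for v
      unfolding h_def A_def m_def by (rule branch_control[OF f \<nu>(1,2) that])
    then obtain \<nu>' where \<nu>': "\<And>v. v \<in> words k \<Longrightarrow> charge (\<nu>' v)"
      "\<And>v. v \<in> words k \<Longrightarrow> controls (\<nu>' v) (h v) UNIV"
      "\<And>v. v \<in> words k \<Longrightarrow> \<nu>' v UNIV \<le> \<nu> (cyl_real v) + 2 * (\<nu> (cyl_real v) + A / m v)" by metis
    define \<rho> where "\<rho> Z = (\<Sum>v\<in>words k. \<nu>' v Z)" for Z
    have "charge \<rho>" unfolding charge_def \<rho>_def
      using \<nu>'(1) charge_nonneg charge_Un by (auto intro!: sum_nonneg simp flip: sum.distrib)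
    moreover have Lf: "(laps.L ^^ k) f = (\<lambda>x. \<Sum>v\<in>words k. h v x)"
      using arg_cong[OF cyl_sum[OF f, of k], of "laps.L ^^ k"] unfolding h_def transfer_pow_sum .
    have "controls \<rho> ((laps.L ^^ k) f) UNIV" unfolding controls_def
    proof (intro ballI impI)
      fix x y assume x: "x \<in> J0 \<inter> UNIV" and y: "y \<in> J0 \<inter> UNIV" and xy: "x < y"
      have "\<bar>(laps.L ^^ k) f (y, 0) - (laps.L ^^ k) f (x, 0)\<bar> = \<bar>\<Sum>v\<in>words k. h v (y, 0) - h v (x, 0)\<bar>"
        by (simp add: Lf sum_subtractf)
      also have "\<dots> \<le> (\<Sum>v\<in>words k. \<bar>h v (y, 0) - h v (x, 0)\<bar>)" by (rule sum_abs)
      finally have "of_int \<bar>(laps.L ^^ k) f (y, 0) - (laps.L ^^ k) f (x, 0)\<bar> \<le>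
        (of_int (\<Sum>v\<in>words k. \<bar>h v (y, 0) - h v (x, 0)\<bar>) :: real)" by (simp only: of_int_le_iff)
      also have "\<dots> \<le> \<rho> {x..y}" unfolding \<rho>_def of_int_sum
        using \<nu>'(2) x y xy by (intro sum_mono) (simp add: controls_def)
      finally show "of_int \<bar>(laps.L ^^ k) f (y, 0) - (laps.L ^^ k) f (x, 0)\<bar> \<le> \<rho> {x..y}" .
    qed
    moreover have "\<rho> UNIV \<le> 3 * B + C * A"
    proof -
      have "\<rho> UNIV \<le> (\<Sum>v\<in>words k. 3 * \<nu> (cyl_real v) + 2 / m v * A)"
        unfolding \<rho>_def using \<nu>'(3) by (intro sum_mono) (fastforce simp: algebra_simps)
      also have "\<dots> = 3 * (\<Sum>v\<in>words k. \<nu> (cyl_real v)) + C * A"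
        by (simp add: sum.distrib sum_distrib_left sum_distrib_right C_def)
      also have "(\<Sum>v\<in>words k. \<nu> (cyl_real v)) \<le> B"
        using charge_UN[OF \<nu>(1) finite_words cyl_real_disjoint] charge_mono[OF \<nu>(1) subset_UNIV] \<nu>(3)
        by (metis order_trans)
      finally show ?thesis by simp
    qed
    ultimately show ?thesis unfolding ctrl_def A_def by blast
  qed
  then show ?thesis using C by blast
qed

text \<open>Otherwise g falls below half its integral somewhere on each nonempty cylinder, hence
  exceeds it there by at most the charge of the shadow. Integrating with the bound on cylinder
  measures contradicts the value of the integral.\<close>

lemma ctrl_floor:
  assumes s: "1 < s"
  shows "\<exists>\<U>. finite \<U> \<and> (\<forall>U\<in>\<U>. openin X U \<and> U \<noteq> {}) \<and>
      (\<forall>g\<in>C_int X. (\<forall>x. 0 \<le> g x) \<longrightarrow> 0 < laps.I g \<longrightarrow> ctrl g (B * laps.I g) \<longrightarrow>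
         (\<exists>U\<in>\<U>. \<forall>x\<in>U. laps.I g / 2 \<le> of_int (g x)))"
proof -
  \<comment> \<open>The oscillations contribute at most \<open>B * I g / s^k\<close>, which has to
    stay below half the integral.\<close>
  obtain k where k: "2 * B < s ^ k" using real_arch_pow[OF s] by blast
  define \<U> where "\<U> = cyl ` {v \<in> words k. cyl v \<noteq> {}}"
  have "\<exists>U\<in>\<U>. \<forall>x\<in>U. laps.I g / 2 \<le> of_int (g x)"
    if g: "g \<in> C_int X" "\<forall>x. 0 \<le> g x" "0 < laps.I g" "ctrl g (B * laps.I g)" for g
  proof (rule ccontr)
    assume "\<not> ?thesis"
    then have ex: "\<exists>p\<in>cyl v. of_int (g p) < laps.I g / 2" if "v \<in> words k" "cyl v \<noteq> {}" for v
      using that by (force simp: \<U>_def not_le)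
    obtain \<nu> where \<nu>: "charge \<nu>" "controls \<nu> g UNIV" "\<nu> UNIV \<le> B * laps.I g"
      using g(4) by (auto simp: ctrl_def)
    define m where "m v = laps.I (indicator (cyl v))" for v
    have m: "0 \<le> m v" for v unfolding m_def by (rule laps.I_nonneg) simp
    have le: "laps.I (\<lambda>x. g x * indicator (cyl v) x) \<le> laps.I g / 2 * m v + \<nu> (cyl_real v) / s ^ k"
      if v: "v \<in> words k" for v
    proof -
      have "laps.I (\<lambda>x. g x * indicator (cyl v) x) \<le> (laps.I g / 2 + \<nu> (cyl_real v)) * m v"
        unfolding m_def
      proof (rule laps.I_restrict(2))
        fix q assume q: "q \<in> cyl v"
        then obtain p where p: "p \<in> cyl v" "of_int (g p) < laps.I g / 2" using ex[OF v] by blast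
        have "of_int \<bar>g p - g q\<bar> \<le> \<nu> (cyl_real v)" by (rule osc_le[OF \<nu>(1,2) g(1) v p(1) q])
        then show "of_int (g q) \<le> laps.I g / 2 + \<nu> (cyl_real v)" using p(2) by linarith
      qed (use cyl_clopen[OF v] g(1) in auto)
      also have "\<nu> (cyl_real v) * m v \<le> \<nu> (cyl_real v) * (1 / s ^ k)"
        using cyl_measure_le[OF v] charge_nonneg[OF \<nu>(1)] unfolding m_def by (intro mult_left_mono) auto
      then have "(laps.I g / 2 + \<nu> (cyl_real v)) * m v \<le> laps.I g / 2 * m v + \<nu> (cyl_real v) / s ^ k"
        by (simp add: distrib_right)
      finally show ?thesis .
    qed
    have "laps.I g = (\<Sum>v\<in>words k. laps.I (\<lambda>x. g x * indicator (cyl v) x))"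
      using cyl_sum[OF g(1), of k] laps.I_sum[of "words k" "\<lambda>v x. g x * indicator (cyl v) x"]
        C_int_mult[OF g(1) C_cyl] by simp
    also have "\<dots> \<le> (\<Sum>v\<in>words k. laps.I g / 2 * m v + \<nu> (cyl_real v) / s ^ k)"
      by (rule sum_mono[OF le])
    also have "\<dots> = laps.I g / 2 * (\<Sum>v\<in>words k. m v) + (\<Sum>v\<in>words k. \<nu> (cyl_real v)) / s ^ k"
      by (simp only: sum.distrib sum_divide_distrib sum_distrib_left)
    also have "(\<Sum>v\<in>words k. m v) = 1" unfolding m_def by (rule cyl_measure_sum)
    also have "(\<Sum>v\<in>words k. \<nu> (cyl_real v)) \<le> B * laps.I g"
      using charge_UN[OF \<nu>(1) finite_words cyl_real_disjoint] charge_mono[OF \<nu>(1) subset_UNIV] \<nu>(3)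
      by (metis order_trans)
    finally have "laps.I g \<le> laps.I g / 2 + B * laps.I g / s ^ k"
      using laps.s_pos by (simp add: divide_right_mono)
    moreover have "B * laps.I g / s ^ k < laps.I g / 2"
    proof -
      have "2 * B * laps.I g < s ^ k * laps.I g" using k g(3) by simp
      then show ?thesis using laps.s_pos by (simp add: field_simps)
    qed
    ultimately show False by linarith
  qed
  moreover have "finite \<U>" using finite_words by (simp add: \<U>_def)
  moreover have "\<forall>U\<in>\<U>. openin X U \<and> U \<noteq> {}" using cyl_clopen by (auto simp: \<U>_def)
  ultimately show ?thesis by blast
qed

end

section \<open>Dimension groups modulo infinitesimals\<close>

definition cone_group :: "('a, 'b) ordered_group_scheme \<Rightarrow> bool" where
  "cone_group G \<longleftrightarrow> group G \<and> poscone G \<subseteq> carrier G"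

text \<open>Matching cones instead of orders: this form composes, inverts and passes to sums and
  quotients without computing inverses of group elements.\<close>

definition cone_iso :: "('a, 'c) ordered_group_scheme \<Rightarrow> ('b, 'd) ordered_group_scheme \<Rightarrow> ('a \<Rightarrow> 'b) set" where
  "cone_iso G H = {h \<in> iso G H. h ` poscone G = poscone H}"

lemma cone_isoI:
  assumes "\<And>x y. x \<in> carrier G \<Longrightarrow> y \<in> carrier G \<Longrightarrow> h (x \<otimes>\<^bsub>G\<^esub> y) = h x \<otimes>\<^bsub>H\<^esub> h y"
    and "bij_betw h (carrier G) (carrier H)" and "h ` poscone G = poscone H"
  shows "h \<in> cone_iso G H"
  using assms bij_betwE[OF assms(2)] by (auto simp: cone_iso_def iso_def hom_def)

text \<open>The order is membership of a quotient in the cone. A homomorphism mapping cone onto cone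
  preserves this, and injectivity makes it reflect it.\<close>

lemma cone_iso_og_iso:
  assumes "cone_group G" "cone_group H" "h \<in> cone_iso G H"
  shows "h \<in> og_iso G H"
proof -
  interpret G: group G using assms(1) by (simp add: cone_group_def)
  interpret H: group H using assms(2) by (simp add: cone_group_def)
  have iso: "h \<in> iso G H" and cone: "h ` poscone G = poscone H" using assms(3) by (auto simp: cone_iso_def)
  interpret h: group_hom G H h
    using iso by unfold_locales (auto simp: iso_def)
  have inj: "inj_on h (carrier G)" using iso by (auto simp: iso_def bij_betw_def)
  have "og_le G x y \<longleftrightarrow> og_le H (h x) (h y)" if xy: "x \<in> carrier G" "y \<in> carrier G" for x y
  proof -
    define z where "z = inv\<^bsub>G\<^esub> x \<otimes>\<^bsub>G\<^esub> y"
    have z: "z \<in> carrier G" "h z = inv\<^bsub>H\<^esub> (h x) \<otimes>\<^bsub>H\<^esub> h y" using xy by (simp_all add: z_def)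
    have "z \<in> poscone G \<longleftrightarrow> h z \<in> h ` poscone G"
      using inj z(1) assms(1) unfolding cone_group_def by (metis image_eqI inj_on_image_mem_iff)
    then show ?thesis using z(2) cone by (simp add: og_le_def z_def)
  qed
  then show ?thesis using iso by (simp add: og_iso_def)
qed

lemma cone_iso_comp: "f \<in> cone_iso G H \<Longrightarrow> g \<in> cone_iso H K \<Longrightarrow> g \<circ> f \<in> cone_iso G K"
proof (rule cone_isoI)
  assume f: "f \<in> cone_iso G H" and g: "g \<in> cone_iso H K"
  then have hom: "f \<in> hom G H" "g \<in> hom H K" by (auto simp: cone_iso_def iso_def)
  show "(g \<circ> f) (x \<otimes>\<^bsub>G\<^esub> y) = (g \<circ> f) x \<otimes>\<^bsub>K\<^esub> (g \<circ> f) y"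
    if "x \<in> carrier G" "y \<in> carrier G" for x y
    using that hom by (simp add: hom_mult hom_in_carrier)
  show "bij_betw (g \<circ> f) (carrier G) (carrier K)"
    using f g by (auto simp: cone_iso_def iso_def intro: bij_betw_trans)
  show "(g \<circ> f) ` poscone G = poscone K"
    using f g unfolding image_comp[symmetric] by (simp add: cone_iso_def)
qed

lemma cone_iso_inv:
  assumes G: "cone_group G" and f: "f \<in> cone_iso G H"
  shows "inv_into (carrier G) f \<in> cone_iso H G"
proof -
  have iso: "f \<in> iso G H" and cone: "f ` poscone G = poscone H" using f by (auto simp: cone_iso_def)
  have "inv_into (carrier G) f \<in> iso H G"
    using group.iso_set_sym[OF _ iso] G by (simp add: cone_group_def)
  moreover have "inv_into (carrier G) f ` f ` poscone G = poscone G"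
    using iso G by (intro inv_into_image_cancel) (auto simp: iso_def bij_betw_def cone_group_def)
  ultimately show ?thesis using cone by (simp add: cone_iso_def)
qed

lemma group_cong:
  assumes "group G" "carrier H = carrier G" "mult H = mult G" "one H = one G"
  shows "group H"
  using assms unfolding group_def monoid_def group_axioms_def Units_def by simp

lemma cone_group_sum:
  assumes "\<And>i. i \<in> K \<Longrightarrow> cone_group (G i)"
  shows "cone_group (og_sum K G)"
proof -
  have "group (product_group K G)" using assms by (simp add: cone_group_def)
  then have "group (og_sum K G)" by (rule group_cong) (simp_all add: og_sum_def)
  then show ?thesis using assms by (auto simp: cone_group_def og_sum_def intro!: PiE_mono)
qed

lemma image_PiE:
  assumes "\<And>i. i \<in> K \<Longrightarrow> f i ` A i = B i"
  shows "(\<lambda>x. \<lambda>i\<in>K. f i (x i)) ` (\<Pi>\<^sub>E i\<in>K. A i) = (\<Pi>\<^sub>E i\<in>K. B i)"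
proof
  show "(\<lambda>x. \<lambda>i\<in>K. f i (x i)) ` (\<Pi>\<^sub>E i\<in>K. A i) \<subseteq> (\<Pi>\<^sub>E i\<in>K. B i)"
  proof (intro image_subsetI restrict_PiE_iff[THEN iffD2] ballI)
    fix x i assume "x \<in> (\<Pi>\<^sub>E i\<in>K. A i)" "i \<in> K"
    then show "f i (x i) \<in> B i" using assms[of i] by (metis PiE_mem imageI)
  qed
  show "(\<Pi>\<^sub>E i\<in>K. B i) \<subseteq> (\<lambda>x. \<lambda>i\<in>K. f i (x i)) ` (\<Pi>\<^sub>E i\<in>K. A i)"
  proof
    fix y assume y: "y \<in> (\<Pi>\<^sub>E i\<in>K. B i)"
    have "\<exists>x. x \<in> A i \<and> f i x = y i" if i: "i \<in> K" for i
    proof -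
      have "y i \<in> f i ` A i" using assms[OF i] PiE_mem[OF y i] by simp
      then show ?thesis by auto
    qed
    then obtain x where x: "\<And>i. i \<in> K \<Longrightarrow> x i \<in> A i \<and> f i (x i) = y i" by metis
    have "y = (\<lambda>i\<in>K. f i (restrict x K i))"
    proof
      show "y i = (\<lambda>i\<in>K. f i (restrict x K i)) i" for i
        using x[of i] PiE_arb[OF y, of i] by (cases "i \<in> K") simp_all
    qed
    moreover have "restrict x K \<in> (\<Pi>\<^sub>E i\<in>K. A i)" using x by (simp add: restrict_PiE_iff)
    ultimately show "y \<in> (\<lambda>x. \<lambda>i\<in>K. f i (x i)) ` (\<Pi>\<^sub>E i\<in>K. A i)" by blast
  qed
qed

lemma bij_betw_PiE:
  assumes "\<And>i. i \<in> K \<Longrightarrow> bij_betw (f i) (A i) (B i)"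
  shows "bij_betw (\<lambda>x. \<lambda>i\<in>K. f i (x i)) (\<Pi>\<^sub>E i\<in>K. A i) (\<Pi>\<^sub>E i\<in>K. B i)"
  unfolding bij_betw_def
proof
  show "inj_on (\<lambda>x. \<lambda>i\<in>K. f i (x i)) (\<Pi>\<^sub>E i\<in>K. A i)"
  proof (rule inj_onI)
    fix x y assume x: "x \<in> (\<Pi>\<^sub>E i\<in>K. A i)" and y: "y \<in> (\<Pi>\<^sub>E i\<in>K. A i)"
      and eq: "(\<lambda>i\<in>K. f i (x i)) = (\<lambda>i\<in>K. f i (y i))"
    show "x = y"
    proof (rule PiE_ext[OF x y])
      fix i assume i: "i \<in> K"
      then have "f i (x i) = f i (y i)" using fun_cong[OF eq, of i] by simp
      then show "x i = y i" using assms[OF i] x y i by (auto simp: bij_betw_def dest: inj_onD)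
    qed
  qed
  show "(\<lambda>x. \<lambda>i\<in>K. f i (x i)) ` (\<Pi>\<^sub>E i\<in>K. A i) = (\<Pi>\<^sub>E i\<in>K. B i)"
    using assms by (intro image_PiE) (simp add: bij_betw_def)
qed

lemma cone_iso_sum:
  assumes "\<And>i. i \<in> K \<Longrightarrow> cone_group (G i)" "\<And>i. i \<in> K \<Longrightarrow> f i \<in> cone_iso (G i) (H i)"
  shows "(\<lambda>x. \<lambda>i\<in>K. f i (x i)) \<in> cone_iso (og_sum K G) (og_sum K H)"
proof (rule cone_isoI)
  have iso: "\<And>i. i \<in> K \<Longrightarrow> f i \<in> iso (G i) (H i)" "\<And>i. i \<in> K \<Longrightarrow> f i ` poscone (G i) = poscone (H i)"
    using assms(2) by (auto simp: cone_iso_def)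
  show "bij_betw (\<lambda>x. \<lambda>i\<in>K. f i (x i)) (carrier (og_sum K G)) (carrier (og_sum K H))"
    using iso(1) bij_betw_PiE[of K f "\<lambda>i. carrier (G i)" "\<lambda>i. carrier (H i)"]
    by (simp add: og_sum_def iso_def)
  show "(\<lambda>x. \<lambda>i\<in>K. f i (x i)) ` poscone (og_sum K G) = poscone (og_sum K H)"
    using image_PiE[of K f "\<lambda>i. poscone (G i)" "\<lambda>i. poscone (H i)"] iso(2) by (simp add: og_sum_def)
  show "(\<lambda>i\<in>K. f i ((x \<otimes>\<^bsub>og_sum K G\<^esub> y) i)) = (\<lambda>i\<in>K. f i (x i)) \<otimes>\<^bsub>og_sum K H\<^esub> (\<lambda>i\<in>K. f i (y i))"
    if "x \<in> carrier (og_sum K G)" "y \<in> carrier (og_sum K G)" for x y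
    using iso(1) that by (auto simp: og_sum_def iso_def hom_mult fun_eq_iff PiE_iff)
qed

text \<open>The first isomorphism theorem with order. The cone of the quotient is the image of the
  cone, so the induced map matches cones as soon as h maps cone onto cone; positivity of h alone
  would give one inclusion only.\<close>

lemma cone_quotient:
  assumes G: "cone_group G" and K: "cone_group K" and h: "h \<in> hom G K"
    and onto: "h ` carrier G = carrier K" and ker: "H = kernel G K h"
    and cone: "h ` poscone G = poscone K"
  shows "cone_group (og_quotient G H)"
    and "\<exists>\<phi> \<in> cone_iso (og_quotient G H) K. \<forall>x\<in>carrier G. \<phi> (H #>\<^bsub>G\<^esub> x) = h x"
proof -
  interpret G: group G using G by (simp add: cone_group_def)
  interpret K: group K using K by (simp add: cone_group_def)
  interpret h: group_hom G K h by unfold_locales (rule h)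
  interpret N: normal H G unfolding ker by (rule h.normal_kernel)
  \<comment> \<open>h is constant on each coset of its kernel, so the image of a coset is a
    singleton.\<close>
  define \<phi> where "\<phi> X = the_elem (h ` X)" for X
  have \<phi>: "\<phi> (H #>\<^bsub>G\<^esub> x) = h x" if x: "x \<in> carrier G" for x
  proof -
    have "h ` (H #>\<^bsub>G\<^esub> x) = {h x}"
    proof
      show "h ` (H #>\<^bsub>G\<^esub> x) \<subseteq> {h x}"
      proof
        fix z assume "z \<in> h ` (H #>\<^bsub>G\<^esub> x)"
        then obtain k where k: "k \<in> H" "z = h (k \<otimes>\<^bsub>G\<^esub> x)" unfolding r_coset_def by blast
        then show "z \<in> {h x}" using x unfolding ker kernel_def by simp
      qed
      show "{h x} \<subseteq> h ` (H #>\<^bsub>G\<^esub> x)" using G.rcos_self[OF x N.subgroup_axioms] by blast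
    qed
    then show ?thesis by (simp add: \<phi>_def)
  qed
  have sub: "poscone G \<subseteq> carrier G" using G by (simp add: cone_group_def)
  have "group (og_quotient G H)"
    by (rule group_cong[OF N.factorgroup_is_group]) (simp_all add: og_quotient_def)
  then show "cone_group (og_quotient G H)"
    using sub by (auto simp: cone_group_def og_quotient_def FactGroup_def RCOSETS_def)
  have "\<phi> \<in> iso (G Mod H) K" unfolding \<phi>_def ker by (rule h.FactGroup_iso_set[OF onto])
  then have "\<phi> \<in> iso (og_quotient G H) K" by (simp add: iso_def hom_def og_quotient_def)
  moreover have "\<phi> ` poscone (og_quotient G H) = poscone K"
  proof -
    have "\<phi> ` poscone (og_quotient G H) = (\<lambda>x. \<phi> (H #>\<^bsub>G\<^esub> x)) ` poscone G"
      by (simp add: og_quotient_def image_image)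
    also have "\<dots> = h ` poscone G" using \<phi> sub by (intro image_cong) auto
    finally show ?thesis using cone by simp
  qed
  ultimately have "\<phi> \<in> cone_iso (og_quotient G H) K" by (simp add: cone_iso_def)
  then show "\<exists>\<phi> \<in> cone_iso (og_quotient G H) K. \<forall>x\<in>carrier G. \<phi> (H #>\<^bsub>G\<^esub> x) = h x"
    using \<phi> by blast
qed

lemma real_og_group:
  assumes "0 \<in> M" "\<And>x y. x \<in> M \<Longrightarrow> y \<in> M \<Longrightarrow> x + y \<in> M" "\<And>x. x \<in> M \<Longrightarrow> - x \<in> M"
  shows "cone_group (real_og M)"
proof -
  have "group (real_og M)"
    by (rule groupI) (use assms in \<open>auto simp: real_og_def intro: bexI[of _ "- _"]\<close>)
  then show ?thesis by (auto simp: cone_group_def real_og_def)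
qed

section \<open>The dimension group and its summands\<close>

context variation_system
begin

abbreviation cls :: "('a \<Rightarrow> int) \<Rightarrow> ('a \<Rightarrow> int) set" where "cls \<equiv> DG_class X \<sigma>"

definition ev_nonneg :: "('a \<Rightarrow> int) \<Rightarrow> bool" where
  "ev_nonneg f \<longleftrightarrow> (\<exists>k. \<forall>x. 0 \<le> (L ^^ k) f x)"

lemma L_pow_split: "k \<le> m \<Longrightarrow> (L ^^ m) f = (L ^^ (m - k)) ((L ^^ k) f)"
  using funpow_add[of "m - k" k L] by simp

lemma L_pow_eq_mono: "(L ^^ k) f = (L ^^ k) g \<Longrightarrow> k \<le> m \<Longrightarrow> (L ^^ m) f = (L ^^ m) g"
  by (simp add: L_pow_split)

lemma L_pow_nonneg_mono: "\<forall>x. 0 \<le> (L ^^ k) f x \<Longrightarrow> k \<le> m \<Longrightarrow> 0 \<le> (L ^^ m) f x"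
  unfolding L_pow_split by (rule transfer_pow_nonneg) simp

lemma DG_equiv: "equiv (C_int X) (DG_rel X \<sigma>)"
proof (rule equivI)
  show "DG_rel X \<sigma> \<subseteq> C_int X \<times> C_int X" by (auto simp: DG_rel_def)
  show "refl_on (C_int X) (DG_rel X \<sigma>)" by (auto simp: refl_on_def DG_rel_def)
  show "sym (DG_rel X \<sigma>)" by (auto simp: sym_def DG_rel_def) metis
  show "trans (DG_rel X \<sigma>)"
  proof (rule transI)
    fix f g h assume "(f, g) \<in> DG_rel X \<sigma>" "(g, h) \<in> DG_rel X \<sigma>"
    then obtain k m where "f \<in> C_int X" "h \<in> C_int X" "(L ^^ k) f = (L ^^ k) g" "(L ^^ m) g = (L ^^ m) h"
      by (auto simp: DG_rel_def)
    then have "(L ^^ max k m) f = (L ^^ max k m) h"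
      using L_pow_eq_mono[of k f g "max k m"] L_pow_eq_mono[of m g h "max k m"] by simp
    then show "(f, h) \<in> DG_rel X \<sigma>" using \<open>f \<in> C_int X\<close> \<open>h \<in> C_int X\<close> by (auto simp: DG_rel_def)
  qed
qed

lemma cls_eq_iff:
  "f \<in> C_int X \<Longrightarrow> g \<in> C_int X \<Longrightarrow> cls f = cls g \<longleftrightarrow> (\<exists>k. (L ^^ k) f = (L ^^ k) g)"
  using eq_equiv_class_iff[OF DG_equiv, of f g] by (auto simp: DG_class_def DG_rel_def)

lemma in_cls: "g \<in> cls f \<longleftrightarrow> (f, g) \<in> DG_rel X \<sigma>"
  by (simp add: DG_class_def)

lemma cls_self: "f \<in> C_int X \<Longrightarrow> f \<in> cls f"
  by (auto simp: in_cls DG_rel_def)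

lemma DG_carrier: "carrier (DG X \<sigma>) = cls ` C_int X"
  by (auto simp: DG_def quotient_def DG_class_def)

text \<open>The product is a union over representatives; it is a single class because both pairs of
  representatives agree after the larger of the two exponents.\<close>

lemma DG_mult:
  assumes "f \<in> C_int X" "g \<in> C_int X"
  shows "cls f \<otimes>\<^bsub>DG X \<sigma>\<^esub> cls g = cls (\<lambda>x. f x + g x)"
proof -
  have eq: "cls (\<lambda>x. f' x + g' x) = cls (\<lambda>x. f x + g x)" if fg: "f' \<in> cls f" "g' \<in> cls g" for f' g'
  proof -
    obtain k m where km: "f' \<in> C_int X" "g' \<in> C_int X" "(L ^^ k) f = (L ^^ k) f'" "(L ^^ m) g = (L ^^ m) g'"
      using fg unfolding in_cls DG_rel_def by blast
    have *: "(L ^^ max k m) f = (L ^^ max k m) f'" "(L ^^ max k m) g = (L ^^ max k m) g'"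
      using L_pow_eq_mono[OF km(3), of "max k m"] L_pow_eq_mono[OF km(4), of "max k m"] by simp_all
    have "(L ^^ max k m) (\<lambda>x. f' x + g' x) = (L ^^ max k m) (\<lambda>x. f x + g x)"
      unfolding transfer_pow_add * ..
    then show ?thesis using cls_eq_iff[OF C_int_add[OF km(1,2)] C_int_add[OF assms]] by blast
  qed
  have "cls f \<noteq> {}" "cls g \<noteq> {}" using cls_self assms by blast+
  then have "(\<Union>f'\<in>cls f. \<Union>g'\<in>cls g. cls (\<lambda>x. f' x + g' x)) = cls (\<lambda>x. f x + g x)"
    by (simp add: eq cong: SUP_cong)
  then show ?thesis by (simp add: DG_def)
qed

lemma DG_one: "\<one>\<^bsub>DG X \<sigma>\<^esub> = cls (\<lambda>x. 0)"
  by (simp add: DG_def)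

lemma poscone_DG: "poscone (DG X \<sigma>) = cls ` {f \<in> C_int X. ev_nonneg f}"
  unfolding DG_def ev_nonneg_def by auto

lemma DG_pos:
  assumes f: "f \<in> C_int X"
  shows "cls f \<in> poscone (DG X \<sigma>) \<longleftrightarrow> ev_nonneg f"
proof
  assume "cls f \<in> poscone (DG X \<sigma>)"
  then obtain g where g: "g \<in> C_int X" "cls f = cls g" "ev_nonneg g" unfolding poscone_DG by blast
  then obtain k m where k: "\<forall>x. 0 \<le> (L ^^ k) g x" and m: "(L ^^ m) f = (L ^^ m) g"
    using cls_eq_iff[OF f g(1)] unfolding ev_nonneg_def by blast
  have "(L ^^ max k m) f = (L ^^ max k m) g" using L_pow_eq_mono[OF m, of "max k m"] by simp
  then have "\<forall>x. 0 \<le> (L ^^ max k m) f x" using L_pow_nonneg_mono[OF k, of "max k m"] by simp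
  then show "ev_nonneg f" unfolding ev_nonneg_def by blast
qed (use f in \<open>auto simp: poscone_DG\<close>)

lemma DG_pos_sub: "poscone (DG X \<sigma>) \<subseteq> carrier (DG X \<sigma>)"
  unfolding DG_carrier poscone_DG by blast

text \<open>\<open>U = topspace X\<close> gives the whole dimension group, \<open>U = Y i\<close> its summands.\<close>

definition supp_in :: "'a set \<Rightarrow> ('a \<Rightarrow> int) set" where
  "supp_in U = {f \<in> C_int X. {x. f x \<noteq> 0} \<subseteq> U}"

lemma supp_in_iff: "f \<in> supp_in U \<longleftrightarrow> f \<in> C_int X \<and> (\<forall>x. x \<notin> U \<longrightarrow> f x = 0)"
  by (auto simp: supp_in_def)

lemma supp_in_zero: "(\<lambda>x. 0) \<in> supp_in U"
  and supp_in_add: "f \<in> supp_in U \<Longrightarrow> g \<in> supp_in U \<Longrightarrow> (\<lambda>x. f x + g x) \<in> supp_in U"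
  and supp_in_minus: "f \<in> supp_in U \<Longrightarrow> (\<lambda>x. - f x) \<in> supp_in U"
  and supp_in_scale: "f \<in> supp_in U \<Longrightarrow> (\<lambda>x. c * f x) \<in> supp_in U"
  by (simp_all add: supp_in_iff C_int_zero C_int_add C_int_minus C_int_scale)

lemma supp_in_C: "f \<in> supp_in U \<Longrightarrow> f \<in> C_int X"
  by (simp add: supp_in_def)

lemma supp_in_X: "supp_in (topspace X) = C_int X"
  using C_int_outside by (auto simp: supp_in_iff)

lemma DG_part_simps:
  "carrier (DG_part X \<sigma> U) = cls ` supp_in U"
  "mult (DG_part X \<sigma> U) = mult (DG X \<sigma>)"
  "one (DG_part X \<sigma> U) = one (DG X \<sigma>)"
  "poscone (DG_part X \<sigma> U) = poscone (DG X \<sigma>) \<inter> cls ` supp_in U"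
  by (auto simp: DG_part_def Let_def supp_in_def)

lemma DG_eq_part: "DG X \<sigma> = DG_part X \<sigma> (topspace X)"
proof -
  have "carrier (DG X \<sigma>) = carrier (DG_part X \<sigma> (topspace X))"
    "poscone (DG X \<sigma>) = poscone (DG_part X \<sigma> (topspace X))"
    using DG_pos_sub by (auto simp: DG_part_simps supp_in_X DG_carrier)
  then show ?thesis
    by (intro ordered_group.equality) (simp_all add: DG_part_simps(2,3))
qed

lemma DG_part_mult: "f \<in> supp_in U \<Longrightarrow> g \<in> supp_in U \<Longrightarrow>
    cls f \<otimes>\<^bsub>DG_part X \<sigma> U\<^esub> cls g = cls (\<lambda>x. f x + g x)"
  using DG_mult supp_in_C by (simp add: DG_part_simps)

lemma DG_part_group: "group (DG_part X \<sigma> U)"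
proof (rule groupI)
  fix A assume "A \<in> carrier (DG_part X \<sigma> U)"
  then obtain f where f: "f \<in> supp_in U" "A = cls f" by (auto simp: DG_part_simps)
  show "\<one>\<^bsub>DG_part X \<sigma> U\<^esub> \<otimes>\<^bsub>DG_part X \<sigma> U\<^esub> A = A"
    using DG_part_mult[OF supp_in_zero f(1)] f(2) by (simp add: DG_part_simps DG_one)
  show "\<exists>B\<in>carrier (DG_part X \<sigma> U). B \<otimes>\<^bsub>DG_part X \<sigma> U\<^esub> A = \<one>\<^bsub>DG_part X \<sigma> U\<^esub>"
    using DG_part_mult[OF supp_in_minus[OF f(1)] f(1)] f supp_in_minus
    by (intro bexI[of _ "cls (\<lambda>x. - f x)"]) (auto simp: DG_part_simps DG_one)
next
  fix A B assume "A \<in> carrier (DG_part X \<sigma> U)" "B \<in> carrier (DG_part X \<sigma> U)"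
  then obtain f g where fg: "f \<in> supp_in U" "A = cls f" "g \<in> supp_in U" "B = cls g"
    by (auto simp: DG_part_simps)
  show "A \<otimes>\<^bsub>DG_part X \<sigma> U\<^esub> B \<in> carrier (DG_part X \<sigma> U)"
    using DG_part_mult[OF fg(1,3)] supp_in_add[OF fg(1,3)] fg(2,4) by (simp add: DG_part_simps(1))
  fix C assume "C \<in> carrier (DG_part X \<sigma> U)"
  then obtain h where h: "h \<in> supp_in U" "C = cls h" by (auto simp: DG_part_simps)
  show "A \<otimes>\<^bsub>DG_part X \<sigma> U\<^esub> B \<otimes>\<^bsub>DG_part X \<sigma> U\<^esub> C = A \<otimes>\<^bsub>DG_part X \<sigma> U\<^esub> (B \<otimes>\<^bsub>DG_part X \<sigma> U\<^esub> C)"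
    using fg h by (simp add: DG_part_mult supp_in_add add.assoc)
qed (auto simp: DG_part_simps DG_one supp_in_zero)

lemma DG_part_cone: "cone_group (DG_part X \<sigma> U)"
  using DG_part_group by (simp add: cone_group_def DG_part_simps)

lemma DG_part_inv:
  assumes "f \<in> supp_in U"
  shows "inv\<^bsub>DG_part X \<sigma> U\<^esub> cls f = cls (\<lambda>x. - f x)"
proof (rule group.inv_equality[OF DG_part_group])
  show "cls (\<lambda>x. - f x) \<otimes>\<^bsub>DG_part X \<sigma> U\<^esub> cls f = \<one>\<^bsub>DG_part X \<sigma> U\<^esub>"
    using DG_part_mult[OF supp_in_minus[OF assms] assms] by (simp add: DG_part_simps DG_one)
qed (use assms supp_in_minus in \<open>auto simp: DG_part_simps\<close>)

lemma DG_part_pow: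
  assumes "f \<in> supp_in U"
  shows "cls f [^]\<^bsub>DG_part X \<sigma> U\<^esub> (k::nat) = cls (\<lambda>x. int k * f x)"
proof -
  interpret group "DG_part X \<sigma> U" by (rule DG_part_group)
  show ?thesis
  proof (induction k)
    case 0
    then show ?case by (simp add: DG_part_simps DG_one)
  next
    case (Suc k)
    then show ?case using DG_part_mult[OF supp_in_scale[OF assms] assms]
      by (simp add: nat_pow_Suc distrib_right add.commute)
  qed
qed

lemma DG_part_le:
  assumes "f \<in> supp_in U" "g \<in> supp_in U"
  shows "og_le (DG_part X \<sigma> U) (cls f) (cls g) \<longleftrightarrow> ev_nonneg (\<lambda>x. g x - f x)"
proof -
  have s: "(\<lambda>x. - f x + g x) \<in> supp_in U" by (intro supp_in_add supp_in_minus assms)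
  have "inv\<^bsub>DG_part X \<sigma> U\<^esub> cls f \<otimes>\<^bsub>DG_part X \<sigma> U\<^esub> cls g = cls (\<lambda>x. - f x + g x)"
    using assms by (simp add: DG_part_inv DG_part_mult supp_in_minus)
  then show ?thesis using s DG_pos[OF supp_in_C[OF s]] by (simp add: og_le_def DG_part_simps)
qed

section \<open>Integrals over the pieces, positivity and infinitesimals\<close>

definition mean :: "('a \<Rightarrow> int) \<Rightarrow> nat \<Rightarrow> real" where
  "mean f = (\<lambda>i\<in>{1..N}. I (restr i f))"

lemma mean_eq: "i \<in> {1..N} \<Longrightarrow> mean f i = I (restr i f)"
  by (simp add: mean_def)

lemma I_restr_add: "i \<in> {1..N} \<Longrightarrow> f \<in> C_int X \<Longrightarrow> g \<in> C_int X \<Longrightarrow>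
    I (restr i (\<lambda>x. f x + g x)) = I (restr i f) + I (restr i g)"
  using I_add[OF C_restr C_restr, of i f i g] by (simp add: restr_def distrib_right)

lemma I_restr_scale: "I (restr i (\<lambda>x. c * f x)) = of_int c * I (restr i f)"
  using I_scale[of c "restr i f"] by (simp add: restr_def mult.assoc)

text \<open>Transfer moves the i-th part of f to another piece and multiplies its integral by a
  positive number.\<close>

lemma ev_nonneg_imp:
  assumes f: "f \<in> C_int X" "ev_nonneg f" and i: "i \<in> {1..N}"
  shows "0 \<le> I (restr i f)"
proof -
  obtain k where "\<forall>x. 0 \<le> (L ^^ k) f x" using f(2) by (auto simp: ev_nonneg_def)
  then have "0 \<le> I ((L ^^ k) (restr i f))"
    unfolding L_pow_restr[OF i] by (intro I_nonneg restr_nonneg) blast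
  then have "0 \<le> s ^ k * I (restr i f)" using I_L_pow[OF C_restr[OF i f(1)], of k] by simp
  moreover have "0 < s ^ k" using s_pos by simp
  ultimately show ?thesis using mult_pos_neg[of "s ^ k" "I (restr i f)"] by linarith
qed

text \<open>Each part becomes nonnegative after its own number of steps and stays so; the sum of
  these numbers serves all parts. A part with integral 0 is required to vanish, because its integral
  alone would not yield eventual positivity.\<close>

lemma ev_nonnegI:
  assumes f: "f \<in> C_int X" and pos: "\<And>i. i \<in> {1..N} \<Longrightarrow> 0 < I (restr i f) \<or> restr i f = (\<lambda>x. 0)"
  shows "ev_nonneg f"
proof -
  have "\<exists>k. \<forall>x. 0 \<le> (L ^^ k) (restr i f) x" if i: "i \<in> {1..N}" for i
  proof (cases "restr i f = (\<lambda>x. 0)")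
    case True
    then show ?thesis by (simp add: transfer_pow_zero)
  next
    case False
    then show ?thesis using pos[OF i] eventually_nonneg[OF i C_restr[OF i f] restr_supp] by blast
  qed
  then obtain k where k: "\<And>i. i \<in> {1..N} \<Longrightarrow> \<forall>x. 0 \<le> (L ^^ k i) (restr i f) x" by metis
  define m where "m = (\<Sum>i\<in>{1..N}. k i)"
  have nonneg: "0 \<le> (L ^^ m) (restr i f) x" if i: "i \<in> {1..N}" for i x
    by (rule L_pow_nonneg_mono[OF k[OF i]]) (use i in \<open>auto simp: m_def intro: member_le_sum\<close>)
  have "(L ^^ m) f = (\<lambda>x. \<Sum>i\<in>{1..N}. (L ^^ m) (restr i f) x)"
    using arg_cong[OF restr_sum[OF f], of "L ^^ m"] unfolding transfer_pow_sum .
  moreover have "0 \<le> (\<Sum>i\<in>{1..N}. (L ^^ m) (restr i f) x)" for x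
    by (rule sum_nonneg) (rule nonneg)
  ultimately have "\<forall>x. 0 \<le> (L ^^ m) f x" by simp
  then show ?thesis by (auto simp: ev_nonneg_def)
qed

lemma mean_cong:
  assumes "f \<in> C_int X" "g \<in> C_int X" "cls f = cls g"
  shows "mean f = mean g"
proof -
  obtain k where k: "(L ^^ k) f = (L ^^ k) g" using assms cls_eq_iff by blast
  have "I (restr i f) = I (restr i g)" if i: "i \<in> {1..N}" for i
  proof -
    have "s ^ k * I (restr i f) = s ^ k * I (restr i g)"
      using I_L_pow[OF C_restr[OF i assms(1)], of k] I_L_pow[OF C_restr[OF i assms(2)], of k]
      by (simp add: L_pow_restr[OF i] k)
    then show ?thesis using s_pos by simp
  qed
  then show ?thesis by (auto simp: mean_def)
qed

text \<open>For an infinitesimal class the integrals of all multiples over a piece stay bounded,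
  hence vanish. Conversely \<open>c * f + indicator U\<close> has positive integral over each piece
  inside U and vanishes on the others, so it is eventually nonnegative for every c.\<close>

lemma infinitesimal_iff:
  assumes f: "f \<in> supp_in U" and U: "openin X U" "closedin X U"
    and U': "\<And>i. i \<in> {1..N} \<Longrightarrow> Y i \<subseteq> U \<or> Y i \<inter> U = {}"
  shows "cls f \<in> infinitesimals (DG_part X \<sigma> U) (cls (indicator U)) \<longleftrightarrow> (\<forall>i\<in>{1..N}. I (restr i f) = 0)"
proof -
  have e: "indicator U \<in> supp_in U"
    using C_int_indicator[OF U] by (auto simp: supp_in_def indicator_def split: if_splits)
  have Cf: "f \<in> C_int X" and Ce: "indicator U \<in> C_int X" using supp_in_C f e by blast+
  have iff: "cls f \<in> infinitesimals (DG_part X \<sigma> U) (cls (indicator U)) \<longleftrightarrow>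
    (\<forall>k. ev_nonneg (\<lambda>x. int k * f x + indicator U x) \<and> ev_nonneg (\<lambda>x. indicator U x + (- int k) * f x))"
    using f e supp_in_scale[OF f] supp_in_minus[OF e]
    by (simp add: infinitesimals_def DG_part_pow DG_part_inv DG_part_le DG_part_simps(1))
  have I_comb: "I (restr i (\<lambda>x. c * f x + indicator U x)) = of_int c * I (restr i f) + I (restr i (indicator U))"
    if "i \<in> {1..N}" for i c
    using I_restr_add[OF that C_int_scale[OF Cf] Ce] by (simp add: I_restr_scale)
  have I_comb': "I (restr i (\<lambda>x. indicator U x + c * f x)) = of_int c * I (restr i f) + I (restr i (indicator U))"
    if "i \<in> {1..N}" for i c
    using I_comb[OF that, of c] by (simp add: add.commute)
  show ?thesis unfolding iff
  proof
    assume small: "\<forall>k. ev_nonneg (\<lambda>x. int k * f x + indicator U x) \<and>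
      ev_nonneg (\<lambda>x. indicator U x + (- int k) * f x)"
    show "\<forall>i\<in>{1..N}. I (restr i f) = 0"
    proof (rule ballI, rule ccontr)
      fix i assume i: "i \<in> {1..N}" and ne: "I (restr i f) \<noteq> 0"
      have bound: "\<bar>real k * I (restr i f)\<bar> \<le> I (restr i (indicator U))" for k
      proof -
        have "0 \<le> I (restr i (\<lambda>x. int k * f x + indicator U x))"
          "0 \<le> I (restr i (\<lambda>x. indicator U x + (- int k) * f x))"
          using small ev_nonneg_imp[OF _ _ i] Cf Ce C_int_add C_int_scale by blast+
        then show ?thesis unfolding I_comb[OF i] I_comb'[OF i] by (simp add: abs_le_iff)
      qed
      obtain k where "I (restr i (indicator U)) < real k * \<bar>I (restr i f)\<bar>"
        using reals_Archimedean3[of "\<bar>I (restr i f)\<bar>"] ne by auto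
      then show False using bound[of k] by (simp add: abs_mult)
    qed
  next
    assume zero: "\<forall>i\<in>{1..N}. I (restr i f) = 0"
    have alt: "0 < I (restr i (indicator U)) \<or>
      (restr i f = (\<lambda>x. 0) \<and> restr i (indicator U) = (\<lambda>x. 0))" if i: "i \<in> {1..N}" for i
    proof (cases "Y i \<subseteq> U")
      case True
      then have "restr i (indicator U) = indicator (Y i)" by (auto simp: restr_def indicator_def fun_eq_iff)
      then show ?thesis using I_Y_pos[OF i] by simp
    next
      case False
      then have "Y i \<inter> U = {}" using U'[OF i] by blast
      then have "x \<notin> Y i \<or> (f x = 0 \<and> x \<notin> U)" for x using f by (auto simp: supp_in_def)
      then show ?thesis by (auto simp: restr_def fun_eq_iff indicator_def)
    qed
    have "ev_nonneg (\<lambda>x. c * f x + indicator U x)" for c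
    proof (rule ev_nonnegI)
      show "(\<lambda>x. c * f x + indicator U x) \<in> C_int X" by (intro C_int_add C_int_scale Cf Ce)
      fix i assume i: "i \<in> {1..N}"
      have "restr i (\<lambda>x. c * f x + indicator U x) = (\<lambda>x. c * restr i f x + restr i (indicator U) x)"
        by (auto simp: restr_def fun_eq_iff distrib_right)
      then show "0 < I (restr i (\<lambda>x. c * f x + indicator U x)) \<or>
        restr i (\<lambda>x. c * f x + indicator U x) = (\<lambda>x. 0)"
        using alt[OF i] I_comb[OF i, of c] zero i by auto
    qed
    then show "\<forall>k. ev_nonneg (\<lambda>x. int k * f x + indicator U x) \<and>
      ev_nonneg (\<lambda>x. indicator U x + (- int k) * f x)"
      by (metis (no_types, lifting) add.commute ext)
  qed
qed

lemma DG_part_pos: "f \<in> supp_in U \<Longrightarrow> cls f \<in> poscone (DG_part X \<sigma> U) \<longleftrightarrow> ev_nonneg f"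
  using DG_pos supp_in_C by (simp add: DG_part_simps)

lemma DG_part_poscone: "poscone (DG_part X \<sigma> U) = cls ` {f \<in> supp_in U. ev_nonneg f}"
proof (intro equalityI subsetI)
  fix A assume A: "A \<in> poscone (DG_part X \<sigma> U)"
  then obtain f where f: "f \<in> supp_in U" "A = cls f" unfolding DG_part_simps by blast
  then have "ev_nonneg f" using A DG_part_pos by simp
  then show "A \<in> cls ` {f \<in> supp_in U. ev_nonneg f}" using f by blast
qed (auto simp: DG_part_pos)

lemma restr_in: "i \<in> {1..N} \<Longrightarrow> f \<in> C_int X \<Longrightarrow> restr i f \<in> supp_in (Y i)"
  using C_restr restr_supp by (simp add: supp_in_def)

lemma supp_in_restr: "f \<in> supp_in (Y i) \<Longrightarrow> restr i f = f"
  using restr_id by (simp add: supp_in_def)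

lemma restr_other: "i \<in> {1..N} \<Longrightarrow> j \<in> {1..N} \<Longrightarrow> j \<noteq> i \<Longrightarrow> f \<in> supp_in (Y i) \<Longrightarrow> restr j f = (\<lambda>x. 0)"
  using restr_restr[of j i f] supp_in_restr[of f i] by simp

text \<open>Representatives of a class agree after some transfer, and the power of s cancels. Hence
  the description in \<open>class_integral\<close> has exactly one value.\<close>

lemma class_integral_cls:
  assumes f: "f \<in> C_int X"
  shows "class_integral \<mu> (cls f) = I f"
  unfolding class_integral_def
proof (rule the_equality)
  show "\<exists>g\<in>cls f. I f = (\<integral>x. of_int (g x) \<partial>\<mu>)" using cls_self[OF f] by (auto simp: I_def)
  fix r :: real assume "\<exists>g\<in>cls f. r = (\<integral>x. of_int (g x) \<partial>\<mu>)"
  then obtain g where g: "g \<in> cls f" "r = I g" by (auto simp: I_def)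
  then obtain k where k: "g \<in> C_int X" "(L ^^ k) f = (L ^^ k) g" unfolding in_cls DG_rel_def by blast
  have "s ^ k * I f = s ^ k * I g"
    unfolding I_L_pow[OF f, symmetric] I_L_pow[OF k(1), symmetric] k(2) ..
  moreover have "s ^ k \<noteq> 0" using s_pos by simp
  ultimately have "I f = I g" using mult_left_cancel[of "s ^ k" "I f" "I g"] by blast
  then show "r = I f" using g(2) by simp
qed

section \<open>The groups of integrals and the scaled shift\<close>

definition M :: "nat \<Rightarrow> real set" where "M i = I ` supp_in (Y i)"

lemma mu_part_eq: "mu_part X \<sigma> \<mu> (Y i) = real_og (M i)"
proof -
  have "class_integral \<mu> ` cls ` supp_in (Y i) = M i"
    unfolding M_def image_image using class_integral_cls supp_in_C by (intro image_cong) auto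
  then show ?thesis by (simp add: mu_part_def DG_part_simps)
qed

lemma M_group: "cone_group (real_og (M i))"
proof (rule real_og_group)
  show "0 \<in> M i"
    unfolding M_def by (rule image_eqI[of _ _ "\<lambda>x. 0"]) (simp_all add: I_zero supp_in_zero)
  fix x y assume "x \<in> M i" "y \<in> M i"
  then obtain f g where "f \<in> supp_in (Y i)" "g \<in> supp_in (Y i)" "x = I f" "y = I g" by (auto simp: M_def)
  then show "x + y \<in> M i"
    unfolding M_def using I_add[of f g] supp_in_C supp_in_add by (intro image_eqI[of _ _ "\<lambda>x. f x + g x"]) auto
next
  fix x assume "x \<in> M i"
  then obtain f where "f \<in> supp_in (Y i)" "x = I f" by (auto simp: M_def)
  then show "- x \<in> M i"
    unfolding M_def using I_scale[of "-1" f] supp_in_scale[of f "Y i" "-1"]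
    by (intro image_eqI[of _ _ "\<lambda>x. - 1 * f x"]) auto
qed

text \<open>\<open>L\<close> carries functions on a piece to functions on the next one and
  multiplies integrals by s; surjectivity of \<open>L\<close> gives the reverse inclusion.\<close>

lemma M_shift:
  assumes i: "i \<in> {1..N}"
  shows "M (succ i) = (*) s ` M i"
proof
  show "(*) s ` M i \<subseteq> M (succ i)"
  proof
    fix r assume "r \<in> (*) s ` M i"
    then obtain f where f: "f \<in> supp_in (Y i)" "r = s * I f" by (auto simp: M_def)
    have "L f = restr (succ i) (L f)" using L_restr[OF i, of f] supp_in_restr[OF f(1)] by simp
    then have "L f \<in> supp_in (Y (succ i))"
      using restr_in[OF succ_in C_L[OF supp_in_C[OF f(1)]], of i] by simp
    moreover have "r = I (L f)" using f(2) I_L[OF supp_in_C[OF f(1)]] by simp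
    ultimately show "r \<in> M (succ i)" unfolding M_def by blast
  qed
  show "M (succ i) \<subseteq> (*) s ` M i"
  proof
    fix r assume "r \<in> M (succ i)"
    then obtain f where f: "f \<in> supp_in (Y (succ i))" "r = I f" by (auto simp: M_def)
    obtain g where g: "g \<in> C_int X" "L g = f" using L_surj[OF supp_in_C[OF f(1)] \<sigma>_onto] .
    have "L (restr i g) = f" using L_restr[OF i, of g] g(2) supp_in_restr[OF f(1)] by simp
    then have "r = s * I (restr i g)" using I_L[OF C_restr[OF i g(1)]] f(2) by simp
    then show "r \<in> (*) s ` M i" using restr_in[OF i g(1)] by (auto simp: M_def)
  qed
qed

abbreviation "mu_sum \<equiv> og_sum {1..N} (\<lambda>i. mu_part X \<sigma> \<mu> (Y i))"
abbreviation "part_sum \<equiv> og_sum {1..N} (\<lambda>i. DG_part_mod_inf X \<sigma> (Y i))"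

lemma mu_sum_simps:
  "carrier mu_sum = (\<Pi>\<^sub>E i\<in>{1..N}. M i)"
  "x \<otimes>\<^bsub>mu_sum\<^esub> y = (\<lambda>i\<in>{1..N}. x i + y i)"
  "\<one>\<^bsub>mu_sum\<^esub> = (\<lambda>i\<in>{1..N}. 0)"
  "poscone mu_sum = (\<Pi>\<^sub>E i\<in>{1..N}. {r \<in> M i. 0 \<le> r})"
  by (simp_all add: og_sum_def mu_part_eq real_og_def)

lemma mu_sum_group: "cone_group mu_sum"
  unfolding mu_part_eq by (intro cone_group_sum M_group)

lemma shift_iso: "scaled_shift N s \<in> cone_iso mu_sum mu_sum"
proof (rule cone_isoI)
  define pred where "pred i = (if i = 1 then N else i - 1)" for i
  have pred: "pred i \<in> {1..N}" "succ (pred i) = i" "pred (succ i) = i" if "i \<in> {1..N}" for i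
    using that succ_pred[OF that] pred_succ[OF that] by (auto simp: pred_def)
  have shift: "scaled_shift N s l = (\<lambda>i\<in>{1..N}. s * l (pred i))" for l
    by (simp add: scaled_shift_def pred_def)
  \<comment> \<open>A general family A is used so that the argument serves twice: for the groups
    \<open>M i\<close> and for their nonnegative parts.\<close>
  have image: "scaled_shift N s ` (\<Pi>\<^sub>E i\<in>{1..N}. A i) = (\<Pi>\<^sub>E i\<in>{1..N}. A i)"
    if A: "\<And>i. i \<in> {1..N} \<Longrightarrow> A (succ i) = (*) s ` A i" for A
  proof
    show "scaled_shift N s ` (\<Pi>\<^sub>E i\<in>{1..N}. A i) \<subseteq> (\<Pi>\<^sub>E i\<in>{1..N}. A i)"
    proof (intro image_subsetI, unfold shift, intro restrict_PiE_iff[THEN iffD2] ballI)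
      fix l i assume l: "l \<in> (\<Pi>\<^sub>E i\<in>{1..N}. A i)" and i: "i \<in> {1..N}"
      have "l (pred i) \<in> A (pred i)" using PiE_mem[OF l pred(1)[OF i]] .
      then have "s * l (pred i) \<in> A (succ (pred i))" unfolding A[OF pred(1)[OF i]] by blast
      then show "s * l (pred i) \<in> A i" unfolding pred(2)[OF i] .
    qed
    show "(\<Pi>\<^sub>E i\<in>{1..N}. A i) \<subseteq> scaled_shift N s ` (\<Pi>\<^sub>E i\<in>{1..N}. A i)"
    proof
      fix r assume r: "r \<in> (\<Pi>\<^sub>E i\<in>{1..N}. A i)"
      define l where "l = (\<lambda>i\<in>{1..N}. r (succ i) / s)"
      have "r (succ i) / s \<in> A i" if i: "i \<in> {1..N}" for i
        using PiE_mem[OF r succ_in, of i] A[OF i] s_pos by auto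
      then have "l \<in> (\<Pi>\<^sub>E i\<in>{1..N}. A i)" unfolding l_def by (simp add: restrict_PiE_iff)
      moreover have "r = scaled_shift N s l"
      proof
        show "r i = scaled_shift N s l i" for i
          using pred[of i] s_pos PiE_arb[OF r, of i] by (cases "i \<in> {1..N}") (auto simp: shift l_def)
      qed
      ultimately show "r \<in> scaled_shift N s ` (\<Pi>\<^sub>E i\<in>{1..N}. A i)" by blast
    qed
  qed
  have "inj_on (scaled_shift N s) (\<Pi>\<^sub>E i\<in>{1..N}. M i)"
  proof (rule inj_onI)
    fix l m assume l: "l \<in> (\<Pi>\<^sub>E i\<in>{1..N}. M i)" and m: "m \<in> (\<Pi>\<^sub>E i\<in>{1..N}. M i)"
      and eq: "scaled_shift N s l = scaled_shift N s m"
    show "l = m"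
    proof (rule PiE_ext[OF l m])
      fix i assume i: "i \<in> {1..N}"
      have "s * l i = s * m i" using fun_cong[OF eq, of "succ i"] succ_in[of i] pred(3)[OF i] by (simp add: shift)
      then show "l i = m i" using s_pos by simp
    qed
  qed
  then show "bij_betw (scaled_shift N s) (carrier mu_sum) (carrier mu_sum)"
    unfolding bij_betw_def mu_sum_simps(1) using image[of M] M_shift by blast
  show "scaled_shift N s ` poscone mu_sum = poscone mu_sum"
    unfolding mu_sum_simps(4)
  proof (rule image)
    fix i assume i: "i \<in> {1..N}"
    show "{r \<in> M (succ i). 0 \<le> r} = (*) s ` {r \<in> M i. 0 \<le> r}"
      unfolding M_shift[OF i] using s_pos by (auto simp: zero_le_mult_iff)
  qed
  show "scaled_shift N s (x \<otimes>\<^bsub>mu_sum\<^esub> y) = scaled_shift N s x \<otimes>\<^bsub>mu_sum\<^esub> scaled_shift N s y" for x y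
    unfolding mu_sum_simps(2) shift using pred(1) by (intro ext) (auto simp: distrib_left)
qed

lemma mean_glue:
  assumes f: "\<And>i. i \<in> {1..N} \<Longrightarrow> f i \<in> supp_in (Y i)"
  shows "\<exists>g\<in>C_int X. \<forall>i\<in>{1..N}. restr i g = f i"
proof (intro bexI ballI)
  show "(\<lambda>x. \<Sum>i\<in>{1..N}. f i x) \<in> C_int X" using f supp_in_C by (intro C_int_sum) blast
  fix j assume j: "j \<in> {1..N}"
  show "restr j (\<lambda>x. \<Sum>i\<in>{1..N}. f i x) = f j"
  proof
    fix x
    have "restr j (\<lambda>x. \<Sum>i\<in>{1..N}. f i x) x = (\<Sum>i\<in>{1..N}. restr j (f i) x)"
      by (simp add: restr_def sum_distrib_right)
    also have "\<dots> = (\<Sum>i\<in>{j}. restr j (f i) x)"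
    proof (rule sum.mono_neutral_right)
      show "\<forall>i\<in>{1..N} - {j}. restr j (f i) x = 0"
      proof
        fix i assume i: "i \<in> {1..N} - {j}"
        then have "restr j (f i) = (\<lambda>x. 0)" by (intro restr_other[OF _ j _ f]) auto
        then show "restr j (f i) x = 0" by simp
      qed
    qed (use j in auto)
    finally show "restr j (\<lambda>x. \<Sum>i\<in>{1..N}. f i x) x = f j x" using supp_in_restr[OF f[OF j]] by simp
  qed
qed

lemma mean_in: "f \<in> C_int X \<Longrightarrow> mean f \<in> carrier mu_sum"
  unfolding mu_sum_simps mean_def M_def by (simp add: restrict_PiE_iff restr_in)

text \<open>This is \<Psi> before passing to the quotient; by \<open>mean_cong\<close> the chosen
  representative does not matter.\<close>

definition class_mean :: "('a \<Rightarrow> int) set \<Rightarrow> nat \<Rightarrow> real" where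
  "class_mean A = mean (SOME f. f \<in> C_int X \<and> A = cls f)"

lemma class_mean_cls:
  assumes f: "f \<in> C_int X"
  shows "class_mean (cls f) = mean f"
proof -
  define g where "g = (SOME g. g \<in> C_int X \<and> cls f = cls g)"
  have "g \<in> C_int X \<and> cls f = cls g" unfolding g_def by (rule someI[of _ f]) (use f in simp)
  then have "mean g = mean f" using mean_cong[OF f, of g] by (metis (no_types))
  then show ?thesis unfolding class_mean_def g_def .
qed

section \<open>Kernels of the integrals and the isomorphisms\<close>

lemma Y_cases: "i \<in> {1..N} \<Longrightarrow> j \<in> {1..N} \<Longrightarrow> Y i \<subseteq> Y j \<or> Y i \<inter> Y j = {}"
  using Y_unique by blast

lemma DG_inf_iff:
  assumes "f \<in> C_int X"
  shows "cls f \<in> DG_inf X \<sigma> \<longleftrightarrow> mean f = \<one>\<^bsub>mu_sum\<^esub>"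
proof -
  have "cls f \<in> DG_inf X \<sigma> \<longleftrightarrow> (\<forall>i\<in>{1..N}. I (restr i f) = 0)"
    unfolding DG_inf_def using infinitesimal_iff[of f "topspace X"] assms Y_props(5)
    by (simp add: DG_eq_part supp_in_X)
  also have "\<dots> \<longleftrightarrow> mean f = \<one>\<^bsub>mu_sum\<^esub>"
    unfolding mu_sum_simps mean_def by (auto simp: restrict_def fun_eq_iff)
  finally show ?thesis .
qed

lemma DG_part_inf_iff:
  assumes i: "i \<in> {1..N}" and f: "f \<in> supp_in (Y i)"
  shows "cls f \<in> DG_part_inf X \<sigma> (Y i) \<longleftrightarrow> I f = 0"
proof -
  have "cls f \<in> DG_part_inf X \<sigma> (Y i) \<longleftrightarrow> (\<forall>j\<in>{1..N}. I (restr j f) = 0)"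
    unfolding DG_part_inf_def using infinitesimal_iff[OF f Y_props(2,3)[OF i]] Y_cases[OF _ i] by blast
  also have "\<dots> \<longleftrightarrow> I f = 0"
    using restr_other[OF i _ _ f] supp_in_restr[OF f] i I_zero by metis
  finally show ?thesis .
qed

text \<open>\<open>class_mean\<close> is onto, its kernel consists of the infinitesimals, and it
  maps cone onto cone, so the quotient theorem applies. Lifting a nonnegative vector to a positive
  class is where eventual positivity enters.\<close>

lemma \<Psi>_exists:
  "cone_group (DG_mod_inf X \<sigma>) \<and> (\<exists>\<Psi>\<in>cone_iso (DG_mod_inf X \<sigma>) mu_sum.
     \<forall>f\<in>C_int X. \<Psi> (mod_inf_class X \<sigma> f) = mean f)"
proof -
  have G: "cone_group (DG X \<sigma>)" unfolding DG_eq_part by (rule DG_part_cone)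
  have hom: "class_mean \<in> hom (DG X \<sigma>) mu_sum"
  proof (rule homI)
    fix A assume "A \<in> carrier (DG X \<sigma>)"
    then show "class_mean A \<in> carrier mu_sum" using class_mean_cls mean_in unfolding DG_carrier by auto
  next
    fix A B assume "A \<in> carrier (DG X \<sigma>)" "B \<in> carrier (DG X \<sigma>)"
    then obtain f g where fg: "f \<in> C_int X" "g \<in> C_int X" "A = cls f" "B = cls g" unfolding DG_carrier by blast
    have "mean (\<lambda>x. f x + g x) = (\<lambda>i\<in>{1..N}. mean f i + mean g i)"
      unfolding mean_def using I_restr_add[OF _ fg(1,2)] by (intro ext) simp
    then show "class_mean (A \<otimes>\<^bsub>DG X \<sigma>\<^esub> B) = class_mean A \<otimes>\<^bsub>mu_sum\<^esub> class_mean B"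
      by (simp only: fg(3,4) DG_mult[OF fg(1,2)] class_mean_cls[OF C_int_add[OF fg(1,2)]]
          class_mean_cls[OF fg(1)] class_mean_cls[OF fg(2)] mu_sum_simps(2))
  qed
  \<comment> \<open>The preimage is chosen to be 0 on pieces with r i = 0, since a function with
    vanishing integral need not be eventually nonnegative.\<close>
  have glue: "\<exists>f\<in>C_int X. mean f = r \<and> (\<forall>i\<in>{1..N}. r i = 0 \<longrightarrow> restr i f = (\<lambda>x. 0))"
    if r: "r \<in> (\<Pi>\<^sub>E i\<in>{1..N}. M i)" for r
  proof -
    define P where "P i g \<longleftrightarrow> g \<in> supp_in (Y i) \<and> r i = I g \<and> (r i = 0 \<longrightarrow> g = (\<lambda>x. 0))" for i g
    define g where "g i = (SOME g. P i g)" for i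
    have "P i (g i)" if i: "i \<in> {1..N}" for i
    proof -
      have "\<exists>g. P i g"
      proof (cases "r i = 0")
        case True
        then have "P i (\<lambda>x. 0)" by (simp add: P_def I_zero supp_in_zero)
        then show ?thesis by blast
      next
        case False
        have "r i \<in> I ` supp_in (Y i)" using PiE_mem[OF r i] unfolding M_def .
        then show ?thesis using False unfolding P_def by blast
      qed
      then show ?thesis unfolding g_def by (rule someI_ex)
    qed
    then have g: "\<And>i. i \<in> {1..N} \<Longrightarrow> g i \<in> supp_in (Y i)" "\<And>i. i \<in> {1..N} \<Longrightarrow> r i = I (g i)"
      "\<And>i. i \<in> {1..N} \<Longrightarrow> r i = 0 \<Longrightarrow> g i = (\<lambda>x. 0)" unfolding P_def by blast+
    from mean_glue[of g, OF g(1)]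
    obtain f where f: "f \<in> C_int X" "\<forall>i\<in>{1..N}. restr i f = g i" by (rule bexE)
    have "mean f = r"
    proof
      show "mean f i = r i" for i
      proof (cases "i \<in> {1..N}")
        case True
        then show ?thesis using f(2) g(2) mean_eq by simp
      next
        case False
        then show ?thesis using PiE_arb[OF r False] unfolding mean_def restrict_apply by (simp only: if_False)
      qed
    qed
    then show ?thesis using f g(3) by (intro bexI[of _ f]) simp_all
  qed
  have onto: "class_mean ` carrier (DG X \<sigma>) = carrier mu_sum"
  proof
    show "class_mean ` carrier (DG X \<sigma>) \<subseteq> carrier mu_sum" using hom by (auto simp: hom_def)
    show "carrier mu_sum \<subseteq> class_mean ` carrier (DG X \<sigma>)"
      using glue class_mean_cls unfolding DG_carrier mu_sum_simps by (metis imageI subsetI)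
  qed
  have ker: "DG_inf X \<sigma> = kernel (DG X \<sigma>) mu_sum class_mean"
  proof -
    have "DG_inf X \<sigma> \<subseteq> carrier (DG X \<sigma>)" by (auto simp: DG_inf_def infinitesimals_def)
    then show ?thesis using DG_inf_iff class_mean_cls unfolding kernel_def DG_carrier by auto
  qed
  have cone: "class_mean ` poscone (DG X \<sigma>) = poscone mu_sum"
  proof
    show "class_mean ` poscone (DG X \<sigma>) \<subseteq> poscone mu_sum"
    proof
      fix r assume "r \<in> class_mean ` poscone (DG X \<sigma>)"
      then obtain f where f: "f \<in> C_int X" "ev_nonneg f" "r = mean f"
        using class_mean_cls unfolding poscone_DG by auto
      then show "r \<in> poscone mu_sum" unfolding mu_sum_simps
        using ev_nonneg_imp[OF f(1,2)] restr_in by (auto simp: mean_def M_def)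
    qed
    show "poscone mu_sum \<subseteq> class_mean ` poscone (DG X \<sigma>)"
    proof
      fix r assume r: "r \<in> poscone mu_sum"
      then have r': "r \<in> (\<Pi>\<^sub>E i\<in>{1..N}. M i)" "\<And>i. i \<in> {1..N} \<Longrightarrow> 0 \<le> r i"
        unfolding mu_sum_simps by (auto simp: PiE_iff)
      obtain f where f: "f \<in> C_int X" "mean f = r" "\<forall>i\<in>{1..N}. r i = 0 \<longrightarrow> restr i f = (\<lambda>x. 0)"
        using glue[OF r'(1)] by blast
      have "ev_nonneg f"
      proof (rule ev_nonnegI[OF f(1)])
        fix i assume i: "i \<in> {1..N}"
        then have "I (restr i f) = r i" using f(2) mean_eq by metis
        then show "0 < I (restr i f) \<or> restr i f = (\<lambda>x. 0)" using r'(2)[OF i] f(3) i by force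
      qed
      then have "cls f \<in> poscone (DG X \<sigma>)" using DG_pos[OF f(1)] by simp
      then show "r \<in> class_mean ` poscone (DG X \<sigma>)"
        using class_mean_cls[OF f(1)] f(2) by (metis imageI)
    qed
  qed
  note quot = cone_quotient[OF G mu_sum_group hom onto ker cone]
  obtain \<Psi> where \<Psi>: "\<Psi> \<in> cone_iso (og_quotient (DG X \<sigma>) (DG_inf X \<sigma>)) mu_sum"
    "\<forall>A\<in>carrier (DG X \<sigma>). \<Psi> (DG_inf X \<sigma> #>\<^bsub>DG X \<sigma>\<^esub> A) = class_mean A" using quot(2) by blast
  have "\<Psi> (mod_inf_class X \<sigma> f) = mean f" if "f \<in> C_int X" for f
    using \<Psi>(2) class_mean_cls[OF that] that unfolding DG_carrier mod_inf_class_def by simp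
  then show ?thesis using quot(1) \<Psi>(1) unfolding DG_mod_inf_def by blast
qed

text \<open>The argument for the whole group repeats on one piece, with the integral itself as
  homomorphism.\<close>

lemma \<psi>_exists:
  assumes i: "i \<in> {1..N}"
  shows "cone_group (DG_part_mod_inf X \<sigma> (Y i)) \<and>
    (\<exists>\<psi>\<in>cone_iso (DG_part_mod_inf X \<sigma> (Y i)) (mu_part X \<sigma> \<mu> (Y i)).
       \<forall>f\<in>supp_in (Y i). \<psi> (part_mod_inf_class X \<sigma> (Y i) f) = I f)"
proof -
  let ?G = "DG_part X \<sigma> (Y i)" and ?K = "real_og (M i)"
  have ci: "class_integral \<mu> (cls f) = I f" if "f \<in> supp_in (Y i)" for f
    using class_integral_cls supp_in_C that by blast
  have hom: "class_integral \<mu> \<in> hom ?G ?K"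
  proof (rule homI)
    fix A assume "A \<in> carrier ?G"
    then obtain f where "f \<in> supp_in (Y i)" "A = cls f" by (auto simp: DG_part_simps)
    then show "class_integral \<mu> A \<in> carrier ?K" using ci by (simp add: real_og_def M_def)
  next
    fix A B assume "A \<in> carrier ?G" "B \<in> carrier ?G"
    then obtain f g where fg: "f \<in> supp_in (Y i)" "g \<in> supp_in (Y i)" "A = cls f" "B = cls g"
      by (auto simp: DG_part_simps)
    then show "class_integral \<mu> (A \<otimes>\<^bsub>?G\<^esub> B) = class_integral \<mu> A \<otimes>\<^bsub>?K\<^esub> class_integral \<mu> B"
      using I_add[of f g] supp_in_C by (simp add: DG_part_mult ci supp_in_add real_og_def)
  qed
  have onto: "class_integral \<mu> ` carrier ?G = carrier ?K"
    unfolding DG_part_simps real_og_def M_def using ci by (auto simp: image_image)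
  have ker: "DG_part_inf X \<sigma> (Y i) = kernel ?G ?K (class_integral \<mu>)"
  proof -
    have "DG_part_inf X \<sigma> (Y i) \<subseteq> carrier ?G" by (auto simp: DG_part_inf_def infinitesimals_def)
    then show ?thesis using DG_part_inf_iff[OF i] ci unfolding kernel_def DG_part_simps
      by (auto simp: real_og_def)
  qed
  have cone: "class_integral \<mu> ` poscone ?G = poscone ?K"
  proof
    show "class_integral \<mu> ` poscone ?G \<subseteq> poscone ?K"
    proof
      fix r assume "r \<in> class_integral \<mu> ` poscone ?G"
      then obtain f where f: "f \<in> supp_in (Y i)" "ev_nonneg f" "r = I f"
        using ci unfolding DG_part_poscone by auto
      have "0 \<le> I (restr i f)" using ev_nonneg_imp[OF supp_in_C[OF f(1)] f(2) i] .
      then show "r \<in> poscone ?K" using f supp_in_restr[OF f(1)] by (simp add: real_og_def M_def)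
    qed
    show "poscone ?K \<subseteq> class_integral \<mu> ` poscone ?G"
    proof
      fix r assume "r \<in> poscone ?K"
      then obtain f where f: "f \<in> supp_in (Y i)" "r = I f" "0 \<le> r" by (auto simp: real_og_def M_def)
      \<comment> \<open>The value 0 is represented by the zero function; a positive value may be
        represented by any preimage.\<close>
      have "\<exists>g\<in>supp_in (Y i). I g = r \<and> ev_nonneg g"
      proof (cases "r = 0")
        case True
        have "ev_nonneg (\<lambda>x. 0)" by (auto simp: ev_nonneg_def transfer_pow_zero)
        then show ?thesis using True I_zero supp_in_zero by (intro bexI[of _ "\<lambda>x. 0"]) auto
      next
        case False
        have "ev_nonneg f"
        proof (rule ev_nonnegI[OF supp_in_C[OF f(1)]])
          fix j assume j: "j \<in> {1..N}"
          show "0 < I (restr j f) \<or> restr j f = (\<lambda>x. 0)"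
            using restr_other[OF i j _ f(1)] supp_in_restr[OF f(1)] f(2,3) False by (cases "j = i") auto
        qed
        then show ?thesis using f by blast
      qed
      then obtain g where "g \<in> supp_in (Y i)" "I g = r" "ev_nonneg g" by blast
      then show "r \<in> class_integral \<mu> ` poscone ?G" using ci unfolding DG_part_poscone by force
    qed
  qed
  note quot = cone_quotient[OF DG_part_cone M_group hom onto ker cone]
  obtain \<psi> where \<psi>: "\<psi> \<in> cone_iso (og_quotient ?G (DG_part_inf X \<sigma> (Y i))) ?K"
    "\<forall>A\<in>carrier ?G. \<psi> (DG_part_inf X \<sigma> (Y i) #>\<^bsub>?G\<^esub> A) = class_integral \<mu> A" using quot(2) by blast
  have "\<psi> (part_mod_inf_class X \<sigma> (Y i) f) = I f" if "f \<in> supp_in (Y i)" for f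
    using \<psi>(2) ci[OF that] that unfolding DG_part_simps part_mod_inf_class_def by simp
  then show ?thesis using quot(1) \<psi>(1) unfolding DG_part_mod_inf_def mu_part_eq by blast
qed

text \<open>The part of \<open>L f\<close> on a piece is the transfer of the part of f on the
  preceding piece, with integral multiplied by s.\<close>

lemma mean_L:
  assumes f: "f \<in> C_int X"
  shows "mean (L f) = scaled_shift N s (mean f)"
proof
  fix i
  show "mean (L f) i = scaled_shift N s (mean f) i"
  proof (cases "i \<in> {1..N}")
    case True
    define j where "j = (if i = 1 then N else i - 1)"
    have j: "j \<in> {1..N}" "succ j = i" using True succ_pred[OF True] by (auto simp: j_def)
    have "I (restr i (L f)) = s * I (restr j f)"
      using L_restr[OF j(1), of f] I_L[OF C_restr[OF j(1) f]] j(2) by simp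
    moreover have "scaled_shift N s (mean f) i = s * mean f j"
      unfolding scaled_shift_def j_def restrict_apply using True by (simp only: if_True)
    ultimately show ?thesis using mean_eq[OF True] mean_eq[OF j(1)] by simp
  next
    case False
    then show ?thesis unfolding mean_def scaled_shift_def restrict_apply by (simp only: if_False)
  qed
qed

end

context variation_system
begin

text \<open>Only \<Psi> and \<Theta> come from quotients. \<Phi> is \<Psi> followed by the inverse
  of \<Theta>, and \<Lambda> is the shift conjugated by \<Psi>; both are isomorphisms by
  construction, and only their values on classes remain to be computed.\<close>

lemma quotient_isomorphisms:
  shows
    "\<exists>\<Phi> \<Theta> \<Psi> \<Lambda>.
       \<Phi> \<in> og_iso (DG_mod_inf X \<sigma>) (og_sum {1..N} (\<lambda>i. DG_part_mod_inf X \<sigma> (Y i))) \<and>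
       (\<forall>f\<in>C_int X. \<Phi> (mod_inf_class X \<sigma> f) =
          (\<lambda>i\<in>{1..N}. part_mod_inf_class X \<sigma> (Y i) (\<lambda>x. f x * indicator (Y i) x))) \<and>
       \<Theta> \<in> og_iso (og_sum {1..N} (\<lambda>i. DG_part_mod_inf X \<sigma> (Y i)))
                  (og_sum {1..N} (\<lambda>i. mu_part X \<sigma> \<mu> (Y i))) \<and>
       (\<forall>f\<in>C_int X.
          \<Theta> (\<lambda>i\<in>{1..N}. part_mod_inf_class X \<sigma> (Y i) (\<lambda>x. f x * indicator (Y i) x)) =
          (\<lambda>i\<in>{1..N}. \<integral>x. of_int (f x * indicator (Y i) x) \<partial>\<mu>)) \<and>
       \<Psi> \<in> og_iso (DG_mod_inf X \<sigma>) (og_sum {1..N} (\<lambda>i. mu_part X \<sigma> \<mu> (Y i))) \<and>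
       (\<forall>f\<in>C_int X. \<Psi> (mod_inf_class X \<sigma> f) =
          (\<lambda>i\<in>{1..N}. \<integral>x. of_int (f x * indicator (Y i) x) \<partial>\<mu>)) \<and>
       \<Lambda> \<in> og_iso (DG_mod_inf X \<sigma>) (DG_mod_inf X \<sigma>) \<and>
       (\<forall>f\<in>C_int X. \<Lambda> (mod_inf_class X \<sigma> f) = mod_inf_class X \<sigma> (transfer X \<sigma> f)) \<and>
       scaled_shift N s \<in> og_iso (og_sum {1..N} (\<lambda>i. mu_part X \<sigma> \<mu> (Y i)))
                                 (og_sum {1..N} (\<lambda>i. mu_part X \<sigma> \<mu> (Y i))) \<and>
       (\<forall>q\<in>carrier (DG_mod_inf X \<sigma>). \<Psi> (\<Lambda> q) = scaled_shift N s (\<Psi> q))"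
proof -
  obtain \<Psi> where G: "cone_group (DG_mod_inf X \<sigma>)" and \<Psi>: "\<Psi> \<in> cone_iso (DG_mod_inf X \<sigma>) mu_sum"
    and \<Psi>_eq: "\<And>f. f \<in> C_int X \<Longrightarrow> \<Psi> (mod_inf_class X \<sigma> f) = mean f"
    using \<Psi>_exists by blast
  define Q where "Q i \<psi> \<longleftrightarrow> \<psi> \<in> cone_iso (DG_part_mod_inf X \<sigma> (Y i)) (mu_part X \<sigma> \<mu> (Y i)) \<and>
    (\<forall>f\<in>supp_in (Y i). \<psi> (part_mod_inf_class X \<sigma> (Y i) f) = I f)" for i \<psi>
  define \<psi> where "\<psi> i = (SOME \<psi>. Q i \<psi>)" for i
  have "Q i (\<psi> i)" if "i \<in> {1..N}" for i
  proof -
    have "\<exists>\<psi>. Q i \<psi>" using \<psi>_exists[OF that] unfolding Q_def by blast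
    then show ?thesis unfolding \<psi>_def by (rule someI_ex)
  qed
  then have \<psi>: "\<And>i. i \<in> {1..N} \<Longrightarrow> \<psi> i \<in> cone_iso (DG_part_mod_inf X \<sigma> (Y i)) (mu_part X \<sigma> \<mu> (Y i))"
    "\<And>i f. i \<in> {1..N} \<Longrightarrow> f \<in> supp_in (Y i) \<Longrightarrow> \<psi> i (part_mod_inf_class X \<sigma> (Y i) f) = I f"
    unfolding Q_def by blast+
  define \<Theta> where "\<Theta> x = (\<lambda>i\<in>{1..N}. \<psi> i (x i))" for x
  have part: "cone_group part_sum" using \<psi>_exists by (intro cone_group_sum) blast
  have \<Theta>: "\<Theta> \<in> cone_iso part_sum mu_sum"
    unfolding \<Theta>_def using \<psi>(1) \<psi>_exists by (intro cone_iso_sum) blast+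
  define parts where "parts f = (\<lambda>i\<in>{1..N}. part_mod_inf_class X \<sigma> (Y i) (restr i f))" for f
  have \<Theta>_eq: "\<Theta> (parts f) = mean f" if f: "f \<in> C_int X" for f
  proof
    show "\<Theta> (parts f) i = mean f i" for i
      using \<psi>(2)[of i "restr i f"] restr_in[OF _ f, of i] by (simp add: \<Theta>_def parts_def mean_def)
  qed
  have parts_in: "parts f \<in> carrier part_sum" if f: "f \<in> C_int X" for f
  proof -
    have "part_mod_inf_class X \<sigma> (Y i) (restr i f) \<in> carrier (DG_part_mod_inf X \<sigma> (Y i))" if i: "i \<in> {1..N}" for i
      using restr_in[OF i f] unfolding part_mod_inf_class_def DG_part_mod_inf_def og_quotient_def
      by (simp add: FactGroup_def RCOSETS_def DG_part_simps) blast
    then show ?thesis by (simp add: og_sum_def parts_def)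
  qed
  define \<Phi> where "\<Phi> = inv_into (carrier part_sum) \<Theta> \<circ> \<Psi>"
  have \<Phi>: "\<Phi> \<in> cone_iso (DG_mod_inf X \<sigma>) part_sum"
    unfolding \<Phi>_def by (rule cone_iso_comp[OF \<Psi> cone_iso_inv[OF part \<Theta>]])
  have bij: "inj_on \<Theta> (carrier part_sum)" "bij_betw \<Psi> (carrier (DG_mod_inf X \<sigma>)) (carrier mu_sum)"
    using \<Theta> \<Psi> by (auto simp: cone_iso_def iso_def bij_betw_def)
  have \<Phi>_eq: "\<Phi> (mod_inf_class X \<sigma> f) = parts f" if "f \<in> C_int X" for f
    using inv_into_f_f[OF bij(1) parts_in[OF that]] by (simp add: \<Phi>_def \<Psi>_eq[OF that] \<Theta>_eq[OF that])
  define \<Lambda> where "\<Lambda> = inv_into (carrier (DG_mod_inf X \<sigma>)) \<Psi> \<circ> (scaled_shift N s \<circ> \<Psi>)"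
  have \<Lambda>: "\<Lambda> \<in> cone_iso (DG_mod_inf X \<sigma>) (DG_mod_inf X \<sigma>)"
    unfolding \<Lambda>_def by (rule cone_iso_comp[OF cone_iso_comp[OF \<Psi> shift_iso] cone_iso_inv[OF G \<Psi>]])
  have class_in: "mod_inf_class X \<sigma> f \<in> carrier (DG_mod_inf X \<sigma>)" if f: "f \<in> C_int X" for f
    unfolding mod_inf_class_def DG_mod_inf_def og_quotient_def
    using f by (simp add: FactGroup_def RCOSETS_def DG_carrier) blast
  have \<Lambda>_eq: "\<Lambda> (mod_inf_class X \<sigma> f) = mod_inf_class X \<sigma> (L f)" if f: "f \<in> C_int X" for f
  proof -
    have "scaled_shift N s (\<Psi> (mod_inf_class X \<sigma> f)) = \<Psi> (mod_inf_class X \<sigma> (L f))"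
      using \<Psi>_eq[OF f] \<Psi>_eq[OF C_L[OF f]] mean_L[OF f] by simp
    then show ?thesis
      using inv_into_f_f[OF bij_betw_imp_inj_on[OF bij(2)] class_in[OF C_L[OF f]]] by (simp add: \<Lambda>_def)
  qed
  have conj: "\<Psi> (\<Lambda> q) = scaled_shift N s (\<Psi> q)" if q: "q \<in> carrier (DG_mod_inf X \<sigma>)" for q
  proof -
    have "\<Psi> q \<in> carrier mu_sum" using bij_betwE[OF bij(2)] q by blast
    moreover have "bij_betw (scaled_shift N s) (carrier mu_sum) (carrier mu_sum)"
      using shift_iso by (simp add: cone_iso_def iso_def)
    ultimately have "scaled_shift N s (\<Psi> q) \<in> carrier mu_sum" using bij_betwE by blast
    then have "scaled_shift N s (\<Psi> q) \<in> \<Psi> ` carrier (DG_mod_inf X \<sigma>)"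
      using bij(2) by (simp add: bij_betw_def)
    then show ?thesis unfolding \<Lambda>_def o_apply by (rule f_inv_into_f)
  qed
  have mean: "(\<lambda>i\<in>{1..N}. \<integral>x. of_int (f x * indicator (Y i) x) \<partial>\<mu>) = mean f" for f
    by (simp add: mean_def I_def restr_def)
  show ?thesis
    unfolding mean
    using cone_iso_og_iso[OF G part \<Phi>] \<Phi>_eq cone_iso_og_iso[OF part mu_sum_group \<Theta>] \<Theta>_eq
      cone_iso_og_iso[OF G mu_sum_group \<Psi>] \<Psi>_eq cone_iso_og_iso[OF G G \<Lambda>] \<Lambda>_eq
      cone_iso_og_iso[OF mu_sum_group mu_sum_group shift_iso] conj
    unfolding parts_def restr_def
    by (intro exI[of _ \<Phi>] exI[of _ \<Theta>] exI[of _ \<Psi>] exI[of _ \<Lambda>] conjI ballI)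
qed

end

section \<open>Verification for the interval map\<close>

context interval_map
begin

text \<open>J contains an unsplit x, and equality of the images gives \<open>x'\<close> in J' with
  the same value under \<tau>. Invariance of \<open>S\<close> makes \<open>x'\<close> unsplit as
  well, so two distinct points of X have the same image.\<close>

lemma not_inj:
  assumes "\<not> essentially_injective \<tau> n a"
  shows "\<not> inj_on \<sigma> (topspace X)"
proof -
  define P where "P = partition_set n a"
  obtain J J' where J: "J \<subseteq> {0..1}" "J' \<subseteq> {0..1}" "nondegenerate_interval J" "J \<inter> J' = {}"
    "\<tau> ` (J - P) = \<tau> ` (J' - P)"
    using assms unfolding essentially_injective_def P_def by blast
  have P: "P \<subseteq> S" using a_in_S by (auto simp: P_def partition_set_def)
  obtain c d where cd: "c \<in> J" "d \<in> J" "c < d" "is_interval J"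
    using J(3) by (auto simp: nondegenerate_interval_def)
  obtain x where x: "c < x" "x < d" "x \<notin> S" using dense_I0[OF cd(3)] .
  have "x \<in> J" using cd x unfolding is_interval_1 by (meson less_imp_le)
  then have "\<tau> x \<in> \<tau> ` (J - P)" "x \<in> {0..1}" using x(3) P J(1) by blast+
  then obtain x' where x': "x' \<in> J' - P" "\<tau> x' = \<tau> x" unfolding J(5) by (metis imageE)
  have unit: "x' \<in> {0..1}" using x' J(2) by blast
  have "x' \<noteq> a i" if "i \<le> n" for i using x'(1) that by (auto simp: P_def partition_set_def)
  then have "x' \<noteq> 0" "x' \<noteq> 1" and ne: "\<And>i. i < n \<Longrightarrow> x' \<noteq> a i" using a_0 a_n by (metis le0 order_refl less_imp_le)+
  then obtain i where i: "i < n" "lap_side i 1 x'" using ex_lap_side[of 1 x'] unit by auto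
  then have int: "a i < x'" "x' < a (Suc i)" using ne[OF i(1)] by (auto simp: lap_side_def)
  have "\<tau> x \<notin> S" using \<tau>_I0(2) \<open>x \<in> {0..1}\<close> x(3) by blast
  then have "x' \<notin> S" using S_forward[OF i(1), of x'] branch_eq[OF int] int x'(2) by auto
  then have "\<sigma> (x', 0) = \<sigma> (x, 0)" using \<sigma>_I0 unit \<open>x \<in> {0..1}\<close> x(3) x'(2) by simp
  moreover have "(x, 0) \<noteq> (x', 0::int)" using x'(1) \<open>x \<in> J\<close> J(4) by auto
  ultimately show ?thesis
    using I0_point[OF unit \<open>x' \<notin> S\<close>] I0_point[OF \<open>x \<in> {0..1}\<close> x(3)] by (auto simp: inj_on_def)
qed

end

context interval_cycle
begin

lemma ctrl_mono: "ctrl f B \<Longrightarrow> B \<le> B' \<Longrightarrow> ctrl f B'"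
  unfolding ctrl_def by (meson order_trans)

lemma ctrl_lip:
  assumes "ctrl f B" and gf: "\<And>x y. \<bar>g x - g y\<bar> \<le> \<bar>f x - f y\<bar>"
  shows "ctrl g B"
proof -
  obtain \<nu> where \<nu>: "charge \<nu>" "controls \<nu> f UNIV" "\<nu> UNIV \<le> B" using assms(1) by (auto simp: ctrl_def)
  have "controls \<nu> g UNIV" unfolding controls_def
  proof (intro ballI impI)
    fix x y assume "x \<in> J0 \<inter> UNIV" "y \<in> J0 \<inter> UNIV" "x < y"
    then have "of_int \<bar>f (y, 0) - f (x, 0)\<bar> \<le> \<nu> {x..y}" using \<nu>(2) by (simp add: controls_def)
    moreover have "of_int \<bar>g (y, 0) - g (x, 0)\<bar> \<le> (of_int \<bar>f (y, 0) - f (x, 0)\<bar> :: real)"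
      using gf by (simp only: of_int_le_iff)
    ultimately show "of_int \<bar>g (y, 0) - g (x, 0)\<bar> \<le> \<nu> {x..y}" by linarith
  qed
  then show ?thesis using \<nu> unfolding ctrl_def by blast
qed

lemma variation_system:
  assumes s: "1 < s"
  shows "variation_system X \<sigma> lap n s \<mu> N Y ctrl"
proof (rule variation_system.intro[OF laps.exact_lap_system_axioms variation_system_axioms.intro])
  show "1 < s" by (rule s)
  show "\<exists>B. ctrl f B" if "f \<in> C_int X" for f using that by (rule ctrl_ex)
  show "ctrl f B'" if "ctrl f B" "B \<le> B'" for f B B' using that by (rule ctrl_mono)
  show "ctrl g B" if "ctrl f B" "\<And>x y. \<bar>g x - g y\<bar> \<le> \<bar>f x - f y\<bar>" for f g B using that by (rule ctrl_lip)
qed (rule ctrl_L_pow ctrl_sup ctrl_floor[OF s]; assumption)+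

end

theorem proposition5p7:
  fixes \<tau> :: "real \<Rightarrow> real" and n :: nat and a :: "nat \<Rightarrow> real"
    and X :: "(real \<times> int) topology" and \<sigma> :: "real \<times> int \<Rightarrow> real \<times> int"
    and N :: nat and Xs :: "nat \<Rightarrow> (real \<times> int) set"
    and \<mu> :: "(real \<times> int) measure" and s :: real
  assumes "piecewise_monotonic \<tau>" and "associated_partition \<tau> n a"
    and "transitive_map \<tau> n a" and "\<not> essentially_injective \<tau> n a"
    and X: "X = X_top \<tau> n a"
    and "associated_local_homeo \<tau> n a \<sigma>"
    and "exact_cycle X \<sigma> N Xs"
    and "scaled_measure X \<sigma> s \<mu>"
  shows
    "\<exists>\<Phi> \<Theta> \<Psi> \<Lambda>.
       \<Phi> \<in> og_iso (DG_mod_inf X \<sigma>) (og_sum {1..N} (\<lambda>i. DG_part_mod_inf X \<sigma> (Xs i))) \<and>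
       (\<forall>f\<in>C_int X. \<Phi> (mod_inf_class X \<sigma> f) =
          (\<lambda>i\<in>{1..N}. part_mod_inf_class X \<sigma> (Xs i) (\<lambda>x. f x * indicator (Xs i) x))) \<and>
       \<Theta> \<in> og_iso (og_sum {1..N} (\<lambda>i. DG_part_mod_inf X \<sigma> (Xs i)))
                  (og_sum {1..N} (\<lambda>i. mu_part X \<sigma> \<mu> (Xs i))) \<and>
       (\<forall>f\<in>C_int X.
          \<Theta> (\<lambda>i\<in>{1..N}. part_mod_inf_class X \<sigma> (Xs i) (\<lambda>x. f x * indicator (Xs i) x)) =
          (\<lambda>i\<in>{1..N}. \<integral>x. of_int (f x * indicator (Xs i) x) \<partial>\<mu>)) \<and>
       \<Psi> \<in> og_iso (DG_mod_inf X \<sigma>) (og_sum {1..N} (\<lambda>i. mu_part X \<sigma> \<mu> (Xs i))) \<and>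
       (\<forall>f\<in>C_int X. \<Psi> (mod_inf_class X \<sigma> f) =
          (\<lambda>i\<in>{1..N}. \<integral>x. of_int (f x * indicator (Xs i) x) \<partial>\<mu>)) \<and>
       \<Lambda> \<in> og_iso (DG_mod_inf X \<sigma>) (DG_mod_inf X \<sigma>) \<and>
       (\<forall>f\<in>C_int X. \<Lambda> (mod_inf_class X \<sigma> f) = mod_inf_class X \<sigma> (transfer X \<sigma> f)) \<and>
       scaled_shift N s \<in> og_iso (og_sum {1..N} (\<lambda>i. mu_part X \<sigma> \<mu> (Xs i)))
                                 (og_sum {1..N} (\<lambda>i. mu_part X \<sigma> \<mu> (Xs i))) \<and>
       (\<forall>q\<in>carrier (DG_mod_inf X \<sigma>). \<Psi> (\<Lambda> q) = scaled_shift N s (\<Psi> q))"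
proof -
  interpret interval_cycle \<tau> n a \<sigma> s \<mu> N Xs
    using assms unfolding X piecewise_monotonic_def associated_partition_def
    by unfold_locales auto
  \<comment> \<open>Failure of essential injectivity enters here, as expansion.\<close>
  have "1 < s" using laps.s_gt_1 not_inj assms(4) by blast
  then interpret V: variation_system "X_top \<tau> n a" \<sigma> lap n s \<mu> N Xs ctrl
    by (rule variation_system)
  show ?thesis unfolding X by (rule V.quotient_isomorphisms)
qed

end
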